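(* Let $K$ be an algebraic function field over a field $k$, let $\nu$ be an Abhyankar valuation of $K/k$, and let $R$ be a regular algebraic local ring of $K$ which is dominated by $\nu$ and which, with a regular system of parameters $x_{1,1},\ldots,x_{t,r_t}$, satisfies conditions (A1) and (A2) of the context. 1) Suppose that $0\ne f\in R$. Then there exists a sequence of primitive transforms $R\rightarrow R(1)$ along $\nu$ such that $R(1)$, with the resulting very good parameters $x_{1,1}(1),\ldots,x_{t,r_t}(1)$, satisfies (A1) and (A2), and $$f=x_{1,1}(1)^{a_{1,1}}\cdots x_{t,r_t}(1)^{a_{t,r_t}}u$$ where $a_{1,1},\ldots,a_{t,r_t}\in\mathbb{N}$ and $u\in R(1)$ is a unit. 2) Suppose that $I\subset R$ is a nonzero ideal. Then there exist a sequence of primitive transforms $R\rightarrow R(1)$ along $\nu$ and $a_{1,1},\ldots,a_{t,r_t}\in\mathbb{N}$ such that $$IR(1)=x_{1,1}(1)^{a_{1,1}}\cdots x_{t,r_t}(1)^{a_{t,r_t}}R(1),$$ where $x_{1,1}(1),\ldots,x_{t,r_t}(1)$ are the resulting very good parameters of $R(1)$. 3) Suppose that $0\ne f\in V_\nu$. Then there exists a sequence of primitive transforms $R\rightarrow R(1)$ along $\nu$ such that $$f=x_{1,1}(1)^{a_{1,1}}\cdots x_{t,r_t}(1)^{a_{t,r_t}}u$$ where $x_{1,1}(1),\ldots,x_{t,r_t}(1)$ are the resulting very good parameters of $R(1)$, $a_{1,1},\ldots,a_{t,r_t}\in\mathbb{N}$ and $u\in R(1)$ is a unit.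
   Context: $\mathbb{N}$ denotes the non-negative integers. An algebraic function field $K$ over $k$ is a finitely generated field extension. A valuation of $K/k$ is a valuation of $K$ that is trivial on $k$. For a valuation $\nu$ of $K/k$, $V_\nu$ is its valuation ring, $m_\nu$ the maximal ideal, $\Gamma_\nu$ the value group. Let $t$ be the rank of $\nu$, let $(0)=P_{t+1}^{\nu}\subset P_t^{\nu}\subset\cdots\subset P_1^{\nu}=m_\nu$ be the chain of prime ideals of $V_\nu$, and let $0=\Gamma_0\subset\Gamma_1\subset\cdots\subset\Gamma_t=\Gamma_\nu$ be the chain of isolated (convex) subgroups. For $1\le i\le t$, $\nu_i$ is the valuation of $K$ with valuation ring $V_{\nu_i}=(V_\nu)_{P_i^\nu}$; its maximal ideal is $m_{\nu_i}=P_i^\nu V_{\nu_i}$ and its value group is $\Gamma_\nu/\Gamma_{i-1}$; in particular $\nu_1=\nu$. The valuation $\nu$ is Abhyankar if equality holds in Abhyankar's inequality $\operatorname{rrank}\nu+\operatorname{trdeg}_k V_\nu/m_\nu\le \operatorname{trdeg}_k K$, where $\operatorname{rrank}\nu=\dim_{\mathbb{Q}}(\Gamma_\nu\otimes_{\mathbb{Z}}\mathbb{Q})$. An algebraic local ring of $K$ is a local domain which is essentially of finite type over $k$ (a localization of a finitely generated $k$-algebra) and whose quotient field is $K$. The valuation $\nu$ dominates a local ring $R\subset V_\nu$ if $m_\nu\cap R=m_R$. A regular prime ideal $P$ of a Noetherian local ring $R$ is a prime ideal such that $R/P$ is a regular local ring. The conditions on a regular algebraic local ring $R$ of $K$ dominated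 by $\nu$, with regular system of parameters $x_{1,1},\ldots,x_{1,r_1},\ldots,x_{t,1},\ldots,x_{t,r_t}$, are: (A1) for $1\le j\le t$, $\nu_j(x_{j,1}),\ldots,\nu_j(x_{j,r_j})$ is a $\mathbb{Z}$-basis of $\Gamma_j/\Gamma_{j-1}$, and $P_j(R)=P_j^\nu\cap R$ is the regular prime ideal $(x_{j,1},\ldots,x_{t,r_t})$ generated by all $x_{a,b}$ with $a\ge j$; (A2) for $1\le i\le t$, $(R/P_i(R))_{P_i(R)}\cong (V_\nu/P_i^\nu)_{P_i^\nu}\cong V_{\nu_i}/m_{\nu_i}$, where $(A/P)_P$ denotes the quotient field of $A/P$. A regular system of parameters $z_{1,1},\ldots,z_{t,r_t}$ of a regular algebraic local ring $A$ of $K$ dominated by $\nu$ is called very good if $\nu_j(z_{j,1}),\ldots,\nu_j(z_{j,r_j})$ is a $\mathbb{Z}$-basis of $\Gamma_j/\Gamma_{j-1}$ for $1\le j\le t$. Given such $A$ and very good parameters, a primitive transform $A\to A_1$ along $\nu$ is defined by choosing indices $(j,k)$, $(l,m)$ with $\nu(z_{j,k})>\nu(z_{l,m})$, setting $z_{j,k}=z_{j,k}(1)z_{l,m}$, and letting $A_1=A[z_{j,k}(1)]_\nu$ be the localization of $A[z_{j,k}(1)]$ at its prime ideal $m_\nu\cap A[z_{j,k}(1)]$. Then $A_1$ is a regular algebraic local ring of $K$ dominated by $\nu$, with very good regular system of parameters $z_{1,1}(1),\ldots,z_{t,r_t}(1)$, where $z_{\alpha,\beta}(1)=z_{\alpha,\beta}$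 for $(\alpha,\beta)\ne(j,k)$. A sequence of primitive transforms $R\to R(1)$ along $\nu$ is a finite (possibly empty) composition of these, starting with the given parameters $x_{1,1},\ldots,x_{t,r_t}$ of $R$ and using at each stage the parameters produced by the previous transform; the final parameters are the resulting very good parameters $x_{1,1}(1),\ldots,x_{t,r_t}(1)$ of $R(1)$. *)

theory Defs
  imports
    "HOL-Algebra.Algebra"
    "HOL-Algebra.Algebraic_Closure_Type"
    "HOL-Library.Extended_Nat"
begin

text \<open>
  The ambient field \<open>K\<close> is a type \<open>'a :: field\<close>, viewed as the HOL-Algebra field
  \<^const>\<open>ring_of_type_algebra\<close>; all rings between \<open>k\<close> and \<open>K\<close> are subsets of it.
\<close>

abbreviation ring_on :: "'a::field set \<Rightarrow> 'a ring" where
  "ring_on A \<equiv> ring_of_type_algebra\<lparr>carrier := A\<rparr>"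

definition adjoin :: "'a::field set \<Rightarrow> 'a set \<Rightarrow> 'a set" where
  "adjoin A T = generate_ring ring_of_type_algebra (A \<union> T)"

definition localize :: "'a::field set \<Rightarrow> 'a set \<Rightarrow> 'a set" where
  "localize A S = {a / s | a s. a \<in> A \<and> s \<in> S}"

definition algebraic_function_field :: "'a::field set \<Rightarrow> bool" where
  "algebraic_function_field k \<longleftrightarrow> subfield k ring_of_type_algebra \<and>
     (\<exists>T. finite T \<and> generate_field ring_of_type_algebra (k \<union> T) = UNIV)"


section \<open>Local rings and regularity\<close>

definition local_ring :: "('a, 'b) ring_scheme \<Rightarrow> bool" where
  "local_ring A \<longleftrightarrow> cring A \<and> (\<exists>!M. maximalideal M A)"

definition max_ideal :: "('a, 'b) ring_scheme \<Rightarrow> 'a set" where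
  "max_ideal A = (THE M. maximalideal M A)"

definition krull_dim :: "('a, 'b) ring_scheme \<Rightarrow> enat" where
  "krull_dim A = (SUP n \<in> {n. \<exists>p. (\<forall>i\<le>n. primeideal (p i) A) \<and> (\<forall>i<n. p i \<subset> p (Suc i))}. enat n)"

definition regular_local_ring :: "('a, 'b) ring_scheme \<Rightarrow> bool" where
  "regular_local_ring A \<longleftrightarrow> local_ring A \<and> noetherian_ring A \<and>
     (\<exists>S. finite S \<and> S \<subseteq> carrier A \<and> genideal A S = max_ideal A \<and> enat (card S) = krull_dim A)"

definition regular_prime :: "'a set \<Rightarrow> ('a, 'b) ring_scheme \<Rightarrow> bool" where
  "regular_prime P A \<longleftrightarrow> primeideal P A \<and> regular_local_ring (A Quot P)"

definition regular_parameters :: "('a, 'b) ring_scheme \<Rightarrow> 'i set \<Rightarrow> ('i \<Rightarrow> 'a) \<Rightarrow> bool" where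
  "regular_parameters A J x \<longleftrightarrow> finite J \<and> x \<in> J \<rightarrow> carrier A \<and>
     genideal A (x ` J) = max_ideal A \<and> enat (card J) = krull_dim A"

text \<open>
  A localization of an abstract finitely generated \<open>k\<close>-algebra that is a domain with quotient
  field \<open>K\<close> is also the localization of the image of that algebra in \<open>K\<close>, so
  finitely generated subalgebras of \<open>K\<close> suffice.
\<close>

definition algebraic_local_ring :: "'a::field set \<Rightarrow> 'a set \<Rightarrow> bool" where
  "algebraic_local_ring k A \<longleftrightarrow> subring A ring_of_type_algebra \<and> local_ring (ring_on A) \<and>
     (\<exists>T S. finite T \<and> S \<subseteq> adjoin k T \<and> submonoid S ring_of_type_algebra \<and> 0 \<notin> S \<and>
        A = localize (adjoin k T) S) \<and>
     (\<forall>c. \<exists>a\<in>A. \<exists>b\<in>A. b \<noteq> 0 \<and> c = a / b)"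


section \<open>Quotient field of a domain\<close>

definition frac_pairs :: "('a, 'b) ring_scheme \<Rightarrow> ('a \<times> 'a) set" where
  "frac_pairs D = carrier D \<times> (carrier D - {\<zero>\<^bsub>D\<^esub>})"

definition frac_class :: "('a, 'b) ring_scheme \<Rightarrow> 'a \<times> 'a \<Rightarrow> ('a \<times> 'a) set" where
  "frac_class D p = {q \<in> frac_pairs D. fst p \<otimes>\<^bsub>D\<^esub> snd q = fst q \<otimes>\<^bsub>D\<^esub> snd p}"

definition quotient_field :: "('a, 'b) ring_scheme \<Rightarrow> ('a \<times> 'a) set ring" where
  "quotient_field D =
     \<lparr>carrier = frac_class D ` frac_pairs D,
      monoid.mult = (\<lambda>u v. \<Union>p\<in>u. \<Union>q\<in>v.
               frac_class D (fst p \<otimes>\<^bsub>D\<^esub> fst q, snd p \<otimes>\<^bsub>D\<^esub> snd q)),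
      one = frac_class D (\<one>\<^bsub>D\<^esub>, \<one>\<^bsub>D\<^esub>),
      ring.zero = frac_class D (\<zero>\<^bsub>D\<^esub>, \<one>\<^bsub>D\<^esub>),
      add = (\<lambda>u v. \<Union>p\<in>u. \<Union>q\<in>v.
               frac_class D (fst p \<otimes>\<^bsub>D\<^esub> snd q \<oplus>\<^bsub>D\<^esub> fst q \<otimes>\<^bsub>D\<^esub> snd p,
                             snd p \<otimes>\<^bsub>D\<^esub> snd q))\<rparr>"

definition to_quotient_field :: "('a, 'b) ring_scheme \<Rightarrow> 'a \<Rightarrow> ('a \<times> 'a) set" where
  "to_quotient_field D a = frac_class D (a, \<one>\<^bsub>D\<^esub>)"


section \<open>Transcendence degree and rational rank\<close>

text \<open>
  The elements \<open>e\<close> of \<open>S \<rightarrow>\<^sub>E UNIV\<close> are the exponent vectors of monomials in \<open>S\<close>, so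
  \<open>E\<close> and \<open>c\<close> describe a polynomial over \<open>F\<close> in the elements of \<open>S\<close>.
\<close>

definition alg_independent :: "('a, 'b) ring_scheme \<Rightarrow> 'a set \<Rightarrow> 'a set \<Rightarrow> bool" where
  "alg_independent L F S \<longleftrightarrow> finite S \<and> S \<subseteq> carrier L \<and>
     (\<forall>(E :: ('a \<Rightarrow> nat) set) c. finite E \<longrightarrow> E \<subseteq> S \<rightarrow>\<^sub>E UNIV \<longrightarrow> c \<in> E \<rightarrow> F \<longrightarrow>
        (\<Oplus>\<^bsub>L\<^esub>e\<in>E. c e \<otimes>\<^bsub>L\<^esub> (\<Otimes>\<^bsub>L\<^esub>s\<in>S. s [^]\<^bsub>L\<^esub> e s)) = \<zero>\<^bsub>L\<^esub> \<longrightarrow> (\<forall>e\<in>E. c e = \<zero>\<^bsub>L\<^esub>))"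

definition trdeg :: "('a, 'b) ring_scheme \<Rightarrow> 'a set \<Rightarrow> enat" where
  "trdeg L F = (SUP S \<in> {S. alg_independent L F S}. enat (card S))"

text \<open>
  \<open>G \<otimes> \<rat>\<close> is the free abelian group on \<open>G \<times> \<rat>\<close> modulo the bilinearity relations,
  with \<open>\<rat>\<close> acting on the second factor.
\<close>

abbreviation tensor_gens :: "('g, 'm) monoid_scheme \<Rightarrow> ('g \<times> rat \<Rightarrow>\<^sub>0 int) monoid" where
  "tensor_gens G \<equiv> free_Abelian_group (carrier G \<times> UNIV)"

definition tensor_rels :: "('g, 'm) monoid_scheme \<Rightarrow> ('g \<times> rat \<Rightarrow>\<^sub>0 int) set" where
  "tensor_rels G = generate (tensor_gens G)
     ({frag_of (g \<otimes>\<^bsub>G\<^esub> h, q) - frag_of (g, q) - frag_of (h, q) | g h q.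
         g \<in> carrier G \<and> h \<in> carrier G} \<union>
      {frag_of (g, p + q) - frag_of (g, p) - frag_of (g, q) | g p q. g \<in> carrier G})"

definition rat_tensor :: "('g, 'm) monoid_scheme \<Rightarrow> ('g \<times> rat \<Rightarrow>\<^sub>0 int) set monoid" where
  "rat_tensor G = tensor_gens G Mod tensor_rels G"

definition rat_scale ::
  "('g, 'm) monoid_scheme \<Rightarrow> rat \<Rightarrow> ('g \<times> rat \<Rightarrow>\<^sub>0 int) set \<Rightarrow> ('g \<times> rat \<Rightarrow>\<^sub>0 int) set" where
  "rat_scale G c w =
     (\<Union>f\<in>w. tensor_rels G #>\<^bsub>tensor_gens G\<^esub> frag_extend (\<lambda>(g, q). frag_of (g, c * q)) f)"

definition rat_independent :: "('g, 'm) monoid_scheme \<Rightarrow> ('g \<times> rat \<Rightarrow>\<^sub>0 int) set set \<Rightarrow> bool" where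
  "rat_independent G B \<longleftrightarrow> finite B \<and> B \<subseteq> carrier (rat_tensor G) \<and>
     (\<forall>c. finprod (rat_tensor G) (\<lambda>b. rat_scale G (c b) b) B = \<one>\<^bsub>rat_tensor G\<^esub> \<longrightarrow>
        (\<forall>b\<in>B. c b = 0))"

definition rational_dim :: "('g, 'm) monoid_scheme \<Rightarrow> enat" where
  "rational_dim G = (SUP B \<in> {B. rat_independent G B}. enat (card B))"


section \<open>Valuations\<close>

text \<open>
  A valuation is a function on the nonzero elements of the field; \<open>\<nu> 0\<close>, conventionally
  \<open>\<infinity>\<close>, is an unspecified element of \<open>'g\<close> and is never used.  The value group is the
  image of \<open>\<nu>\<close>, which need not be all of \<open>'g\<close>.
\<close>

definition valuation_over :: "'a::field set \<Rightarrow> ('a \<Rightarrow> 'g::linordered_ab_group_add) \<Rightarrow> bool" where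
  "valuation_over k \<nu> \<longleftrightarrow>
     (\<forall>x y. x \<noteq> 0 \<longrightarrow> y \<noteq> 0 \<longrightarrow> \<nu> (x * y) = \<nu> x + \<nu> y) \<and>
     (\<forall>x y. x \<noteq> 0 \<longrightarrow> y \<noteq> 0 \<longrightarrow> x + y \<noteq> 0 \<longrightarrow> min (\<nu> x) (\<nu> y) \<le> \<nu> (x + y)) \<and>
     (\<forall>c\<in>k. c \<noteq> 0 \<longrightarrow> \<nu> c = 0)"

definition val_ring :: "('a::field \<Rightarrow> 'g::linordered_ab_group_add) \<Rightarrow> 'a set" where
  "val_ring \<nu> = {x. x = 0 \<or> 0 \<le> \<nu> x}"

definition val_ideal :: "('a::field \<Rightarrow> 'g::linordered_ab_group_add) \<Rightarrow> 'a set" where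
  "val_ideal \<nu> = {x. x = 0 \<or> 0 < \<nu> x}"

definition value_group :: "('a::field \<Rightarrow> 'g::linordered_ab_group_add) \<Rightarrow> 'g set" where
  "value_group \<nu> = \<nu> ` (UNIV - {0})"

abbreviation add_group_on :: "'g::ab_group_add set \<Rightarrow> 'g monoid" where
  "add_group_on H \<equiv> \<lparr>carrier = H, monoid.mult = (+), one = 0\<rparr>"

definition rational_rank :: "('a::field \<Rightarrow> 'g::linordered_ab_group_add) \<Rightarrow> enat" where
  "rational_rank \<nu> = rational_dim (add_group_on (value_group \<nu>))"

definition abhyankar :: "'a::field set \<Rightarrow> ('a \<Rightarrow> 'g::linordered_ab_group_add) \<Rightarrow> bool" where
  "abhyankar k \<nu> \<longleftrightarrow>
     rational_rank \<nu> +
       trdeg (ring_on (val_ring \<nu>) Quot val_ideal \<nu>)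
         ((\<lambda>c. val_ideal \<nu> +>\<^bsub>ring_on (val_ring \<nu>)\<^esub> c) ` k) =
     trdeg ring_of_type_algebra k"

definition isolated_subgroup :: "('a::field \<Rightarrow> 'g::linordered_ab_group_add) \<Rightarrow> 'g set \<Rightarrow> bool" where
  "isolated_subgroup \<nu> H \<longleftrightarrow> subgroup H (add_group_on (value_group \<nu>)) \<and>
     (\<forall>h\<in>H. \<forall>g\<in>value_group \<nu>. 0 \<le> g \<and> g \<le> h \<longrightarrow> g \<in> H)"

definition isolated_chain ::
  "('a::field \<Rightarrow> 'g::linordered_ab_group_add) \<Rightarrow> nat \<Rightarrow> (nat \<Rightarrow> 'g set) \<Rightarrow> bool" where
  "isolated_chain \<nu> t \<Gamma> \<longleftrightarrow> \<Gamma> 0 = {0} \<and> \<Gamma> t = value_group \<nu> \<and> (\<forall>i<t. \<Gamma> i \<subset> \<Gamma> (Suc i)) \<and>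
     {H. isolated_subgroup \<nu> H} = \<Gamma> ` {0..t}"

definition prime_chain ::
  "('a::field \<Rightarrow> 'g::linordered_ab_group_add) \<Rightarrow> nat \<Rightarrow> (nat \<Rightarrow> 'a set) \<Rightarrow> bool" where
  "prime_chain \<nu> t P \<longleftrightarrow> P 1 = val_ideal \<nu> \<and> P (Suc t) = {0} \<and> (\<forall>i\<in>{1..t}. P (Suc i) \<subset> P i) \<and>
     {Q. primeideal Q (ring_on (val_ring \<nu>))} = P ` {1..Suc t}"

definition dominates :: "('a::field \<Rightarrow> 'g::linordered_ab_group_add) \<Rightarrow> 'a set \<Rightarrow> bool" where
  "dominates \<nu> A \<longleftrightarrow> A \<subseteq> val_ring \<nu> \<and> val_ideal \<nu> \<inter> A = max_ideal (ring_on A)"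

text \<open>The composite valuation \<open>\<nu>\<^sub>i\<close>, with values in \<open>\<Gamma>\<^sub>\<nu> / \<Gamma>\<^bsub>i-1\<^esub>\<close>, and its valuation ring.\<close>

definition comp_val ::
  "('a::field \<Rightarrow> 'g::linordered_ab_group_add) \<Rightarrow> (nat \<Rightarrow> 'g set) \<Rightarrow> nat \<Rightarrow> 'a \<Rightarrow> 'g set" where
  "comp_val \<nu> \<Gamma> i x = \<Gamma> (i - 1) #>\<^bsub>add_group_on (value_group \<nu>)\<^esub> \<nu> x"

definition comp_ring ::
  "('a::field \<Rightarrow> 'g::linordered_ab_group_add) \<Rightarrow> (nat \<Rightarrow> 'a set) \<Rightarrow> nat \<Rightarrow> 'a set" where
  "comp_ring \<nu> P i = localize (val_ring \<nu>) (val_ring \<nu> - P i)"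

definition comp_ideal ::
  "('a::field \<Rightarrow> 'g::linordered_ab_group_add) \<Rightarrow> (nat \<Rightarrow> 'a set) \<Rightarrow> nat \<Rightarrow> 'a set" where
  "comp_ideal \<nu> P i = genideal (ring_on (comp_ring \<nu> P i)) (P i)"


section \<open>Conditions (A1), (A2) and very good parameters\<close>

text \<open>Parameters are indexed by the pairs \<open>(j, l)\<close> with \<open>1 \<le> j \<le> t\<close> and \<open>1 \<le> l \<le> r\<^sub>j\<close>.\<close>

definition param_index :: "nat \<Rightarrow> (nat \<Rightarrow> nat) \<Rightarrow> (nat \<times> nat) set" where
  "param_index t r = (SIGMA j:{1..t}. {1..r j})"

definition Z_basis :: "('g, 'm) monoid_scheme \<Rightarrow> 'i set \<Rightarrow> ('i \<Rightarrow> 'g) \<Rightarrow> bool" where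
  "Z_basis G I b \<longleftrightarrow> finite I \<and> b \<in> I \<rightarrow> carrier G \<and>
     (\<forall>g\<in>carrier G. \<exists>!n. n \<in> I \<rightarrow>\<^sub>E (UNIV :: int set) \<and> (\<Otimes>\<^bsub>G\<^esub>i\<in>I. b i [^]\<^bsub>G\<^esub> n i) = g)"

text \<open>That the parameters are nonzero is part of the requirement that their values lie in the value
  group.\<close>

definition value_bases ::
  "('a::field \<Rightarrow> 'g::linordered_ab_group_add) \<Rightarrow> nat \<Rightarrow> (nat \<Rightarrow> 'g set) \<Rightarrow> (nat \<Rightarrow> nat) \<Rightarrow>
   (nat \<times> nat \<Rightarrow> 'a) \<Rightarrow> bool" where
  "value_bases \<nu> t \<Gamma> r z \<longleftrightarrow> (\<forall>j\<in>{1..t}.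
     (\<forall>l\<in>{1..r j}. z (j, l) \<noteq> 0) \<and>
     Z_basis (add_group_on (\<Gamma> j) Mod \<Gamma> (j - 1)) {1..r j} (\<lambda>l. comp_val \<nu> \<Gamma> j (z (j, l))))"

definition very_good ::
  "'a::field set \<Rightarrow> ('a \<Rightarrow> 'g::linordered_ab_group_add) \<Rightarrow> nat \<Rightarrow> (nat \<Rightarrow> 'g set) \<Rightarrow> (nat \<Rightarrow> nat) \<Rightarrow>
   'a set \<Rightarrow> (nat \<times> nat \<Rightarrow> 'a) \<Rightarrow> bool" where
  "very_good k \<nu> t \<Gamma> r A z \<longleftrightarrow>
     algebraic_local_ring k A \<and> regular_local_ring (ring_on A) \<and> dominates \<nu> A \<and>
     regular_parameters (ring_on A) (param_index t r) z \<and> value_bases \<nu> t \<Gamma> r z"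

definition cond_A1 ::
  "('a::field \<Rightarrow> 'g::linordered_ab_group_add) \<Rightarrow> nat \<Rightarrow> (nat \<Rightarrow> 'g set) \<Rightarrow> (nat \<Rightarrow> 'a set) \<Rightarrow>
   (nat \<Rightarrow> nat) \<Rightarrow> 'a set \<Rightarrow> (nat \<times> nat \<Rightarrow> 'a) \<Rightarrow> bool" where
  "cond_A1 \<nu> t \<Gamma> P r A x \<longleftrightarrow> value_bases \<nu> t \<Gamma> r x \<and>
     (\<forall>j\<in>{1..t}. P j \<inter> A = genideal (ring_on A) (x ` {p \<in> param_index t r. j \<le> fst p}) \<and>
        regular_prime (P j \<inter> A) (ring_on A))"

text \<open>
  The isomorphisms are the canonical ones, i.e. those compatible with the inclusions of \<open>A\<close> in
  \<open>V\<^sub>\<nu>\<close> and of \<open>V\<^sub>\<nu>\<close> in \<open>V\<^bsub>\<nu>_i\<^esub>\<close>.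
\<close>

definition cond_A2 ::
  "('a::field \<Rightarrow> 'g::linordered_ab_group_add) \<Rightarrow> nat \<Rightarrow> (nat \<Rightarrow> 'a set) \<Rightarrow> 'a set \<Rightarrow> bool" where
  "cond_A2 \<nu> t P A \<longleftrightarrow> (\<forall>i\<in>{1..t}.
     let D = ring_on A Quot (P i \<inter> A);
         E = ring_on (val_ring \<nu>) Quot P i;
         F = ring_on (comp_ring \<nu> P i) Quot comp_ideal \<nu> P i
     in (\<exists>\<phi>\<in>ring_iso (quotient_field D) (quotient_field E). \<forall>a\<in>A.
           \<phi> (to_quotient_field D ((P i \<inter> A) +>\<^bsub>ring_on A\<^esub> a)) =
             to_quotient_field E (P i +>\<^bsub>ring_on (val_ring \<nu>)\<^esub> a)) \<and>
        (\<exists>\<psi>\<in>ring_iso (quotient_field E) F. \<forall>a\<in>val_ring \<nu>.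
           \<psi> (to_quotient_field E (P i +>\<^bsub>ring_on (val_ring \<nu>)\<^esub> a)) =
             comp_ideal \<nu> P i +>\<^bsub>ring_on (comp_ring \<nu> P i)\<^esub> a))"


section \<open>Primitive transforms\<close>

definition primitive_transform ::
  "'a::field set \<Rightarrow> ('a \<Rightarrow> 'g::linordered_ab_group_add) \<Rightarrow> nat \<Rightarrow> (nat \<Rightarrow> 'g set) \<Rightarrow> (nat \<Rightarrow> nat) \<Rightarrow>
   'a set \<times> (nat \<times> nat \<Rightarrow> 'a) \<Rightarrow> 'a set \<times> (nat \<times> nat \<Rightarrow> 'a) \<Rightarrow> bool" where
  "primitive_transform k \<nu> t \<Gamma> r = (\<lambda>(A, z) (A', z'). very_good k \<nu> t \<Gamma> r A z \<and>
     (\<exists>p\<in>param_index t r. \<exists>q\<in>param_index t r. \<nu> (z q) < \<nu> (z p) \<and>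
        z' = z(p := z p / z q) \<and>
        (let B = adjoin A {z' p} in A' = localize B (B - val_ideal \<nu>))))"

abbreviation transform_sequence ::
  "'a::field set \<Rightarrow> ('a \<Rightarrow> 'g::linordered_ab_group_add) \<Rightarrow> nat \<Rightarrow> (nat \<Rightarrow> 'g set) \<Rightarrow> (nat \<Rightarrow> nat) \<Rightarrow>
   'a set \<times> (nat \<times> nat \<Rightarrow> 'a) \<Rightarrow> 'a set \<times> (nat \<times> nat \<Rightarrow> 'a) \<Rightarrow> bool" where
  "transform_sequence k \<nu> t \<Gamma> r \<equiv> (primitive_transform k \<nu> t \<Gamma> r)\<^sup>*\<^sup>*"

end

theory Submission
  imports Defs
begin

text \<open>
  Let \<open>V\<close> be the valuation ring of \<open>\<nu>\<close> and \<open>P\<^sub>1 \<supset> \<dots> \<supset> P\<^bsub>t+1\<^esub> = 0\<close> its primes.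
  The argument about \<open>R\<close> rests on one property, called \<open>framed\<close> below: \<open>R\<close> is a Noetherian subring of
  \<open>V\<close> in which the elements of value \<open>0\<close> are units, the values of the parameters of level \<open>j\<close> form a basis
  of \<open>\<Gamma>\<^sub>j / \<Gamma>\<^bsub>j-1\<^esub>\<close>, and \<open>P\<^sub>j \<inter> R\<close> is generated by the parameters of level at least \<open>j\<close>.

  Why monomialization works.  Let \<open>f \<in> R - P\<^bsub>j+1\<^esub>\<close>.  Whenever a coefficient of an expansion of \<open>f\<close> in
  monomials lies in \<open>P\<^sub>j\<close>, it is itself a combination of parameters of level at least \<open>j\<close>, so the expansion
  can be pushed further; as \<open>\<Gamma>\<^sub>j / \<Gamma>\<^bsub>j-1\<^esub>\<close> has rank one this stops, and \<open>f = u m + \<dots>\<close>, where \<open>m\<close> is a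
  monomial in the parameters of level \<open>j\<close>, where \<open>u \<notin> P\<^sub>j\<close>, and where the finitely many other terms are
  multiples of monomials \<open>n\<close> for which \<open>n / m\<close> lies in \<open>P\<^sub>j\<close> (\<open>initial_form\<close>).  These \<open>n / m\<close> are
  Laurent monomials of positive value, and finitely many of those become genuine monomials after
  primitive transforms (\<open>principalize\<close>).  After the transforms \<open>f = m f'\<close> with \<open>f' \<notin> P\<^sub>j\<close>
  (\<open>reduce_level\<close>).  Since \<open>f \<notin> P\<^bsub>t+1\<^esub> = 0\<close>, descending through the levels leaves a cofactor
  outside \<open>P\<^sub>1\<close>, which is a unit.  The statements on ideals and on elements of \<open>V\<close> follow by
  monomializing generators, or numerator and denominator, and comparing the resulting monomials.

  Why primitive transforms keep a ring framed (\<open>framed_transform\<close>).  The delicate point is that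
  \<open>P\<^sub>j\<close> remains generated by parameters when \<open>z\<^sub>p\<close> is replaced by \<open>y = z\<^sub>p / z\<^sub>q\<close> with both levels below
  \<open>j\<close>.  A polynomial relation for \<open>y\<close> modulo \<open>P\<^sub>j\<close> can be lowered in degree as soon as \<open>z\<^sub>p\<close> is not a
  zero divisor modulo \<open>P\<^sub>j + (z\<^sub>q)\<close>.  If the parameters are adjoined one at a time, from the highest
  level to the lowest, all the ideals obtained are prime (\<open>framed_prime_seq\<close>), so they form a regular
  sequence, and a regular sequence in a Noetherian local ring can be permuted (\<open>prime_seq_permute\<close>).
  The primality comes from initial forms again: for a set \<open>S\<close> of parameters of level \<open>j\<close>, the
  elements whose initial form does not involve \<open>S\<close> are closed under multiplication, their
  complement is therefore a prime (\<open>closure_ideal_prime\<close>), and Nakayama's lemma shows that this prime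
  is \<open>(z\<^sub>S) + P\<^bsub>j+1\<^esub>\<close> (\<open>closure_eq_gens\<close>).

  Why framed rings are regular.  The same chain of primes bounds the dimension from below and
  Krull's height theorem bounds it from above, both for the ring and for its quotients by the
  \<open>P\<^sub>j\<close>; Noetherianity of the transforms is Hilbert's basis theorem.  Condition (A2) amounts to
  \<open>R / (P\<^sub>i \<inter> R)\<close> and \<open>V / P\<^sub>i\<close> having the same quotient field, which is inherited by every ring between \<open>R\<close>
  and \<open>V\<close> (\<open>quotient_field_iso_iff\<close>).
\<close>

section \<open>Ideals of subrings of a field\<close>

definition is_subring :: "'a::field set \<Rightarrow> bool" where
  "is_subring A \<longleftrightarrow> 1 \<in> A \<and> (\<forall>x\<in>A. \<forall>y\<in>A. x - y \<in> A \<and> x * y \<in> A)"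

definition submodule_of :: "'a::field set \<Rightarrow> 'a set \<Rightarrow> bool" where
  "submodule_of A M \<longleftrightarrow> 0 \<in> M \<and> (\<forall>x\<in>M. \<forall>y\<in>M. x + y \<in> M) \<and> (\<forall>a\<in>A. \<forall>x\<in>M. a * x \<in> M)"

definition is_ideal :: "'a::field set \<Rightarrow> 'a set \<Rightarrow> bool" where
  "is_ideal A I \<longleftrightarrow> submodule_of A I \<and> I \<subseteq> A"

definition is_prime :: "'a::field set \<Rightarrow> 'a set \<Rightarrow> bool" where
  "is_prime A p \<longleftrightarrow> is_ideal A p \<and> 1 \<notin> p \<and> (\<forall>a\<in>A. \<forall>b\<in>A. a * b \<in> p \<longrightarrow> a \<in> p \<or> b \<in> p)"

inductive_set lspan :: "'a::field set \<Rightarrow> 'a set \<Rightarrow> 'a set" for A and W where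
  lspan_zero: "0 \<in> lspan A W"
| lspan_step: "a \<in> A \<Longrightarrow> x \<in> W \<Longrightarrow> y \<in> lspan A W \<Longrightarrow> a * x + y \<in> lspan A W"

definition noeth :: "'a::field set \<Rightarrow> bool" where
  "noeth A \<longleftrightarrow> is_subring A \<and> (\<forall>I. is_ideal A I \<longrightarrow> (\<exists>W. finite W \<and> I = lspan A W))"

definition is_local :: "'a::field set \<Rightarrow> 'a set \<Rightarrow> bool" where
  "is_local A m \<longleftrightarrow> is_subring A \<and> is_ideal A m \<and> 1 \<notin> m \<and> (\<forall>x\<in>A - m. inverse x \<in> A)"

lemma subringD:
  assumes "is_subring A"
  shows subring_one: "1 \<in> A" and subring_zero: "0 \<in> A"
    and subring_minus: "x \<in> A \<Longrightarrow> - x \<in> A"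
    and subring_diff: "x \<in> A \<Longrightarrow> y \<in> A \<Longrightarrow> x - y \<in> A"
    and subring_add: "x \<in> A \<Longrightarrow> y \<in> A \<Longrightarrow> x + y \<in> A"
    and subring_mult: "x \<in> A \<Longrightarrow> y \<in> A \<Longrightarrow> x * y \<in> A"
proof -
  have D: "1 \<in> A" "\<And>x y. x \<in> A \<Longrightarrow> y \<in> A \<Longrightarrow> x - y \<in> A" "\<And>x y. x \<in> A \<Longrightarrow> y \<in> A \<Longrightarrow> x * y \<in> A"
    using assms unfolding is_subring_def by blast+
  have Z: "0 \<in> A" using D(2)[OF D(1) D(1)] by simp
  have M: "- x \<in> A" if "x \<in> A" for x using D(2)[OF Z that] by simp
  show "1 \<in> A" "0 \<in> A" by fact+
  show "x \<in> A \<Longrightarrow> - x \<in> A" using M .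
  show "x \<in> A \<Longrightarrow> y \<in> A \<Longrightarrow> x - y \<in> A" "x \<in> A \<Longrightarrow> y \<in> A \<Longrightarrow> x * y \<in> A" using D(2,3) by auto
  show "x \<in> A \<Longrightarrow> y \<in> A \<Longrightarrow> x + y \<in> A" using D(2)[of x "- y"] M by simp
qed

lemma subring_power: "is_subring A \<Longrightarrow> x \<in> A \<Longrightarrow> x ^ n \<in> A"
  by (induction n) (auto intro: subring_one subring_mult)

lemma subring_prod: "is_subring A \<Longrightarrow> (\<And>i. i \<in> F \<Longrightarrow> f i \<in> A) \<Longrightarrow> prod f F \<in> A"
  by (induction F rule: infinite_finite_induct) (auto intro: subring_one subring_mult)

lemma submoduleD:
  assumes "submodule_of A M"
  shows submodule_zero: "0 \<in> M" 
    and submodule_add: "x \<in> M \<Longrightarrow> y \<in> M \<Longrightarrow> x + y \<in> M"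
    and submodule_smult: "a \<in> A \<Longrightarrow> x \<in> M \<Longrightarrow> a * x \<in> M"
    and submodule_smult2: "a \<in> A \<Longrightarrow> x \<in> M \<Longrightarrow> x * a \<in> M"
  using assms unfolding submodule_of_def by (auto simp: mult.commute)

lemma submodule_minus:
  assumes "is_subring A" "submodule_of A M" "x \<in> M" shows "- x \<in> M"
  using submodule_smult[OF assms(2), of "- 1" x] assms subring_minus[OF assms(1), of 1] subring_one by auto

lemma submodule_diff:
  assumes "is_subring A" "submodule_of A M" "x \<in> M" "y \<in> M" shows "x - y \<in> M"
  using submodule_add[OF assms(2), of x "- y"] submodule_minus assms by auto

lemma idealD:
  assumes "is_ideal A I"
  shows ideal_zero: "0 \<in> I" and ideal_sub: "x \<in> I \<Longrightarrow> x \<in> A"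
    and ideal_add: "x \<in> I \<Longrightarrow> y \<in> I \<Longrightarrow> x + y \<in> I"
    and ideal_mult: "a \<in> A \<Longrightarrow> x \<in> I \<Longrightarrow> a * x \<in> I"
    and ideal_mult2: "a \<in> A \<Longrightarrow> x \<in> I \<Longrightarrow> x * a \<in> I"
  using assms unfolding is_ideal_def by (auto simp: submoduleD)

lemma ideal_submodule: "is_ideal A I \<Longrightarrow> submodule_of A I"
  by (simp add: is_ideal_def)

lemma ideal_diff: "is_subring A \<Longrightarrow> is_ideal A I \<Longrightarrow> x \<in> I \<Longrightarrow> y \<in> I \<Longrightarrow> x - y \<in> I"
  by (rule submodule_diff) (auto simp: ideal_submodule)

lemma ideal_minus: "is_subring A \<Longrightarrow> is_ideal A I \<Longrightarrow> x \<in> I \<Longrightarrow> - x \<in> I"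
  by (rule submodule_minus) (auto simp: ideal_submodule)

lemma ideal_one_eq: "is_ideal A I \<Longrightarrow> 1 \<in> I \<Longrightarrow> I = A"
  using ideal_mult[of A I _ 1] ideal_sub[of A I] by auto

lemma primeD:
  assumes "is_prime A p"
  shows prime_ideal: "is_ideal A p" and prime_one: "1 \<notin> p"
    and prime_mult: "a \<in> A \<Longrightarrow> b \<in> A \<Longrightarrow> a * b \<in> p \<Longrightarrow> a \<in> p \<or> b \<in> p"
  using assms unfolding is_prime_def by auto

lemma prime_power:
  assumes "is_prime A p" "is_subring A" "x \<in> A" "x ^ n \<in> p" shows "x \<in> p"
  using assms(4)
proof (induction n)
  case 0 then show ?case using prime_one[OF assms(1)] by simp
next
  case (Suc n) then show ?case
    using prime_mult[OF assms(1,3), of "x ^ n"] subring_power[OF assms(2,3)] by auto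
qed

lemma lspan_superset: "is_subring A \<Longrightarrow> x \<in> W \<Longrightarrow> x \<in> lspan A W"
  using lspan_step[of 1 A x W 0] lspan_zero subring_one by fastforce

lemma lspan_submodule: assumes "is_subring A" shows "submodule_of A (lspan A W)"
proof -
  have add: "x + y \<in> lspan A W" if "x \<in> lspan A W" "y \<in> lspan A W" for x y
    using that(1)
  proof induction
    case lspan_zero then show ?case using that(2) by simp
  next
    case (lspan_step a x y') then show ?case using lspan.lspan_step by (metis add.assoc)
  qed
  have mul: "a * x \<in> lspan A W" if "a \<in> A" "x \<in> lspan A W" for x a
    using that(2)
  proof induction
    case lspan_zero then show ?case by (simp add: lspan.lspan_zero)
  next
    case (lspan_step b x y)
    then have "(a * b) * x + a * y \<in> lspan A W" 
      using subring_mult[OF assms that(1)] by (intro lspan.lspan_step) auto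
    then show ?case by (simp add: algebra_simps)
  qed
  show ?thesis unfolding submodule_of_def using add mul lspan_zero by blast
qed

lemma lspan_least: assumes "submodule_of A M" "W \<subseteq> M" shows "lspan A W \<subseteq> M"
proof
  fix x assume "x \<in> lspan A W" then show "x \<in> M"
    by induction (use assms in \<open>auto intro: submoduleD\<close>)
qed

lemma lspan_ideal: "is_subring A \<Longrightarrow> W \<subseteq> A \<Longrightarrow> is_ideal A (lspan A W)"
  unfolding is_ideal_def using lspan_submodule lspan_least[of A A W] 
  by (auto simp: submodule_of_def subringD)

lemma lspan_mono: "is_subring A \<Longrightarrow> W \<subseteq> Y \<Longrightarrow> lspan A W \<subseteq> lspan A Y"
  by (intro lspan_least lspan_submodule) (auto intro: lspan_superset)

lemma lspan_ideal_eq: "is_subring A \<Longrightarrow> is_ideal A I \<Longrightarrow> lspan A I = I"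
  using lspan_least[of A I I] lspan_superset[of A _ I] by (auto simp: ideal_submodule)

lemma lspan_insert:
  assumes "is_subring A" 
  shows "lspan A (insert g W) = {c * g + x | c x. c \<in> A \<and> x \<in> lspan A W}" (is "_ = ?R")
proof
  have W: "submodule_of A (lspan A W)" using lspan_submodule assms .
  have "submodule_of A ?R" unfolding submodule_of_def
  proof (intro conjI ballI)
    show "0 \<in> ?R" using subring_zero[OF assms] lspan_zero by force
  next
    fix x y assume "x \<in> ?R" "y \<in> ?R"
    then obtain c c' u u' where *: "x = c * g + u" "y = c' * g + u'" "c \<in> A" "c' \<in> A" "u \<in> lspan A W" "u' \<in> lspan A W" by auto
    have "x + y = (c + c') * g + (u + u')" using * by (simp add: algebra_simps)
    then show "x + y \<in> ?R" using * subring_add[OF assms] submodule_add[OF W] by blast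
  next
    fix a x assume "a \<in> A" "x \<in> ?R"
    then obtain c u where *: "x = c * g + u" "c \<in> A" "u \<in> lspan A W" by auto
    have "a * x = (a * c) * g + (a * u)" using * by (simp add: algebra_simps)
    then show "a * x \<in> ?R" using * \<open>a \<in> A\<close> subring_mult[OF assms] submodule_smult[OF W] by blast
  qed
  moreover have "insert g W \<subseteq> ?R"
  proof
    fix x assume "x \<in> insert g W"
    moreover have "g = 1 * g + 0" "x = 0 * g + x" by auto
    ultimately show "x \<in> ?R" using subring_one[OF assms] subring_zero[OF assms] lspan_zero lspan_superset[OF assms] by blast
  qed
  ultimately show "lspan A (insert g W) \<subseteq> ?R" by (rule lspan_least)
  show "?R \<subseteq> lspan A (insert g W)"
    using lspan_step[of _ A g "insert g W"] lspan_mono[OF assms, of W "insert g W"] by blast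
qed

lemma lspan_union_ideal:
  assumes "is_subring A" "is_ideal A I"
  shows "lspan A (insert g I) = {c * g + x | c x. c \<in> A \<and> x \<in> I}"
  using lspan_insert[OF assms(1)] lspan_ideal_eq[OF assms] by simp

lemma noethD: "noeth A \<Longrightarrow> is_subring A"
  by (simp add: noeth_def)

lemma noeth_fg:
  assumes "noeth A" "is_ideal A I"
  obtains W where "finite W" "W \<subseteq> I" "I = lspan A W"
proof -
  obtain W where W: "finite W" "I = lspan A W" using assms unfolding noeth_def by blast
  moreover have "W \<subseteq> lspan A W" using lspan_superset[OF noethD[OF assms(1)]] by blast
  ultimately show ?thesis using that by blast
qed

lemma chain_union_ideal:
  assumes "C \<noteq> {}" "subset.chain {I. is_ideal A I} C"
  shows "is_ideal A (\<Union>C)"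
proof -
  have C: "\<And>I. I \<in> C \<Longrightarrow> is_ideal A I" and tot: "\<And>I J. I \<in> C \<Longrightarrow> J \<in> C \<Longrightarrow> I \<subseteq> J \<or> J \<subseteq> I"
    using assms(2) unfolding subset.chain_def by blast+
  show ?thesis unfolding is_ideal_def submodule_of_def
  proof (intro conjI ballI)
    show "0 \<in> \<Union>C" using assms(1) C ideal_zero by blast
    show "x + y \<in> \<Union>C" if xy: "x \<in> \<Union>C" "y \<in> \<Union>C" for x y
    proof -
      obtain I J where *: "x \<in> I" "I \<in> C" "y \<in> J" "J \<in> C" using xy by blast
      then have "\<exists>L\<in>C. x \<in> L \<and> y \<in> L" using tot[of I J] by blast
      then obtain L where L: "L \<in> C" "x \<in> L" "y \<in> L" by blast
      then have "x + y \<in> L" using ideal_add[OF C[OF L(1)]] by blast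
      then show ?thesis using L(1) by blast
    qed
    show "a * x \<in> \<Union>C" if "a \<in> A" "x \<in> \<Union>C" for a x using that C ideal_mult by blast
    show "\<Union>C \<subseteq> A" using C ideal_sub by blast
  qed
qed

text \<open>
  The union of a chain of ideals is finitely generated, hence equal to a member of the chain;
  Zorn's lemma applies.
\<close>

lemma noeth_maximal:
  assumes N: "noeth A" and C: "C \<noteq> {}" "\<And>I. I \<in> C \<Longrightarrow> is_ideal A I"
  obtains M where "M \<in> C" "\<And>I. I \<in> C \<Longrightarrow> M \<subseteq> I \<Longrightarrow> I = M"
proof -
  have "\<exists>M\<in>C. \<forall>W\<in>C. M \<subseteq> W \<longrightarrow> W = M"
  proof (rule subset_Zorn_nonempty[OF C(1)])
    fix D assume D: "D \<noteq> {}" "subset.chain C D"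
    have D': "subset.chain {I. is_ideal A I} D" using D(2) C(2) unfolding subset.chain_def by blast
    obtain W where W: "finite W" "W \<subseteq> \<Union>D" "\<Union>D = lspan A W"
      by (rule noeth_fg[OF N chain_union_ideal[OF D(1) D']])
    obtain B where B: "B \<in> D" "W \<subseteq> B" 
      using finite_subset_Union_chain[OF W(1,2) D(1)] D(2) by blast
    have BC: "B \<in> C" using B(1) D(2) unfolding subset.chain_def by blast
    then have "lspan A W \<subseteq> B" using lspan_least[OF ideal_submodule[OF C(2)] B(2)] by blast
    then have "\<Union>D = B" using B(1) W(3) by blast
    then show "\<Union>D \<in> C" using BC by simp
  qed
  then show ?thesis using that by blast
qed

lemma local_subring: "is_local A m \<Longrightarrow> is_subring A" and local_ideal: "is_local A m \<Longrightarrow> is_ideal A m"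
  by (auto simp: is_local_def)

lemma local_proper_ideal:
  assumes "is_local A m" "is_ideal A I" "1 \<notin> I" shows "I \<subseteq> m"
proof
  fix x assume x: "x \<in> I"
  show "x \<in> m"
  proof (rule ccontr)
    assume "x \<notin> m"
    then have "x \<in> A - m" using x ideal_sub[OF assms(2)] by auto
    then have "inverse x \<in> A" "x \<noteq> 0" using assms(1) by (auto simp: is_local_def ideal_zero)
    then have "inverse x * x \<in> I" using ideal_mult[OF assms(2) _ x] by blast
    with \<open>x \<noteq> 0\<close> assms(3) show False by simp
  qed
qed

lemma local_max_prime:
  assumes "is_local A m" shows "is_prime A m"
  unfolding is_prime_def
proof (intro conjI ballI impI)
  show "is_ideal A m" "1 \<notin> m" using assms by (auto simp: is_local_def)
  fix a b assume ab: "a \<in> A" "b \<in> A" "a * b \<in> m"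
  show "a \<in> m \<or> b \<in> m"
  proof (rule ccontr)
    assume n: "\<not> (a \<in> m \<or> b \<in> m)"
    then have "inverse a \<in> A" "inverse b \<in> A" "a \<noteq> 0" "b \<noteq> 0" 
      using ab assms ideal_zero[OF local_ideal[OF assms]] by (auto simp: is_local_def)
    then have "(inverse a * inverse b) * (a * b) \<in> m"
      using ideal_mult[OF local_ideal[OF assms] _ ab(3)] subring_mult[OF local_subring[OF assms]] by blast
    then show False using \<open>a \<noteq> 0\<close> \<open>b \<noteq> 0\<close> assms by (simp add: field_simps is_local_def)
  qed
qed

lemma local_unit:
  assumes "is_local A m" "a \<in> m" "c \<in> A"
  shows "1 - c * a \<noteq> 0" "inverse (1 - c * a) \<in> A"
proof -
  have ca: "c * a \<in> m" using ideal_mult[OF local_ideal[OF assms(1)] assms(3,2)] .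
  have s: "1 - c * a \<in> A" 
    using subringD[OF local_subring[OF assms(1)]] ideal_sub[OF local_ideal[OF assms(1)] ca] by auto
  have "1 - c * a \<notin> m"
  proof
    assume "1 - c * a \<in> m"
    then have "(1 - c * a) + c * a \<in> m" using ca ideal_add[OF local_ideal[OF assms(1)]] by blast
    then show False using assms(1) by (simp add: is_local_def)
  qed
  then show "inverse (1 - c * a) \<in> A" "1 - c * a \<noteq> 0" 
    using s assms(1) ideal_zero[OF local_ideal[OF assms(1)]] by (auto simp: is_local_def)
qed

text \<open>
  Nakayama's lemma for \<open>M \<subseteq> N + a M\<close> with a single \<open>a \<in> m\<close>.  One generator \<open>g\<close> at a time is
  eliminated: its own coefficient on the right has the form \<open>a c\<close>, and \<open>1 - c a\<close> is a unit.
\<close>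

lemma nakayama_gens:
  assumes L: "is_local A m" and a: "a \<in> m" and N: "submodule_of A N" and "finite G"
    and "\<And>g. g \<in> G \<Longrightarrow> \<exists>y\<in>lspan A G. g - a * y \<in> N"
  shows "G \<subseteq> N"
  using assms(4,5)
proof (induction G)
  case empty then show ?case by simp
next
  case (insert g G)
  have A: "is_subring A" using L local_subring by blast
  have aA: "a \<in> A" using a ideal_sub[OF local_ideal[OF L]] by blast
  have S: "submodule_of A (lspan A G)" using lspan_submodule A .
  obtain y where y: "y \<in> lspan A (insert g G)" "g - a * y \<in> N" using insert.prems by blast
  then obtain c y' where c: "y = c * g + y'" "c \<in> A" "y' \<in> lspan A G" unfolding lspan_insert[OF A] by blast
  define u where "u = inverse (1 - c * a)"
  have u: "u \<in> A" "(1 - c * a) * u = 1" using local_unit[OF L a c(2)] by (auto simp: u_def)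
  define y2 where "y2 = u * y'"
  have y2: "y2 \<in> lspan A G" using u c submodule_smult[OF S] by (simp add: y2_def)
  have "u * (g - a * y) = ((1 - c * a) * u) * g - a * y2" by (simp add: c(1) y2_def algebra_simps)
  then have g: "g - a * y2 \<in> N" using submodule_smult[OF N u(1) y(2)] u(2) by simp
  have "G \<subseteq> N"
  proof (rule insert.IH)
    fix g' assume "g' \<in> G"
    then obtain z where z: "z \<in> lspan A (insert g G)" "g' - a * z \<in> N" using insert.prems by blast
    then obtain d z' where d: "z = d * g + z'" "d \<in> A" "z' \<in> lspan A G" unfolding lspan_insert[OF A] by blast
    have "(g' - a * z) + (a * d) * (g - a * y2) \<in> N"
      using z(2) submodule_smult[OF N _ g, of "a * d"] subring_mult[OF A aA d(2)] submodule_add[OF N] by blast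
    then have "g' - a * (d * a * y2 + z') \<in> N" by (simp add: d(1) algebra_simps)
    moreover have "d * a * y2 + z' \<in> lspan A G"
      using submodule_add[OF S _ d(3)] submodule_smult[OF S _ y2] subring_mult[OF A d(2) aA] by blast
    ultimately show "\<exists>y\<in>lspan A G. g' - a * y \<in> N" by blast
  qed
  moreover then have "y2 \<in> N" using y2 lspan_least[OF N] by blast
  then have "(g - a * y2) + a * y2 \<in> N" using g aA submoduleD[OF N] by blast
  ultimately show ?case by simp
qed

lemma nakayama:
  assumes L: "is_local A m" and Nt: "noeth A" and a: "a \<in> m" and N: "is_ideal A N" and M: "is_ideal A M"
    and *: "\<And>g. g \<in> M \<Longrightarrow> \<exists>y\<in>M. g - a * y \<in> N"
  shows "M \<subseteq> N"
proof -
  obtain G where G: "finite G" "G \<subseteq> M" "M = lspan A G" using noeth_fg[OF Nt M] .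
  have "G \<subseteq> N"
    by (rule nakayama_gens[OF L a ideal_submodule[OF N] G(1)]) (use * G in blast)
  then show ?thesis using G(3) lspan_least[OF ideal_submodule[OF N]] by blast
qed

section \<open>The principal ideal theorem\<close>

lemma colon_ideal:
  assumes "is_subring A" "is_ideal A J" "x \<in> A"
  shows "is_ideal A {c \<in> A. c * x \<in> J}"
  using assms unfolding is_ideal_def submodule_of_def
  by (auto simp: subringD ring_distribs mult.assoc)

text \<open>
  A colon ideal \<open>(J : x)\<close> with \<open>x \<notin> J\<close> that is maximal among all of these is prime, and it
  contains \<open>J\<close>.
\<close>

lemma socle_element:
  assumes N: "noeth A" and J: "is_ideal A J" "J \<noteq> A" and m: "\<And>p. is_prime A p \<Longrightarrow> J \<subseteq> p \<Longrightarrow> p = m"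
  obtains x where "x \<in> A" "x \<notin> J" "\<And>a. a \<in> m \<Longrightarrow> a * x \<in> J"
proof -
  have A: "is_subring A" using N noethD by blast
  define C where "C = (\<lambda>x. {c \<in> A. c * x \<in> J}) ` (A - J)"
  have "C \<noteq> {}" using J ideal_sub[OF J(1)] unfolding C_def by blast
  moreover have "is_ideal A I" if "I \<in> C" for I using that colon_ideal[OF A J(1)] unfolding C_def by blast
  ultimately obtain M where M: "M \<in> C" "\<And>I. I \<in> C \<Longrightarrow> M \<subseteq> I \<Longrightarrow> I = M"
    using noeth_maximal[OF N, of C] by metis
  then obtain x where x: "x \<in> A" "x \<notin> J" "M = {c \<in> A. c * x \<in> J}" unfolding C_def by blast
  have "is_prime A M" unfolding is_prime_def
  proof (intro conjI ballI impI)
    show "is_ideal A M" using colon_ideal[OF A J(1) x(1)] x(3) by simp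
    show "1 \<notin> M" using x by simp
    fix a b assume ab: "a \<in> A" "b \<in> A" "a * b \<in> M"
    show "a \<in> M \<or> b \<in> M"
    proof (cases "b \<in> M")
      case False
      then have bx: "b * x \<in> A - J" using ab x subring_mult[OF A] by auto
      then have "{c \<in> A. c * (b * x) \<in> J} \<in> C" unfolding C_def by (rule imageI)
      moreover have "M \<subseteq> {c \<in> A. c * (b * x) \<in> J}"
      proof
        fix c assume "c \<in> M"
        then have "c \<in> A" "b * (c * x) \<in> J" using x(3) ideal_mult[OF J(1) ab(2)] by auto
        then show "c \<in> {c \<in> A. c * (b * x) \<in> J}" by (simp add: mult.left_commute)
      qed
      ultimately have "{c \<in> A. c * (b * x) \<in> J} = M" using M(2) by blast
      moreover have "a \<in> {c \<in> A. c * (b * x) \<in> J}" using ab x(3) by (simp add: mult.assoc)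
      ultimately show ?thesis by blast
    qed simp
  qed
  moreover have "J \<subseteq> M" unfolding x(3) using ideal_mult2[OF J(1) x(1)] ideal_sub[OF J(1)] by blast
  ultimately have "M = m" using m by blast
  then show ?thesis using that[of x] x by blast
qed

text \<open>
  The ring \<open>A / J\<close> is Artinian if \<open>m\<close> is the only prime above \<open>J\<close>.  Let \<open>K\<close> be a maximal
  counterexample and \<open>x\<close> a socle element modulo \<open>K\<close>.  The chain stabilizes after adding \<open>K' = K + (x)\<close>,
  by maximality, and after intersecting with \<open>K'\<close>, since \<open>K' / K\<close> is simple; the modular law
  combines the two.
\<close>

lemma decreasing_chain_stabilizes:
  assumes N: "noeth A" and L: "is_local A m" and J: "is_ideal A J" 
    and m: "\<And>p. is_prime A p \<Longrightarrow> J \<subseteq> p \<Longrightarrow> p = m"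
    and I: "\<And>n. is_ideal A (I n)" "\<And>n. J \<subseteq> I n" "\<And>n. I (Suc n) \<subseteq> I n"
  shows "\<exists>N. \<forall>n\<ge>N. I n = I N"
proof (rule ccontr)
  assume bad0: "\<not> ?thesis"
  have A: "is_subring A" using N noethD by blast
  define bad where "bad J \<longleftrightarrow> is_ideal A J \<and> (\<forall>p. is_prime A p \<longrightarrow> J \<subseteq> p \<longrightarrow> p = m) \<and>
    (\<exists>I. (\<forall>n. is_ideal A (I n) \<and> J \<subseteq> I n \<and> I (Suc n) \<subseteq> I n) \<and> \<not> (\<exists>N. \<forall>n\<ge>N. I n = I N))" for J :: "'a set"
  have "bad J" unfolding bad_def
  proof (intro conjI exI[of _ I])
    show "\<forall>p. is_prime A p \<longrightarrow> J \<subseteq> p \<longrightarrow> p = m" using m by simp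
    show "\<forall>n. is_ideal A (I n) \<and> J \<subseteq> I n \<and> I (Suc n) \<subseteq> I n" using I by simp
  qed (use J bad0 in auto)
  then have "Collect bad \<noteq> {}" by blast
  moreover have "is_ideal A J" if "J \<in> Collect bad" for J using that by (simp add: bad_def)
  ultimately obtain K where K: "bad K" "\<And>J. bad J \<Longrightarrow> K \<subseteq> J \<Longrightarrow> J = K"
    using noeth_maximal[OF N, of "Collect bad"] by (metis mem_Collect_eq)
  obtain I where I: "\<And>n. is_ideal A (I n)" "\<And>n. K \<subseteq> I n" "\<And>n. I (Suc n) \<subseteq> I n" 
    and unst: "\<not> (\<exists>N. \<forall>n\<ge>N. I n = I N)" using K(1) unfolding bad_def by blast
  have Ki: "is_ideal A K" and Km: "\<And>p. is_prime A p \<Longrightarrow> K \<subseteq> p \<Longrightarrow> p = m" using K(1) unfolding bad_def by auto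
  have dec: "I n \<subseteq> I k" if "k \<le> n" for k n using lift_Suc_antimono_le[of I, OF I(3) that] .
  have "K \<noteq> A"
  proof
    assume "K = A"
    then have "I n = A" for n using I(2)[of n] ideal_sub[OF I(1)[of n]] by blast
    then show False using unst by blast
  qed
  then obtain x where x: "x \<in> A" "x \<notin> K" "\<And>a. a \<in> m \<Longrightarrow> a * x \<in> K" using socle_element[OF N Ki _ Km] by blast
  define K' where "K' = lspan A (insert x K)"
  have K'eq: "K' = {c * x + k | c k. c \<in> A \<and> k \<in> K}" unfolding K'_def by (rule lspan_union_ideal[OF A Ki])
  have K'i: "is_ideal A K'" unfolding K'_def using x(1) ideal_sub[OF Ki] by (intro lspan_ideal[OF A]) auto
  have KK': "K \<subseteq> K'" "x \<in> K'" unfolding K'_def using lspan_superset[OF A, of _ "insert x K"] by auto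
  have "\<not> bad K'" using K(2)[of K'] KK' x(2) by blast
  moreover define T where "T n = {i + k | i k. i \<in> I n \<and> k \<in> K'}" for n
  have Ti: "is_ideal A (T n)" for n unfolding is_ideal_def submodule_of_def
  proof (intro conjI ballI)
    show "0 \<in> T n" unfolding T_def using ideal_zero[OF I(1)] ideal_zero[OF K'i] by force
    show "a + b \<in> T n" if ab: "a \<in> T n" "b \<in> T n" for a b
    proof -
      obtain i k i' k' where *: "a = i + k" "b = i' + k'" "i \<in> I n" "i' \<in> I n" "k \<in> K'" "k' \<in> K'" 
        using ab unfolding T_def by blast
      have "a + b = (i + i') + (k + k')" using * by simp
      then show ?thesis unfolding T_def using * ideal_add[OF I(1)] ideal_add[OF K'i] by blast
    qed
    show "c * a \<in> T n" if ca: "c \<in> A" "a \<in> T n" for c a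
    proof -
      obtain i k where *: "a = i + k" "i \<in> I n" "k \<in> K'" using ca unfolding T_def by blast
      have "c * a = c * i + c * k" using * by (simp add: algebra_simps)
      then show ?thesis unfolding T_def using * ca ideal_mult[OF I(1)] ideal_mult[OF K'i] by blast
    qed
    show "T n \<subseteq> A" unfolding T_def using ideal_sub[OF I(1)] ideal_sub[OF K'i] subring_add[OF A] by blast
  qed
  moreover have "K' \<subseteq> T n" for n unfolding T_def using ideal_zero[OF I(1)] by force
  moreover have "T (Suc n) \<subseteq> T n" for n unfolding T_def using I(3) by blast
  moreover have "p = m" if "is_prime A p" "K' \<subseteq> p" for p using Km[OF that(1)] that(2) KK'(1) by blast
  ultimately obtain N1 where N1: "\<And>n. n \<ge> N1 \<Longrightarrow> T n = T N1" using K'i unfolding bad_def by blast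
  have "\<exists>N2. \<forall>n\<ge>N2. I n \<inter> K' = I N2 \<inter> K'"
  proof (cases "\<exists>n0. x \<notin> I n0")
    case False
    have "K' \<subseteq> I n" for n
      unfolding K'_def using lspan_least[OF ideal_submodule[OF I(1)], of "insert x K" n] I(2) False by blast
    then have "I n \<inter> K' = K'" for n by blast
    then show ?thesis by simp
  next
    case True
    then obtain n0 where n0: "x \<notin> I n0" by blast
    have "I n \<inter> K' = K" if n: "n \<ge> n0" for n
    proof
      show "K \<subseteq> I n \<inter> K'" using KK' I(2) by blast
      show "I n \<inter> K' \<subseteq> K"
      proof
        fix y assume y: "y \<in> I n \<inter> K'"
        then obtain c k where ck: "y = c * x + k" "c \<in> A" "k \<in> K" using K'eq by blast
        have "y - k \<in> I n" using y ck(3) I(2) ideal_diff[OF A I(1)] by blast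
        then have cx: "c * x \<in> I n" by (simp add: ck)
        have "c \<in> m"
        proof (rule ccontr)
          assume "c \<notin> m"
          then have "inverse c \<in> A" "c \<noteq> 0" using ck(2) L by (auto simp: is_local_def ideal_zero)
          then have "inverse c * (c * x) \<in> I n" using ideal_mult[OF I(1) _ cx] by blast
          then have "x \<in> I n" using \<open>c \<noteq> 0\<close> by (simp add: mult.assoc[symmetric])
          then show False using n0 dec[OF n] by blast
        qed
        then show "y \<in> K" unfolding ck(1) using x(3) ck(3) ideal_add[OF Ki] by blast
      qed
    qed
    then show ?thesis by blast
  qed
  then obtain N2 where N2: "\<And>n. n \<ge> N2 \<Longrightarrow> I n \<inter> K' = I N2 \<inter> K'" by blast
  \<comment> \<open>Beyond \<open>M\<close> both the sum with \<open>K'\<close> and the intersection with \<open>K'\<close> are constant.\<close>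
  define M where "M = max N1 N2"
  have "I n = I M" if n: "n \<ge> M" for n
  proof
    show "I n \<subseteq> I M" using dec n by blast
    show "I M \<subseteq> I n"
    proof
      fix y assume y: "y \<in> I M"
      have "y \<in> T M" unfolding T_def using y ideal_zero[OF K'i] by force
      then have "y \<in> T n" using N1[of M] N1[of n] n by (simp add: M_def)
      then obtain i k where ik: "y = i + k" "i \<in> I n" "k \<in> K'" unfolding T_def by blast
      have "y - i \<in> I M" using ideal_diff[OF A I(1) y] ik(2) dec[OF n] by blast
      then have "k \<in> I M \<inter> K'" using ik by simp
      then have "k \<in> I n" using N2[of M] N2[of n] n by (auto simp: M_def)
      then show "y \<in> I n" using ik ideal_add[OF I(1)] by blast
    qed
  qed
  then show False using unst by blast
qed

text \<open>
  The ideals \<open>J + (x\<^sup>n)\<close> stabilize, so \<open>x\<^sup>n (1 - c x) \<in> J\<close> for some \<open>n\<close> and \<open>c\<close>.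
\<close>

lemma nilpotent_mod:
  assumes N: "noeth A" and L: "is_local A m" and J: "is_ideal A J" 
    and m: "\<And>p. is_prime A p \<Longrightarrow> J \<subseteq> p \<Longrightarrow> p = m" and x: "x \<in> m"
  shows "\<exists>n. x ^ n \<in> J"
proof -
  have A: "is_subring A" using N noethD by blast
  have xA: "x \<in> A" using x ideal_sub[OF local_ideal[OF L]] by blast
  define I where "I n = lspan A (insert (x ^ n) J)" for n
  have Ieq: "I n = {c * x ^ n + k | c k. c \<in> A \<and> k \<in> J}" for n unfolding I_def by (rule lspan_union_ideal[OF A J])
  have Ii: "is_ideal A (I n)" for n unfolding I_def using ideal_sub[OF J] subring_power[OF A xA] 
    by (intro lspan_ideal[OF A]) auto
  have "\<exists>N. \<forall>n\<ge>N. I n = I N"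
  proof (rule decreasing_chain_stabilizes[OF N L J m Ii])
    show "J \<subseteq> I n" for n unfolding I_def using lspan_superset[OF A] by blast
    show "I (Suc n) \<subseteq> I n" for n
    proof
      fix y assume "y \<in> I (Suc n)"
      then obtain c k where ck: "y = (c * x) * x ^ n + k" "c \<in> A" "k \<in> J" unfolding Ieq by (auto simp: mult.assoc)
      then show "y \<in> I n" unfolding Ieq using subring_mult[OF A _ xA] by blast
    qed
  qed auto
  then obtain n where "I (Suc n) = I n" by (metis le_SucI order_refl)
  moreover have "x ^ n \<in> I n" unfolding I_def using lspan_superset[OF A] by blast
  ultimately obtain c k where ck: "x ^ n = c * x ^ Suc n + k" "c \<in> A" "k \<in> J" unfolding Ieq by blast
  note u = local_unit[OF L x ck(2)]
  have "(1 - c * x) * x ^ n = k" using ck(1) by (simp add: algebra_simps)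
  then have "x ^ n = inverse (1 - c * x) * k" using u(1) by (auto simp: field_simps)
  then show ?thesis using ideal_mult[OF J u(2) ck(3)] by metis
qed

text \<open>
  Krull's principal ideal theorem, as the statement that \<open>m\<close> is not minimal over \<open>p0 + (a)\<close>.
  Otherwise \<open>A / (p0 + (a))\<close> is Artinian.  Choose \<open>y \<in> p1 - p0\<close> and let \<open>I n\<close> be the elements that lie in
  \<open>p0 + (y\<^sup>n)\<close> after multiplication by an element outside \<open>p1\<close>.  The ideals \<open>I n + (a)\<close> stabilize; as \<open>a\<close> is
  cancellable modulo each \<open>I n\<close>, Nakayama's lemma makes \<open>I n\<close> itself stabilize, and this forces
  \<open>t - c y \<in> p0\<close> with \<open>t \<notin> p1\<close>, a contradiction.  The powers of one element \<open>y\<close> take the place of the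
  symbolic powers of \<open>p1\<close>, so that no second localization is needed.
\<close>

lemma principal_ideal_theorem:
  assumes N: "noeth A" and L: "is_local A m" and P0: "is_prime A p0" and P1: "is_prime A p1"
    and sub: "p0 \<subset> p1" "p1 \<subset> m" and a: "a \<in> m"
  shows "\<exists>p. is_prime A p \<and> p0 \<subseteq> p \<and> a \<in> p \<and> p \<noteq> m"
proof (rule ccontr)
  assume neg: "\<not> ?thesis"
  have A: "is_subring A" using N noethD by blast
  have aA: "a \<in> A" using a ideal_sub[OF local_ideal[OF L]] by blast
  define J where "J = lspan A (insert a p0)"
  note i0 = prime_ideal[OF P0] and i1 = prime_ideal[OF P1]
  have Jeq: "J = {c * a + k | c k. c \<in> A \<and> k \<in> p0}" unfolding J_def by (rule lspan_union_ideal[OF A i0])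
  have Ji: "is_ideal A J" unfolding J_def using ideal_sub[OF i0] aA by (intro lspan_ideal[OF A]) auto
  have Jsub: "p0 \<subseteq> J" "a \<in> J" unfolding J_def using lspan_superset[OF A] by blast+
  have Jm: "p = m" if "is_prime A p" "J \<subseteq> p" for p using neg that Jsub by blast
  have anp: "a \<notin> p1" using neg P1 sub by blast
  obtain y where y: "y \<in> p1" "y \<notin> p0" using sub by blast
  have yA: "y \<in> A" using y(1) ideal_sub[OF i1] by blast
  define I where "I n = {x \<in> A. \<exists>t\<in>A - p1. \<exists>c\<in>A. t * x - c * y ^ n \<in> p0}" for n
  have tt: "t * t' \<in> A - p1" if "t \<in> A - p1" "t' \<in> A - p1" for t t'
    using that prime_mult[OF P1] subring_mult[OF A] by blast
  have Ii: "is_ideal A (I n)" for n unfolding is_ideal_def submodule_of_def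
  proof (intro conjI ballI)
    show "0 \<in> I n" unfolding I_def using subringD[OF A] prime_one[OF P1] ideal_zero[OF i0] 
      by (auto intro!: bexI[of _ 1] bexI[of _ 0])
    show "u + v \<in> I n" if uv: "u \<in> I n" "v \<in> I n" for u v
    proof -
      obtain t c t' c' where *: "t \<in> A - p1" "c \<in> A" "t * u - c * y ^ n \<in> p0" 
         "t' \<in> A - p1" "c' \<in> A" "t' * v - c' * y ^ n \<in> p0" "u \<in> A" "v \<in> A" using uv unfolding I_def by blast
      have "t' * (t * u - c * y ^ n) + t * (t' * v - c' * y ^ n) \<in> p0"
        using * ideal_mult[OF i0] ideal_add[OF i0] by blast
      then have "(t * t') * (u + v) - (t' * c + t * c') * y ^ n \<in> p0" by (simp add: algebra_simps)
      moreover have "t * t' \<in> A - p1" using tt * by blast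
      moreover have "t' * c + t * c' \<in> A" "u + v \<in> A" using * subringD[OF A] by auto
      ultimately show ?thesis unfolding I_def by blast
    qed
    show "d * u \<in> I n" if du: "d \<in> A" "u \<in> I n" for d u
    proof -
      obtain t c where *: "t \<in> A - p1" "c \<in> A" "t * u - c * y ^ n \<in> p0" "u \<in> A" using du unfolding I_def by blast
      have "d * (t * u - c * y ^ n) \<in> p0" using * du ideal_mult[OF i0] by blast
      then have "t * (d * u) - (d * c) * y ^ n \<in> p0" by (simp add: algebra_simps)
      then show ?thesis unfolding I_def using * du subring_mult[OF A] by blast
    qed
    show "I n \<subseteq> A" unfolding I_def by blast
  qed
  have p0I: "p0 \<subseteq> I n" for n
  proof
    fix k assume k: "k \<in> p0"
    then have "1 * k - 0 * y ^ n \<in> p0" "k \<in> A" using ideal_sub[OF i0] by auto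
    moreover have "1 \<in> A - p1" "0 \<in> A" using subringD[OF A] prime_one[OF P1] by auto
    ultimately show "k \<in> I n" unfolding I_def by blast
  qed
  have dec: "I (Suc n) \<subseteq> I n" for n
  proof
    fix u assume "u \<in> I (Suc n)"
    then obtain t c where *: "t \<in> A - p1" "c \<in> A" "t * u - (c * y) * y ^ n \<in> p0" "u \<in> A" 
      unfolding I_def by (auto simp: mult.assoc)
    then show "u \<in> I n" unfolding I_def using subring_mult[OF A _ yA] by blast
  qed
  define T where "T n = lspan A (insert a (I n))" for n
  have Teq: "T n = {c * a + k | c k. c \<in> A \<and> k \<in> I n}" for n unfolding T_def by (rule lspan_union_ideal[OF A Ii])
  have "\<exists>N. \<forall>n\<ge>N. T n = T N"
  proof (rule decreasing_chain_stabilizes[OF N L Ji Jm])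
    show "is_ideal A (T n)" for n unfolding T_def using ideal_sub[OF Ii] aA by (intro lspan_ideal[OF A]) auto
    show "J \<subseteq> T n" for n unfolding J_def T_def using p0I by (intro lspan_mono[OF A]) auto
    show "T (Suc n) \<subseteq> T n" for n unfolding T_def using dec by (intro lspan_mono[OF A]) auto
  qed auto
  then obtain n where n: "T (Suc n) = T n" by (metis le_SucI order_refl)
  \<comment> \<open>If \<open>c a \<in> I n\<close> then \<open>c \<in> I n\<close>, since \<open>a\<close> is outside \<open>p1\<close>; hence \<open>I n \<subseteq> I (n + 1) + a I n\<close>.\<close>
  have "I n \<subseteq> I (Suc n)"
  proof (rule nakayama[OF L N a Ii Ii])
    fix g assume g: "g \<in> I n"
    then have "g \<in> T n" unfolding T_def using lspan_superset[OF A] by blast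
    then obtain c k where ck: "g = c * a + k" "c \<in> A" "k \<in> I (Suc n)" using n Teq[of "Suc n"] by blast
    have "g - k \<in> I n" using g ck(3) dec ideal_diff[OF A Ii] by blast
    then have ca: "c * a \<in> I n" using ck by simp
    then obtain t d where td: "t \<in> A - p1" "d \<in> A" "t * (c * a) - d * y ^ n \<in> p0" unfolding I_def by blast
    then have "(t * a) * c - d * y ^ n \<in> p0" by (simp add: ac_simps)
    then have "c \<in> I n" unfolding I_def using tt[OF td(1), of a] anp aA td(2) ck(2) by blast
    moreover have "g - a * c \<in> I (Suc n)" using ck by (simp add: mult.commute)
    ultimately show "\<exists>y\<in>I n. g - a * y \<in> I (Suc n)" by blast
  qed
  moreover have "y ^ n \<in> I n"
  proof -
    have "1 * y ^ n - 1 * y ^ n \<in> p0" using ideal_zero[OF i0] by simp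
    moreover have "1 \<in> A - p1" using subringD[OF A] prime_one[OF P1] by auto
    ultimately show ?thesis unfolding I_def using subring_power[OF A yA] by blast
  qed
  ultimately obtain t c where tc: "t \<in> A - p1" "c \<in> A" "t * y ^ n - c * y ^ Suc n \<in> p0" unfolding I_def by blast
  have cy: "c * y \<in> p1" using ideal_mult[OF i1 tc(2) y(1)] .
  then have s: "t - c * y \<in> A" using tc ideal_sub[OF i1] subring_diff[OF A] by blast
  have "(t - c * y) * y ^ n \<in> p0" using tc(3) by (simp add: algebra_simps)
  then have "t - c * y \<in> p0 \<or> y ^ n \<in> p0" using prime_mult[OF P0 s subring_power[OF A yA]] by blast
  then have "t - c * y \<in> p0" using prime_power[OF P0 A yA] y(2) by blast
  then have "(t - c * y) + c * y \<in> p1" using sub(1) cy ideal_add[OF i1] by blast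
  then show False using tc(1) by simp
qed

section \<open>Localization\<close>

definition mult_set :: "'a::field set \<Rightarrow> 'a set \<Rightarrow> bool" where
  "mult_set A S \<longleftrightarrow> S \<subseteq> A \<and> 1 \<in> S \<and> 0 \<notin> S \<and> (\<forall>s\<in>S. \<forall>t\<in>S. s * t \<in> S)"

lemma prime_complement_mult_set: "is_subring A \<Longrightarrow> is_prime A q \<Longrightarrow> mult_set A (A - q)"
  unfolding mult_set_def using subringD primeD ideal_zero by (auto simp: is_prime_def) 

lemma localize_memI: "a \<in> I \<Longrightarrow> s \<in> S \<Longrightarrow> a / s \<in> localize I S"
  unfolding localize_def by blast

lemma localize_memE:
  assumes "x \<in> localize I S" obtains a s where "a \<in> I" "s \<in> S" "x = a / s"
  using assms unfolding localize_def by blast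

lemma localize_mono: "I \<subseteq> J \<Longrightarrow> localize I S \<subseteq> localize J S"
  unfolding localize_def by auto

lemma localize_superset: "mult_set A S \<Longrightarrow> I \<subseteq> localize I S"
  using localize_memI[of _ I 1 S] unfolding mult_set_def by auto

lemma localize_submodule:
  assumes A: "is_subring A" and S: "mult_set A S" and I: "submodule_of A I"
  shows "submodule_of (localize A S) (localize I S)"
  unfolding submodule_of_def
proof (intro conjI ballI)
  have S': "S \<subseteq> A" "1 \<in> S" "0 \<notin> S" "\<And>s t. s \<in> S \<Longrightarrow> t \<in> S \<Longrightarrow> s * t \<in> S" using S unfolding mult_set_def by auto
  show "0 \<in> localize I S" using localize_memI[of 0 I 1 S] submodule_zero[OF I] S' by simp
  show "x + y \<in> localize I S" if xy: "x \<in> localize I S" "y \<in> localize I S" for x y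
  proof -
    obtain a s b t where *: "x = a / s" "y = b / t" "a \<in> I" "b \<in> I" "s \<in> S" "t \<in> S" 
      using xy unfolding localize_def by blast
    have "s \<noteq> 0" "t \<noteq> 0" using * S' by metis+
    then have "x + y = (t * a + s * b) / (s * t)" using * by (simp add: field_simps)
    moreover have "t * a + s * b \<in> I" using * S' submodule_add[OF I] submodule_smult[OF I] by blast
    ultimately show ?thesis using * S' localize_memI by metis
  qed
  show "x * y \<in> localize I S" if xy: "x \<in> localize A S" "y \<in> localize I S" for x y
  proof -
    obtain a s b t where *: "x = a / s" "y = b / t" "a \<in> A" "b \<in> I" "s \<in> S" "t \<in> S" 
      using xy unfolding localize_def by blast
    have "x * y = (a * b) / (s * t)" using * by (simp add: field_simps)
    then show ?thesis using * S' localize_memI submodule_smult[OF I] by metis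
  qed
qed

lemma localize_subring:
  assumes A: "is_subring A" and S: "mult_set A S"
  shows "is_subring (localize A S)"
proof -
  have "submodule_of A A" unfolding submodule_of_def using subringD[OF A] by auto
  note M = localize_submodule[OF A S this]
  have one: "1 \<in> localize A S" using localize_superset[OF S, of A] subring_one[OF A] by blast
  have neg: "- 1 \<in> localize A S" 
    using localize_superset[OF S, of A] subring_minus[OF A subring_one[OF A]] by blast
  have "x - y \<in> localize A S" if "x \<in> localize A S" "y \<in> localize A S" for x y
    using submodule_add[OF M that(1) submodule_smult[OF M neg that(2)]] by simp
  then show ?thesis unfolding is_subring_def using one submodule_smult[OF M] by blast
qed

lemma localize_ideal:
  assumes A: "is_subring A" and S: "mult_set A S" and I: "is_ideal A I"
  shows "is_ideal (localize A S) (localize I S)"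
  using localize_submodule[OF A S ideal_submodule[OF I]] ideal_sub[OF I] 
  unfolding is_ideal_def localize_def by blast

lemma localize_prime_contract:
  assumes A: "is_subring A" and S: "mult_set A S" and q: "is_prime A q" and d: "q \<inter> S = {}"
  shows "localize q S \<inter> A = q"
proof
  show "q \<subseteq> localize q S \<inter> A" using localize_superset[OF S] ideal_sub[OF prime_ideal[OF q]] by blast
  show "localize q S \<inter> A \<subseteq> q"
  proof
    fix x assume x: "x \<in> localize q S \<inter> A"
    then obtain a s where as: "a \<in> q" "s \<in> S" "x = a / s" unfolding localize_def by blast
    then have "s \<in> A" "s \<noteq> 0" "s \<notin> q" using S d unfolding mult_set_def by blast+
    then show "x \<in> q" using prime_mult[OF q, of x s] as x by auto
  qed
qed

lemma localize_prime:
  assumes A: "is_subring A" and S: "mult_set A S" and q: "is_prime A q" and d: "q \<inter> S = {}"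
  shows "is_prime (localize A S) (localize q S)"
  unfolding is_prime_def
proof (intro conjI ballI impI)
  show "is_ideal (localize A S) (localize q S)" using localize_ideal[OF A S prime_ideal[OF q]] .
  show "1 \<notin> localize q S" 
    using localize_prime_contract[OF A S q d] subring_one[OF A] prime_one[OF q] by blast
  fix x y assume xy: "x \<in> localize A S" "y \<in> localize A S" "x * y \<in> localize q S"
  then obtain a s b t c u where *: "x = a / s" "y = b / t" "x * y = c / u" "a \<in> A" "b \<in> A" "c \<in> q" "s \<in> S" "t \<in> S" "u \<in> S"
    unfolding localize_def by blast
  have nz: "s \<noteq> 0" "t \<noteq> 0" "u \<noteq> 0" and SA: "s \<in> A" "t \<in> A" "u \<in> A" "u \<notin> q"
    using * S d unfolding mult_set_def by blast+
  have "a = s * x" "b = t * y" "c = u * (x * y)" using *(1-3) nz by simp_all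
  then have "(a * b) * u = (s * t) * c" by (simp add: ac_simps)
  then have "(a * b) * u \<in> q" using ideal_mult[OF prime_ideal[OF q]] * SA subring_mult[OF A] by metis
  then have "a * b \<in> q" using prime_mult[OF q _ SA(3)] SA(4) * subring_mult[OF A] by blast
  then have "a \<in> q \<or> b \<in> q" using prime_mult[OF q] * by blast
  then show "x \<in> localize q S \<or> y \<in> localize q S" using * localize_memI by metis
qed

lemma contract_ideal:
  assumes "A \<subseteq> B" "is_subring A" "is_ideal B I" shows "is_ideal A (I \<inter> A)"
  using assms unfolding is_ideal_def submodule_of_def by (auto simp: subringD)

lemma contract_prime:
  assumes "A \<subseteq> B" "is_subring A" "is_prime B q" shows "is_prime A (q \<inter> A)"
  unfolding is_prime_def
proof (intro conjI ballI impI)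
  show "is_ideal A (q \<inter> A)" using contract_ideal[OF assms(1,2) prime_ideal[OF assms(3)]] .
  show "1 \<notin> q \<inter> A" using prime_one[OF assms(3)] by blast
  fix a b assume "a \<in> A" "b \<in> A" "a * b \<in> q \<inter> A"
  then show "a \<in> q \<inter> A \<or> b \<in> q \<inter> A" using prime_mult[OF assms(3), of a b] assms(1) by blast
qed

text \<open>
  Ideals of a localization are extended from the ring; primes and finite generation are
  transferred through this.
\<close>

lemma extend_contract:
  assumes A: "is_subring A" and S: "mult_set A S" and I: "is_ideal (localize A S) I"
  shows "localize (I \<inter> A) S = I"
proof
  have SL: "inverse s \<in> localize A S" if "s \<in> S" for s
    using localize_memI[OF subring_one[OF A] that] by (simp add: inverse_eq_divide)
  show "localize (I \<inter> A) S \<subseteq> I"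
  proof
    fix x assume "x \<in> localize (I \<inter> A) S"
    then obtain a s where "a \<in> I" "s \<in> S" "x = inverse s * a" unfolding localize_def by (auto simp: field_simps)
    then show "x \<in> I" using ideal_mult[OF I SL] by blast
  qed
  show "I \<subseteq> localize (I \<inter> A) S"
  proof
    fix x assume x: "x \<in> I"
    then obtain a s where as: "a \<in> A" "s \<in> S" "x = a / s" using ideal_sub[OF I] localize_memE by metis
    then have "s \<noteq> 0" "s \<in> A" using S unfolding mult_set_def by blast+
    moreover then have sL: "s \<in> localize A S" using localize_superset[OF S, of A] by blast
    ultimately have "a \<in> I" using ideal_mult[OF I sL x] as(3) by simp
    then show "x \<in> localize (I \<inter> A) S" using as localize_memI[of a "I \<inter> A" s S] by simp
  qed
qed

lemma noeth_localize:
  assumes N: "noeth A" and S: "mult_set A S" shows "noeth (localize A S)"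
  unfolding noeth_def
proof (intro conjI allI impI)
  have A: "is_subring A" using N noethD by blast
  show L: "is_subring (localize A S)" using localize_subring[OF A S] .
  fix I assume I: "is_ideal (localize A S) I"
  obtain W where W: "finite W" "W \<subseteq> I \<inter> A" "I \<inter> A = lspan A W" 
    using noeth_fg[OF N contract_ideal[OF localize_superset[OF S] A I]] .
  have "I \<subseteq> lspan (localize A S) W"
  proof
    fix x assume "x \<in> I"
    then have "x \<in> localize (I \<inter> A) S" using extend_contract[OF A S I] by simp
    then obtain a s where as: "a \<in> lspan A W" "s \<in> S" "x = (1 / s) * a" 
      unfolding W(3) localize_def by auto
    have "lspan A W \<subseteq> lspan (localize A S) W"
    proof (rule lspan_least)
      show "submodule_of A (lspan (localize A S) W)"
        using lspan_submodule[OF L, of W] localize_superset[OF S, of A] unfolding submodule_of_def by blast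
    qed (use lspan_superset[OF L] in blast)
    then have "a \<in> lspan (localize A S) W" using as(1) by blast
    then show "x \<in> lspan (localize A S) W" 
      using as submodule_smult[OF lspan_submodule[OF L]] localize_memI[OF subring_one[OF A] as(2)] by blast
  qed
  moreover have "lspan (localize A S) W \<subseteq> I" using lspan_least[OF ideal_submodule[OF I]] W(2) by blast
  ultimately show "\<exists>W. finite W \<and> I = lspan (localize A S) W" using W(1) by blast
qed

lemma localize_at_prime_local:
  assumes A: "is_subring A" and q: "is_prime A q"
  shows "is_local (localize A (A - q)) (localize q (A - q))"
proof -
  note S = prime_complement_mult_set[OF A q]
  have p: "is_prime (localize A (A - q)) (localize q (A - q))" by (rule localize_prime[OF A S q]) blast
  have "inverse x \<in> localize A (A - q)" if x: "x \<in> localize A (A - q)" "x \<notin> localize q (A - q)" for x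
  proof -
    obtain a s where as: "a \<in> A" "s \<in> A - q" "x = a / s" using x(1) localize_memE by metis
    then have "a \<notin> q" using x(2) localize_memI[of a q s "A - q"] by blast
    then have "s / a \<in> localize A (A - q)" using as localize_memI[of s A a "A - q"] by blast
    then show ?thesis using as(3) by simp
  qed
  then show ?thesis using p localize_subring[OF A S] by (auto simp: is_local_def is_prime_def)
qed

section \<open>Krull's height theorem\<close>

definition prime_chain_from :: "'a::field set \<Rightarrow> 'a set \<Rightarrow> nat \<Rightarrow> (nat \<Rightarrow> 'a set) \<Rightarrow> bool" where
  "prime_chain_from A I d q \<longleftrightarrow> I \<subseteq> q 0 \<and> (\<forall>i\<le>d. is_prime A (q i)) \<and> (\<forall>i<d. q i \<subset> q (Suc i))"

text \<open>
  The height theorem relative to an ideal \<open>I\<close>, hence also for \<open>A / I\<close>, by induction on the number of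
  elements.  Let \<open>Q\<close> be a maximal prime among those that contain the last but one member of the chain and
  differ from \<open>m\<close>, and let \<open>a \<in> W\<close> be outside \<open>Q\<close>.  Then \<open>m\<close> is the only prime over \<open>Q + (a)\<close>, so a power of each other
  \<open>w \<in> W\<close> equals \<open>c a + b\<close> with \<open>b \<in> Q\<close>.  By the principal ideal theorem \<open>Q\<close> is minimal over \<open>I\<close> and these
  \<open>b\<close>, and the induction hypothesis applies in the localization at \<open>Q\<close>.
\<close>

theorem height_theorem:
  assumes "noeth A" "is_local A m" "finite W" "card W \<le> n" "W \<subseteq> m" 
    and "\<And>p. is_prime A p \<Longrightarrow> I \<subseteq> p \<Longrightarrow> W \<subseteq> p \<Longrightarrow> p = m" 
    and "prime_chain_from A I d q"
  shows "d \<le> n"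
  using assms
proof (induction n arbitrary: A m W I d q)
  case 0
  then have W: "W = {}" by simp
  show ?case
  proof (rule ccontr)
    assume "\<not> d \<le> 0"
    then have "is_prime A (q 0)" "is_prime A (q (Suc 0))" "I \<subseteq> q 0" "q 0 \<subset> q (Suc 0)" 
      using 0(7) by (auto simp: prime_chain_from_def)
    then show False using 0(6)[of "q 0"] 0(6)[of "q (Suc 0)"] W by auto
  qed
next
  case (Suc n)
  note N = Suc.prems(1) and L = Suc.prems(2) and only = Suc.prems(6)
  have A: "is_subring A" using N noethD by blast
  have ch: "I \<subseteq> q 0" "\<And>i. i \<le> d \<Longrightarrow> is_prime A (q i)" "\<And>i. i < d \<Longrightarrow> q i \<subset> q (Suc i)"
    using Suc.prems(7) by (auto simp: prime_chain_from_def)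
  show ?case
  proof (cases d)
    case (Suc e)
    have qm: "q d \<subseteq> m" using local_proper_ideal[OF L] ch(2)[of d] by (auto simp: is_prime_def)
    have qe: "is_prime A (q e)" "q e \<noteq> m" using ch(2)[of e] ch(3)[of e] qm Suc by auto
    have mono: "q i \<subseteq> q j" if "i \<le> j" "j \<le> d" for i j
      using that
    proof (induction j)
      case (Suc j) then show ?case using ch(3)[of j] by (cases "i = Suc j") auto
    qed simp
    define C where "C = {p. is_prime A p \<and> q e \<subseteq> p \<and> p \<noteq> m}"
    have "C \<noteq> {}" using qe C_def by blast
    moreover have "is_ideal A p" if "p \<in> C" for p using that by (simp add: C_def is_prime_def)
    ultimately obtain Q where Q: "Q \<in> C" "\<And>p. p \<in> C \<Longrightarrow> Q \<subseteq> p \<Longrightarrow> p = Q" using noeth_maximal[OF N, of C] by metis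
    have Qp: "is_prime A Q" "q e \<subseteq> Q" "Q \<noteq> m" using Q(1) by (auto simp: C_def)
    have Qm: "Q \<subset> m" using local_proper_ideal[OF L prime_ideal[OF Qp(1)] prime_one[OF Qp(1)]] Qp(3) by blast
    have IQ: "I \<subseteq> Q" using ch(1) mono[of 0 e] Suc Qp(2) by auto
    then obtain a where a: "a \<in> W" "a \<notin> Q" using only[OF Qp(1)] Qp(3) by blast
    have WA: "W \<subseteq> A" using Suc.prems(5) ideal_sub[OF local_ideal[OF L]] by blast
    define J where "J = lspan A (insert a Q)"
    have Jeq: "J = {c * a + k | c k. c \<in> A \<and> k \<in> Q}" unfolding J_def by (rule lspan_union_ideal[OF A prime_ideal[OF Qp(1)]])
    have Ji: "is_ideal A J" unfolding J_def using WA a ideal_sub[OF prime_ideal[OF Qp(1)]] by (intro lspan_ideal[OF A]) auto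
    have JQ: "Q \<subseteq> J" "a \<in> J" unfolding J_def using lspan_superset[OF A] by blast+
    have Jm: "p = m" if p: "is_prime A p" "J \<subseteq> p" for p
    proof (rule ccontr)
      assume "p \<noteq> m"
      then have "p \<in> C" unfolding C_def using p JQ(1) Qp(2) by blast
      then have "p = Q" using Q(2) p JQ(1) by blast
      then show False using p(2) JQ(2) a(2) by blast
    qed
    have "\<exists>s b. b \<in> Q \<and> (\<exists>c\<in>A. x ^ s = c * a + b)" if x: "x \<in> W" for x
      using nilpotent_mod[OF N L Ji Jm, of x] x Suc.prems(5) Jeq by blast
    then obtain s b where sb: "\<And>x. x \<in> W \<Longrightarrow> b x \<in> Q" "\<And>x. x \<in> W \<Longrightarrow> \<exists>c\<in>A. x ^ s x = c * a + b x" by metis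
    define S where "S = A - Q"
    define W' where "W' = b ` (W - {a})"
    have S: "mult_set A S" unfolding S_def using prime_complement_mult_set[OF A Qp(1)] .
    have "e \<le> n"
    proof (rule Suc.IH)
      show "noeth (localize A S)" using noeth_localize[OF N S] .
      show LL: "is_local (localize A S) (localize Q S)" unfolding S_def using localize_at_prime_local[OF A Qp(1)] .
      show "finite W'" unfolding W'_def using Suc.prems(3) by simp
      show "card W' \<le> n" unfolding W'_def
        using card_image_le[of "W - {a}" b] Suc.prems(3,4) a(1) by (simp add: card_Diff_singleton)
      show "W' \<subseteq> localize Q S" unfolding W'_def using sb(1) localize_superset[OF S] by blast
      show "p = localize Q S" if p: "is_prime (localize A S) p" "localize I S \<subseteq> p" "W' \<subseteq> p" for p
      proof -
        define c where "c = p \<inter> A"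
        have c: "is_prime A c" unfolding c_def using contract_prime[OF localize_superset[OF S] A p(1)] .
        have pc: "p = localize c S" unfolding c_def using extend_contract[OF A S prime_ideal[OF p(1)]] by simp
        have "p \<subseteq> localize Q S" using local_proper_ideal[OF LL prime_ideal[OF p(1)] prime_one[OF p(1)]] .
        then have cQ: "c \<subseteq> Q" using localize_prime_contract[OF A S Qp(1)] unfolding c_def S_def by blast
        \<comment> \<open>Otherwise some prime over \<open>c\<close> and \<open>a\<close> differs from \<open>m\<close>; it contains all powers \<open>x ^ s x\<close>, hence \<open>W\<close>.\<close>
        have "c = Q"
        proof (rule ccontr)
          assume "c \<noteq> Q"
          then obtain r where r: "is_prime A r" "c \<subseteq> r" "a \<in> r" "r \<noteq> m"
            using principal_ideal_theorem[OF N L c Qp(1) _ Qm, of a] cQ a Suc.prems(5) by blast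
          have "W \<subseteq> r"
          proof
            fix x assume x: "x \<in> W"
            show "x \<in> r"
            proof (cases "x = a")
              case False
              then have "b x \<in> p" "b x \<in> A" using x p(3) sb(1) ideal_sub[OF prime_ideal[OF Qp(1)]] unfolding W'_def by auto
              then have br: "b x \<in> r" using r(2) c_def by blast
              obtain d where d: "d \<in> A" "x ^ s x = d * a + b x" using sb(2) x by blast
              then have "x ^ s x \<in> r" using br r ideal_add[OF prime_ideal[OF r(1)]] ideal_mult[OF prime_ideal[OF r(1)]] by metis
              then show ?thesis using prime_power[OF r(1) A] x WA by blast
            qed (use r in simp)
          qed
          moreover have "I \<subseteq> r" using p(2) localize_superset[OF S, of I] IQ ideal_sub[OF prime_ideal[OF Qp(1)]] r(2)
            unfolding c_def by blast
          ultimately show False using only[OF r(1)] r(4) by blast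
        qed
        then show ?thesis using pc by simp
      qed
      show "prime_chain_from (localize A S) (localize I S) e (\<lambda>i. localize (q i) S)"
        unfolding prime_chain_from_def
      proof (intro conjI allI impI)
        show "localize I S \<subseteq> localize (q 0) S" by (rule localize_mono[OF ch(1)])
        have qi: "is_prime A (q i)" "q i \<inter> S = {}" if "i \<le> e" for i
          using ch(2)[of i] that Suc mono[of i e] Qp(2) unfolding S_def by auto
        show "is_prime (localize A S) (localize (q i) S)" if "i \<le> e" for i
          using localize_prime[OF A S qi[OF that]] .
        show "localize (q i) S \<subset> localize (q (Suc i)) S" if i: "i < e" for i
        proof -
          have "q i \<subset> q (Suc i)" using ch(3)[of i] i Suc by simp
          moreover then have "localize (q i) S \<subseteq> localize (q (Suc i)) S" by (intro localize_mono) blast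
          moreover have "localize (q i) S \<inter> A = q i" "localize (q (Suc i)) S \<inter> A = q (Suc i)"
            using localize_prime_contract[OF A S qi, of i] localize_prime_contract[OF A S qi, of "Suc i"] i by simp_all
          ultimately show ?thesis by blast
        qed
      qed
    qed
    then show ?thesis using Suc by simp
  qed simp
qed

section \<open>Adjoining an element and the basis theorem\<close>

lemma rta_simps [simp]:
  "carrier ring_of_type_algebra = UNIV" "monoid.mult ring_of_type_algebra = (*)"
  "one ring_of_type_algebra = 1" "ring.zero ring_of_type_algebra = 0" "add ring_of_type_algebra = (+)"
  by (simp_all add: ring_of_type_algebra_def)

lemma rta_a_inv [simp]: "\<ominus>\<^bsub>(ring_of_type_algebra :: 'a::field ring)\<^esub> x = - x"
proof -
  interpret ring "ring_of_type_algebra :: 'a ring" by (rule ring_from_type_algebra)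
  show ?thesis using minus_equality[of "- x" x] by simp
qed

lemma subring_iff_is_subring: "subring A (ring_of_type_algebra :: 'a::field ring) \<longleftrightarrow> is_subring A"
proof -
  interpret ring "ring_of_type_algebra :: 'a ring" by (rule ring_from_type_algebra)
  show ?thesis
  proof
    assume *: "subring A ring_of_type_algebra"
    show "is_subring A" unfolding is_subring_def
    proof (intro conjI ballI)
      show "1 \<in> A" using subringE(3)[OF *] by simp
      fix x y assume "x \<in> A" "y \<in> A"
      then show "x - y \<in> A" "x * y \<in> A" 
        using subringE(5)[OF *, of y] subringE(6)[OF *, of x y] subringE(7)[OF *, of x "- y"] by auto
    qed
  next
    assume "is_subring A"
    then show "subring A ring_of_type_algebra"
      by (intro subringI) (auto simp: subringD)
  qed
qed

lemma is_subring_adjoin: "is_subring (adjoin A T)"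
proof -
  interpret ring "ring_of_type_algebra :: 'a ring" by (rule ring_from_type_algebra)
  show ?thesis unfolding adjoin_def subring_iff_is_subring[symmetric] by (rule generate_ring_is_subring) simp
qed

lemma adjoin_superset: "A \<union> T \<subseteq> adjoin A T"
  unfolding adjoin_def by (auto intro: generate_ring.incl)

lemma adjoin_least: 
  assumes "is_subring (B :: 'a::field set)" "A \<union> T \<subseteq> B" shows "adjoin A T \<subseteq> B"
proof -
  interpret ring "ring_of_type_algebra :: 'a ring" by (rule ring_from_type_algebra)
  show ?thesis unfolding adjoin_def 
    using generate_ring_min_subring1[of "A \<union> T" B] assms by (simp add: subring_iff_is_subring)
qed

text \<open>
  Polynomial expressions in \<open>y\<close> of degree less than \<open>n\<close>.  The representation is not unique when
  \<open>y\<close> is algebraic over \<open>A\<close>, which does not matter for the arguments on leading coefficients.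
\<close>

primrec polys_below :: "'a::field set \<Rightarrow> 'a \<Rightarrow> nat \<Rightarrow> 'a set" where
  "polys_below A y 0 = {0}"
| "polys_below A y (Suc n) = {a * y ^ n + b | a b. a \<in> A \<and> b \<in> polys_below A y n}"

lemma polys_below_SucI: "a \<in> A \<Longrightarrow> b \<in> polys_below A y n \<Longrightarrow> a * y ^ n + b \<in> polys_below A y (Suc n)"
  by auto

lemma polys_below_submodule: 
  assumes "is_subring A" shows "submodule_of A (polys_below A y n)"
proof (induction n)
  case 0 show ?case by (simp add: submodule_of_def)
next
  case (Suc n)
  show ?case unfolding submodule_of_def
  proof (intro conjI ballI)
    show "0 \<in> polys_below A y (Suc n)" 
      using polys_below_SucI[of 0 A 0 y n] subring_zero[OF assms] submodule_zero[OF Suc] by simp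
    fix x z assume "x \<in> polys_below A y (Suc n)" "z \<in> polys_below A y (Suc n)"
    then obtain a b c d where *: "x = a * y ^ n + b" "z = c * y ^ n + d" "a \<in> A" "c \<in> A" 
      "b \<in> polys_below A y n" "d \<in> polys_below A y n" by auto
    have "x + z = (a + c) * y ^ n + (b + d)" using * by (simp add: algebra_simps)
    then show "x + z \<in> polys_below A y (Suc n)"
      using polys_below_SucI[of "a + c" A "b + d" y n] * subring_add[OF assms] submodule_add[OF Suc] by metis
  next
    fix x z assume "x \<in> A" "z \<in> polys_below A y (Suc n)"
    then obtain c d where *: "z = c * y ^ n + d" "c \<in> A" "d \<in> polys_below A y n" by auto
    have "x * z = (x * c) * y ^ n + (x * d)" using * by (simp add: algebra_simps)
    then show "x * z \<in> polys_below A y (Suc n)"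
      using polys_below_SucI[of "x * c" A "x * d" y n] * \<open>x \<in> A\<close> subring_mult[OF assms] submodule_smult[OF Suc] by metis
  qed
qed

lemma polys_below_Suc: "is_subring A \<Longrightarrow> polys_below A y n \<subseteq> polys_below A y (Suc n)"
  using polys_below_SucI[of 0 A _ y n] subring_zero by force

lemma polys_below_mono: "is_subring A \<Longrightarrow> n \<le> k \<Longrightarrow> polys_below A y n \<subseteq> polys_below A y k"
  using lift_Suc_mono_le[of "polys_below A y" n k] polys_below_Suc by blast

lemma polys_below_shift:
  assumes "b \<in> polys_below A y n" "is_subring A" shows "y ^ k * b \<in> polys_below A y (k + n)"
proof -
  have *: "y * b \<in> polys_below A y (Suc n)" if "b \<in> polys_below A y n" for b n
    using that
  proof (induction n arbitrary: b)
    case 0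
    then have "y * b = 0" by simp
    moreover have "0 \<in> polys_below A y (Suc 0)" by (rule submodule_zero[OF polys_below_submodule[OF assms(2)]])
    ultimately show ?case by metis
  next
    case (Suc n)
    then obtain a d where ad: "b = a * y ^ n + d" "a \<in> A" "d \<in> polys_below A y n" by auto
    have "y * b = a * y ^ Suc n + y * d" using ad by (simp add: algebra_simps)
    then show ?case using polys_below_SucI[OF ad(2) Suc.IH[OF ad(3)]] by metis
  qed
  show ?thesis
  proof (induction k)
    case 0 then show ?case using assms by simp
  next
    case (Suc k) then show ?case using *[OF Suc] by (simp add: mult.assoc)
  qed
qed

lemma adjoin_eq_polys:
  assumes A: "is_subring A" shows "adjoin A {y} = (\<Union>n. polys_below A y n)" (is "_ = ?U")
proof
  have one: "1 \<in> polys_below A y 1" using polys_below_SucI[of 1 A 0 y 0] subring_one[OF A] by simp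
  have mem: "x \<in> ?U \<and> z \<in> ?U \<Longrightarrow> \<exists>n. x \<in> polys_below A y n \<and> z \<in> polys_below A y n" for x z
    using polys_below_mono[OF A] by (metis UN_E in_mono max.cobounded1 max.cobounded2)
  have mult: "x * z \<in> ?U" if "x \<in> polys_below A y n" "z \<in> polys_below A y k" for x z n k
    using that(1)
  proof (induction n arbitrary: x)
    case 0 then show ?case using submodule_zero[OF polys_below_submodule[OF A]] by auto
  next
    case (Suc n)
    then obtain a d where ad: "x = a * y ^ n + d" "a \<in> A" "d \<in> polys_below A y n" by auto
    have "a * (y ^ n * z) \<in> polys_below A y (n + k)"
      using submodule_smult[OF polys_below_submodule[OF A] ad(2) polys_below_shift[OF that(2) A]] .
    moreover have "d * z \<in> ?U" using Suc.IH[OF ad(3)] .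
    ultimately obtain l where "a * (y ^ n * z) \<in> polys_below A y l" "d * z \<in> polys_below A y l" using mem by blast
    then have "a * (y ^ n * z) + d * z \<in> polys_below A y l" using submodule_add[OF polys_below_submodule[OF A]] by blast
    then show ?case by (auto simp: ad(1) algebra_simps)
  qed
  have "is_subring ?U" unfolding is_subring_def
  proof (intro conjI ballI)
    show "1 \<in> ?U" using one by blast
    fix x z assume "x \<in> ?U" "z \<in> ?U"
    then obtain n where "x \<in> polys_below A y n" "z \<in> polys_below A y n" using mem by blast
    then show "x - z \<in> ?U" "x * z \<in> ?U" 
      using mult[of x n z n] submodule_diff[OF A polys_below_submodule[OF A], of x y n z] by blast+
  qed
  moreover have "A \<subseteq> polys_below A y 1" using polys_below_SucI[of _ A 0 y 0] by force
  moreover have "y \<in> polys_below A y (1 + 1)" using polys_below_shift[OF one A, of 1] by (simp del: polys_below.simps)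
  ultimately show "adjoin A {y} \<subseteq> ?U" by (intro adjoin_least) (blast, blast)
  note B = is_subring_adjoin[of A "{y}"]
  have "polys_below A y n \<subseteq> adjoin A {y}" for n
  proof (induction n)
    case (Suc n)
    moreover have "A \<subseteq> adjoin A {y}" "y ^ n \<in> adjoin A {y}" 
      using adjoin_superset[of A "{y}"] subring_power[OF B, of y n] by auto
    ultimately show ?case by (auto intro!: subring_add[OF B] subring_mult[OF B])
  qed (use subring_zero[OF B] in simp)
  then show "?U \<subseteq> adjoin A {y}" by blast
qed

text \<open>
  The usual proof: leading coefficients in degree \<open>n\<close> of members of \<open>I\<close> form an increasing sequence
  of ideals \<open>L n\<close>, constant from some \<open>n0\<close> on, and lifts of their generators for \<open>n \<le> n0\<close> generate \<open>I\<close>.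
\<close>

theorem hilbert_basis:
  assumes N: "noeth A" shows "noeth (adjoin A {y})"
  unfolding noeth_def
proof (intro conjI allI impI)
  have A: "is_subring A" using N noethD by blast
  let ?B = "adjoin A {y}"
  show B: "is_subring ?B" by (rule is_subring_adjoin)
  have AB: "A \<subseteq> ?B" and yB: "y \<in> ?B" using adjoin_superset[of A "{y}"] by auto
  fix I assume I: "is_ideal ?B I"
  define L where "L n = {a \<in> A. \<exists>b\<in>polys_below A y n. a * y ^ n + b \<in> I}" for n
  note pm = polys_below_submodule[OF A]
  have Li: "is_ideal A (L n)" for n unfolding is_ideal_def submodule_of_def
  proof (intro conjI ballI)
    show "0 \<in> L n" unfolding L_def using subring_zero[OF A] submodule_zero[OF pm] ideal_zero[OF I] by auto
    show "a + b \<in> L n" if ab: "a \<in> L n" "b \<in> L n" for a b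
    proof -
      obtain u v where *: "a \<in> A" "b \<in> A" "u \<in> polys_below A y n" "v \<in> polys_below A y n" 
        "a * y ^ n + u \<in> I" "b * y ^ n + v \<in> I" using ab unfolding L_def by blast
      have "(a * y ^ n + u) + (b * y ^ n + v) \<in> I" using * ideal_add[OF I] by blast
      then have "(a + b) * y ^ n + (u + v) \<in> I" by (simp add: algebra_simps)
      then show ?thesis unfolding L_def using * subring_add[OF A] submodule_add[OF pm] by blast
    qed
    show "c * a \<in> L n" if ca: "c \<in> A" "a \<in> L n" for c a
    proof -
      obtain u where *: "a \<in> A" "u \<in> polys_below A y n" "a * y ^ n + u \<in> I" using ca unfolding L_def by blast
      have "c * (a * y ^ n + u) \<in> I" using * ca(1) AB ideal_mult[OF I] by blast
      then have "(c * a) * y ^ n + c * u \<in> I" by (simp add: algebra_simps)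
      then show ?thesis unfolding L_def using * ca(1) subring_mult[OF A] submodule_smult[OF pm] by blast
    qed
    show "L n \<subseteq> A" unfolding L_def by blast
  qed
  have LSuc: "L n \<subseteq> L (Suc n)" for n
  proof
    fix a assume "a \<in> L n"
    then obtain u where *: "a \<in> A" "u \<in> polys_below A y n" "a * y ^ n + u \<in> I" unfolding L_def by blast
    have "y * (a * y ^ n + u) \<in> I" using * yB ideal_mult[OF I] by blast
    then have "a * y ^ Suc n + y * u \<in> I" by (simp add: algebra_simps)
    moreover have "y * u \<in> polys_below A y (Suc n)" using polys_below_shift[OF *(2) A, of 1] by simp
    ultimately show "a \<in> L (Suc n)" unfolding L_def using *(1) by blast
  qed
  have Lmono: "L n \<subseteq> L k" if "n \<le> k" for n k using lift_Suc_mono_le[of L, OF LSuc that] .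
  obtain M where M: "M \<in> range L" "\<And>J. J \<in> range L \<Longrightarrow> M \<subseteq> J \<Longrightarrow> J = M"
    using noeth_maximal[OF N, of "range L"] Li by blast
  then obtain n0 where n0: "M = L n0" by blast
  have Lst: "L n = L n0" if "n \<ge> n0" for n using M(2)[of "L n"] Lmono[OF that] n0 by blast
  have "\<exists>G. finite G \<and> L n = lspan A G" for n using N Li unfolding noeth_def by blast
  then obtain G where G: "\<And>n. finite (G n)" "\<And>n. L n = lspan A (G n)" by metis
  have "\<exists>h. g \<in> G n \<longrightarrow> h \<in> I \<and> h - g * y ^ n \<in> polys_below A y n" for n g
  proof (cases "g \<in> G n")
    case True
    then have "g \<in> L n" using G(2) lspan_superset[OF A] by blast
    then obtain u where *: "u \<in> polys_below A y n" "g * y ^ n + u \<in> I" unfolding L_def by blast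
    show ?thesis by (rule exI[of _ "g * y ^ n + u"]) (use * in simp)
  qed simp
  then have "\<forall>n g. \<exists>h. g \<in> G n \<longrightarrow> h \<in> I \<and> h - g * y ^ n \<in> polys_below A y n" by blast
  then obtain h where h: "\<And>n g. g \<in> G n \<Longrightarrow> h n g \<in> I" "\<And>n g. g \<in> G n \<Longrightarrow> h n g - g * y ^ n \<in> polys_below A y n"
    unfolding choice_iff by blast
  define W where "W = (\<Union>n\<le>n0. h n ` G n)"
  have W: "finite W" "W \<subseteq> I" unfolding W_def using G(1) h(1) by auto
  have sW: "submodule_of ?B (lspan ?B W)" using lspan_submodule[OF B] .
  have WI: "lspan ?B W \<subseteq> I" using lspan_least[OF ideal_submodule[OF I] W(2)] .
  have lead: "\<exists>f\<in>lspan ?B W. f - a * y ^ n \<in> polys_below A y n" if "n \<le> n0" "a \<in> lspan A (G n)" for a n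
    using that(2)
  proof induction
    case lspan_zero then show ?case using submodule_zero[OF sW] submodule_zero[OF pm] by force
  next
    case (lspan_step c g a)
    then obtain f where f: "f \<in> lspan ?B W" "f - a * y ^ n \<in> polys_below A y n" by blast
    have "h n g \<in> W" unfolding W_def using that(1) lspan_step(2) by blast
    then have "c * h n g \<in> lspan ?B W" using submodule_smult[OF sW] lspan_step(1) AB lspan_superset[OF B] by blast
    then have "c * h n g + f \<in> lspan ?B W" using f(1) submodule_add[OF sW] by blast
    moreover have "c * (h n g - g * y ^ n) + (f - a * y ^ n) \<in> polys_below A y n"
      using h(2)[OF lspan_step(2)] f(2) lspan_step(1) submoduleD[OF pm] by blast
    then have "(c * h n g + f) - (c * g + a) * y ^ n \<in> polys_below A y n" by (simp add: algebra_simps)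
    ultimately show ?case by blast
  qed
  have "f \<in> lspan ?B W" if "f \<in> I" "f \<in> polys_below A y n" for f n
    using that
  proof (induction n arbitrary: f)
    case 0 then show ?case using submodule_zero[OF sW] by simp
  next
    case (Suc n)
    then obtain a b where ab: "f = a * y ^ n + b" "a \<in> A" "b \<in> polys_below A y n" by auto
    then have aL: "a \<in> L n" unfolding L_def using Suc.prems(1) by blast
    have "\<exists>f'\<in>lspan ?B W. f' - a * y ^ n \<in> polys_below A y n"
    proof (cases "n \<le> n0")
      case True then show ?thesis using lead aL G(2) by blast
    next
      case False
      then have "a \<in> lspan A (G n0)" using aL Lst[of n] G(2) by simp
      then obtain f' where f': "f' \<in> lspan ?B W" "f' - a * y ^ n0 \<in> polys_below A y n0" using lead by blast
      have "y ^ (n - n0) * (f' - a * y ^ n0) \<in> polys_below A y n"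
        using polys_below_shift[OF f'(2) A, of "n - n0"] False by simp
      moreover have "y ^ n = y ^ (n - n0) * y ^ n0" using False by (simp add: power_add[symmetric])
      ultimately have "y ^ (n - n0) * f' - a * y ^ n \<in> polys_below A y n" by (simp add: algebra_simps)
      then show ?thesis using submodule_smult[OF sW subring_power[OF B yB] f'(1)] by blast
    qed
    then obtain f' where f': "f' \<in> lspan ?B W" "f' - a * y ^ n \<in> polys_below A y n" by blast
    have "b - (f' - a * y ^ n) \<in> polys_below A y n" using submodule_diff[OF A pm ab(3) f'(2)] .
    then have "f - f' \<in> polys_below A y n" by (simp add: ab(1) algebra_simps)
    moreover have "f - f' \<in> I" using Suc.prems(1) f'(1) WI ideal_diff[OF B I] by blast
    ultimately have "f - f' \<in> lspan ?B W" using Suc.IH by blast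
    then have "(f - f') + f' \<in> lspan ?B W" using f'(1) submodule_add[OF sW] by blast
    then show ?case by simp
  qed
  then have "I \<subseteq> lspan ?B W" using ideal_sub[OF I] unfolding adjoin_eq_polys[OF A] by blast
  then show "\<exists>W. finite W \<and> I = lspan ?B W" using W(1) WI by blast
qed

section \<open>Sequences of elements generating prime ideals\<close>

text \<open>
  Each initial part of the list generates, together with \<open>I\<close>, a prime ideal not containing the
  next element.  This is a regular sequence modulo \<open>I\<close> and a strict chain of primes at the same time.
\<close>

fun prime_seq :: "'a::field set \<Rightarrow> 'a set \<Rightarrow> 'a list \<Rightarrow> bool" where
  "prime_seq A I [] \<longleftrightarrow> is_prime A I"
| "prime_seq A I (w # ws) \<longleftrightarrow> is_prime A I \<and> w \<in> A \<and> w \<notin> I \<and> prime_seq A (lspan A (insert w I)) ws"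

definition nonzerodiv_mod :: "'a::field set \<Rightarrow> 'a set \<Rightarrow> 'a \<Rightarrow> bool" where
  "nonzerodiv_mod A I b \<longleftrightarrow> (\<forall>c\<in>A. c * b \<in> I \<longrightarrow> c \<in> I)"

lemma prime_seq_prime: "prime_seq A I ws \<Longrightarrow> is_prime A I"
  by (cases ws) auto

lemma prime_seq_notin: 
  assumes "is_subring A" "prime_seq A I ws" "w \<in> set ws" shows "w \<in> A" "w \<notin> I"
proof -
  have "w \<in> A \<and> w \<notin> I" using assms(2,3)
  proof (induction ws arbitrary: I)
    case (Cons v ws)
    then show ?case using lspan_superset[OF assms(1), of _ "insert v I"] by auto
  qed simp
  then show "w \<in> A" "w \<notin> I" by auto
qed

lemma prime_seq_append:
  assumes A: "is_subring A"
  shows "prime_seq A I ws \<Longrightarrow> prime_seq A (lspan A (set ws \<union> I)) vs \<Longrightarrow> prime_seq A I (ws @ vs)"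
proof (induction ws arbitrary: I)
  case Nil then show ?case using lspan_ideal_eq[OF A, of I] by (simp add: is_prime_def)
next
  case (Cons w ws)
  have "lspan A (set (w # ws) \<union> I) = lspan A (set ws \<union> lspan A (insert w I))" (is "?l = ?r")
  proof
    have "insert w I \<subseteq> lspan A (insert w I)" using lspan_superset[OF A] by blast
    then have "set (w # ws) \<union> I \<subseteq> set ws \<union> lspan A (insert w I)" by auto
    then show "?l \<subseteq> ?r" by (rule lspan_mono[OF A])
    have "lspan A (insert w I) \<subseteq> ?l" by (rule lspan_mono[OF A]) auto
    moreover have "set ws \<subseteq> ?l" using lspan_superset[OF A, of _ "set (w # ws) \<union> I"] by auto
    ultimately show "?r \<subseteq> ?l" by (intro lspan_least lspan_submodule[OF A]) auto
  qed
  then show ?case using Cons by simp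
qed

lemma prime_nonzerodiv: "is_prime A I \<Longrightarrow> b \<in> A \<Longrightarrow> b \<notin> I \<Longrightarrow> nonzerodiv_mod A I b"
  unfolding nonzerodiv_mod_def using primeD(3) by blast

text \<open>
  Half of the exchange of two neighbours \<open>a\<close>, \<open>b\<close> in a regular sequence; this half is formal.
\<close>

lemma nonzerodiv_exchange:
  assumes A: "is_subring A" and I: "is_ideal A I" and a: "a \<in> A" and b: "b \<in> A"
    and na: "nonzerodiv_mod A I a" and nb: "nonzerodiv_mod A (lspan A (insert a I)) b"
  shows "nonzerodiv_mod A (lspan A (insert b I)) a"
  unfolding nonzerodiv_mod_def
proof (intro ballI impI)
  fix c assume c: "c \<in> A" "c * a \<in> lspan A (insert b I)"
  then obtain d i where di: "c * a = d * b + i" "d \<in> A" "i \<in> I" unfolding lspan_union_ideal[OF A I] by blast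
  then have "d * b = c * a + (- i)" by simp
  moreover have "- i \<in> I" using ideal_minus[OF A I di(3)] .
  ultimately have "d * b \<in> lspan A (insert a I)" unfolding lspan_union_ideal[OF A I] using c(1) by blast
  then have "d \<in> lspan A (insert a I)" using nb di(2) unfolding nonzerodiv_mod_def by blast
  then obtain e j where ej: "d = e * a + j" "e \<in> A" "j \<in> I" unfolding lspan_union_ideal[OF A I] by blast
  have "(c - e * b) * a = j * b + i" using di(1) ej(1) by (simp add: algebra_simps)
  moreover have "j * b + i \<in> I" using ej(3) di(3) b ideal_mult2[OF I] ideal_add[OF I] by blast
  moreover have "c - e * b \<in> A" using subring_diff[OF A c(1) subring_mult[OF A ej(2) b]] .
  ultimately have "c - e * b \<in> I" using na unfolding nonzerodiv_mod_def by metis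
  moreover have "c = e * b + (c - e * b)" by simp
  ultimately show "c \<in> lspan A (insert b I)" unfolding lspan_union_ideal[OF A I] using ej(2) by blast
qed

text \<open>
  The other half of the exchange.  If \<open>c b \<in> I\<close> then \<open>c \<in> I + (a)\<close>, say \<open>c = d a + i\<close>, and \<open>d b \<in> I\<close> again;
  so the colon ideal \<open>(I : b)\<close> is contained in \<open>I\<close> plus \<open>a\<close> times itself, and Nakayama's lemma applies.
\<close>

lemma nonzerodiv_descend:
  assumes L: "is_local A m" and N: "noeth A" and I: "is_ideal A I" and a: "a \<in> m" and b: "b \<in> A"
    and na: "nonzerodiv_mod A I a" and nb: "nonzerodiv_mod A (lspan A (insert a I)) b"
  shows "nonzerodiv_mod A I b"
proof -
  have A: "is_subring A" using L local_subring by blast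
  have aA: "a \<in> A" using a ideal_sub[OF local_ideal[OF L]] by blast
  have "{c \<in> A. c * b \<in> I} \<subseteq> I"
  proof (rule nakayama[OF L N a I colon_ideal[OF A I b]])
    fix c assume "c \<in> {c \<in> A. c * b \<in> I}"
    then have c: "c \<in> A" "c * b \<in> I" by auto
    then have "c * b \<in> lspan A (insert a I)" using lspan_superset[OF A] by blast
    then have "c \<in> lspan A (insert a I)" using nb c(1) unfolding nonzerodiv_mod_def by blast
    then obtain d i where di: "c = d * a + i" "d \<in> A" "i \<in> I" unfolding lspan_union_ideal[OF A I] by blast
    have "(d * b) * a = c * b - i * b" using di by (simp add: algebra_simps)
    moreover have "c * b - i * b \<in> I" using ideal_diff[OF A I c(2)] ideal_mult2[OF I b di(3)] by blast
    ultimately have "d * b \<in> I" using na subring_mult[OF A di(2) b] unfolding nonzerodiv_mod_def by metis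
    moreover have "c - a * d \<in> I" using di by (simp add: algebra_simps)
    ultimately show "\<exists>y\<in>{c \<in> A. c * b \<in> I}. c - a * y \<in> I" using di(2) by blast
  qed
  then show ?thesis unfolding nonzerodiv_mod_def by blast
qed

text \<open>
  By induction the assertion on \<open>u\<close> and \<open>v\<close> holds modulo the first element \<open>w\<close>.  Exchanging \<open>w\<close> past \<open>v\<close>
  makes \<open>w\<close> a nonzerodivisor modulo \<open>v\<close>, and then \<open>w\<close> can be dropped.  So a regular sequence in a
  Noetherian local ring may be permuted.
\<close>

lemma prime_seq_permute:
  assumes L: "is_local A m" and N: "noeth A" and "prime_seq A I ws" "set ws \<subseteq> m" "distinct ws"
    and "u \<in> set ws" "v \<in> set ws" "u \<noteq> v"
  shows "nonzerodiv_mod A (lspan A (insert v I)) u"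
  using assms(3-8)
proof (induction ws arbitrary: I)
  case (Cons w ws)
  have A: "is_subring A" using L local_subring by blast
  let ?J = "lspan A (insert w I)"
  have p: "is_prime A I" "w \<in> A" "w \<notin> I" "prime_seq A ?J ws" using Cons.prems(1) by auto
  note I = prime_ideal[OF p(1)]
  have J: "is_prime A ?J" using prime_seq_prime[OF p(4)] .
  have wm: "w \<in> m" using Cons.prems(2) by simp
  note nw = prime_nonzerodiv[OF p(1-3)]
  have nJ: "nonzerodiv_mod A ?J x" "x \<in> A" "x \<in> m" if "x \<in> set ws" for x
    using prime_nonzerodiv[OF J] prime_seq_notin[OF A p(4) that] that Cons.prems(2) by auto
  consider "v = w" "u \<in> set ws" | "u = w" "v \<in> set ws" | "u \<in> set ws" "v \<in> set ws" using Cons.prems by auto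
  then show ?case
  proof cases
    case 1 then show ?thesis using nJ by simp
  next
    case 2 then show ?thesis using nonzerodiv_exchange[OF A I p(2) _ nw] nJ by blast
  next
    case 3
    let ?K = "lspan A (insert v I)"
    have K: "is_ideal A ?K" using nJ(2)[OF 3(2)] ideal_sub[OF I] by (intro lspan_ideal[OF A]) auto
    have eq: "lspan A (insert w ?K) = lspan A (insert v ?J)" 
    proof -
      have *: "lspan A (insert a (lspan A (insert b I))) \<subseteq> lspan A (insert b (lspan A (insert a I)))" for a b
      proof (rule lspan_least[OF lspan_submodule[OF A]])
        have "insert b (insert a I) \<subseteq> lspan A (insert b (lspan A (insert a I)))"
          using lspan_superset[OF A, of _ "insert a I"] lspan_superset[OF A, of _ "insert b (lspan A (insert a I))"] by blast
        then have "lspan A (insert b I) \<subseteq> lspan A (insert b (lspan A (insert a I)))"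
            "a \<in> lspan A (insert b (lspan A (insert a I)))"
          by (auto intro!: lspan_least[OF lspan_submodule[OF A]])
        then show "insert a (lspan A (insert b I)) \<subseteq> lspan A (insert b (lspan A (insert a I)))" by blast
      qed
      show ?thesis using * by blast
    qed
    show ?thesis
    proof (rule nonzerodiv_descend[OF L N K wm nJ(2)[OF 3(1)]])
      show "nonzerodiv_mod A ?K w" using nonzerodiv_exchange[OF A I p(2) nJ(2)[OF 3(2)] nw nJ(1)[OF 3(2)]] .
      show "nonzerodiv_mod A (lspan A (insert w ?K)) u" unfolding eq
        using Cons.IH[OF p(4)] Cons.prems 3 by auto
    qed
  qed
qed simp

lemma prime_seq_chain:
  assumes "is_subring A" "prime_seq A I ws"
  shows "\<exists>q. prime_chain_from A I (length ws) q \<and> q 0 = I"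
  using assms(2)
proof (induction ws arbitrary: I)
  case Nil
  show ?case by (rule exI[of _ "\<lambda>_. I"]) (use Nil in \<open>simp add: prime_chain_from_def\<close>)
next
  case (Cons w ws)
  then obtain q where q: "prime_chain_from A (lspan A (insert w I)) (length ws) q" "q 0 = lspan A (insert w I)" by auto
  have "insert w I \<subseteq> lspan A (insert w I)" using lspan_superset[OF assms(1)] by blast
  then have "I \<subset> q 0" using q(2) Cons.prems by auto
  show ?case
  proof (rule exI[of _ "\<lambda>i. case i of 0 \<Rightarrow> I | Suc i \<Rightarrow> q i"], intro conjI)
    show "prime_chain_from A I (length (w # ws)) (\<lambda>i. case i of 0 \<Rightarrow> I | Suc i \<Rightarrow> q i)"
      using q(1) Cons.prems \<open>I \<subset> q 0\<close> unfolding prime_chain_from_def by (auto split: nat.split)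
  qed simp
qed

section \<open>Valuations and their prime ideals\<close>

locale valued_field =
  fixes \<nu> :: "'a::field \<Rightarrow> 'g::linordered_ab_group_add"
  assumes val_mult: "x \<noteq> 0 \<Longrightarrow> y \<noteq> 0 \<Longrightarrow> \<nu> (x * y) = \<nu> x + \<nu> y"
    and val_add: "x \<noteq> 0 \<Longrightarrow> y \<noteq> 0 \<Longrightarrow> x + y \<noteq> 0 \<Longrightarrow> min (\<nu> x) (\<nu> y) \<le> \<nu> (x + y)"
begin

lemma val_one [simp]: "\<nu> 1 = 0"
  using val_mult[of 1 1] by simp

lemma val_minus [simp]: "\<nu> (- x) = \<nu> x"
proof (cases "x = 0")
  case False
  have "\<nu> (- 1) + \<nu> (- 1) = 0" using val_mult[of "- 1" "- 1"] by simp
  then have "\<nu> (- 1) = 0" by simp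
  then show ?thesis using val_mult[of "- 1" x] False by simp
qed simp

lemma val_inverse: "x \<noteq> 0 \<Longrightarrow> \<nu> (inverse x) = - \<nu> x"
  using val_mult[of x "inverse x"] by (simp add: eq_neg_iff_add_eq_0 add.commute)

lemma val_divide: "x \<noteq> 0 \<Longrightarrow> y \<noteq> 0 \<Longrightarrow> \<nu> (x / y) = \<nu> x - \<nu> y"
  using val_mult[of x "inverse y"] val_inverse[of y] by (simp add: field_class.field_divide_inverse)

lemma val_power_nonneg: "x \<noteq> 0 \<Longrightarrow> 0 \<le> \<nu> x \<Longrightarrow> 0 \<le> \<nu> (x ^ n)"
  by (induction n) (auto simp: val_mult)

lemma val_power_mono: "x \<noteq> 0 \<Longrightarrow> 0 \<le> \<nu> x \<Longrightarrow> n \<le> k \<Longrightarrow> \<nu> (x ^ n) \<le> \<nu> (x ^ k)"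
  using lift_Suc_mono_le[of "\<lambda>n. \<nu> (x ^ n)" n k] by (auto simp: val_mult)

lemma val_prod_nonneg: 
  "(\<And>i. i \<in> F \<Longrightarrow> f i \<noteq> 0 \<and> 0 \<le> \<nu> (f i)) \<Longrightarrow> 0 \<le> \<nu> (prod f F)"
  by (induction F rule: infinite_finite_induct) (auto simp: val_mult)

lemma val_add_eq:
  assumes "y \<noteq> 0" "x = 0 \<or> \<nu> y < \<nu> x" shows "y + x \<noteq> 0" "\<nu> (y + x) = \<nu> y"
proof -
  have "y + x \<noteq> 0 \<and> \<nu> (y + x) = \<nu> y"
  proof (cases "x = 0")
    case False
    then have lt: "\<nu> y < \<nu> x" using assms by blast
    have nz: "y + x \<noteq> 0"
    proof
      assume "y + x = 0"
      then have "y = - x" by (simp add: eq_neg_iff_add_eq_0)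
      then show False using lt by simp
    qed
    have "\<nu> y \<le> \<nu> (y + x)" using val_add[OF assms(1) False nz] lt by (simp add: min_def split: if_splits)
    moreover have "min (\<nu> (y + x)) (\<nu> x) \<le> \<nu> y" using val_add[of "y + x" "- x"] nz False assms(1) by simp
    ultimately show ?thesis using nz lt by (auto simp: min_def split: if_splits)
  qed (use assms in simp)
  then show "y + x \<noteq> 0" "\<nu> (y + x) = \<nu> y" by auto
qed

definition isolated :: "'g set \<Rightarrow> bool" where
  "isolated H \<longleftrightarrow> H \<subseteq> value_group \<nu> \<and> 0 \<in> H \<and> (\<forall>a\<in>H. \<forall>b\<in>H. a - b \<in> H) \<and>
     (\<forall>h\<in>H. \<forall>g\<in>value_group \<nu>. 0 \<le> g \<longrightarrow> g \<le> h \<longrightarrow> g \<in> H)"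

text \<open>
  The elements whose value exceeds \<open>v\<close> even modulo \<open>H\<close>.  For \<open>v = 0\<close> and \<open>H\<close> isolated this is the
  prime of the valuation ring that belongs to \<open>H\<close>; for general \<open>v\<close> it collects the terms negligible against
  a term of value \<open>v\<close>.
\<close>

definition above :: "'g \<Rightarrow> 'g set \<Rightarrow> 'a set" where
  "above v H = {x. x = 0 \<or> (v < \<nu> x \<and> \<nu> x - v \<notin> H)}"

abbreviation val_prime :: "'g set \<Rightarrow> 'a set" where
  "val_prime H \<equiv> above 0 H"

lemma value_groupI: "x \<noteq> 0 \<Longrightarrow> \<nu> x \<in> value_group \<nu>"
  unfolding value_group_def by blast

lemma value_group_diff: 
  assumes "g \<in> value_group \<nu>" "h \<in> value_group \<nu>" shows "g - h \<in> value_group \<nu>"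
proof -
  obtain x y where "x \<noteq> 0" "g = \<nu> x" "y \<noteq> 0" "h = \<nu> y" using assms unfolding value_group_def by blast
  then have "\<nu> (x / y) = g - h" "x / y \<noteq> 0" using val_divide by auto
  then show ?thesis using value_groupI by metis
qed

lemma isolatedD:
  assumes "isolated H"
  shows iso_zero: "0 \<in> H" and iso_diff: "a \<in> H \<Longrightarrow> b \<in> H \<Longrightarrow> a - b \<in> H"
    and iso_add: "a \<in> H \<Longrightarrow> b \<in> H \<Longrightarrow> a + b \<in> H" and iso_minus: "a \<in> H \<Longrightarrow> - a \<in> H"
    and iso_convex: "h \<in> H \<Longrightarrow> g \<in> value_group \<nu> \<Longrightarrow> 0 \<le> g \<Longrightarrow> g \<le> h \<Longrightarrow> g \<in> H"
    and iso_vg: "a \<in> H \<Longrightarrow> a \<in> value_group \<nu>"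
proof -
  show z: "0 \<in> H" and d: "\<And>a b. a \<in> H \<Longrightarrow> b \<in> H \<Longrightarrow> a - b \<in> H" 
    and "h \<in> H \<Longrightarrow> g \<in> value_group \<nu> \<Longrightarrow> 0 \<le> g \<Longrightarrow> g \<le> h \<Longrightarrow> g \<in> H" "a \<in> H \<Longrightarrow> a \<in> value_group \<nu>"
    using assms unfolding isolated_def by auto
  show m: "\<And>a. a \<in> H \<Longrightarrow> - a \<in> H" using d[OF z] by simp
  show "a \<in> H \<Longrightarrow> b \<in> H \<Longrightarrow> a + b \<in> H" using d[OF _ m, of a b] by simp
qed

lemma iso_triv: "isolated {0}"
  unfolding isolated_def using value_groupI[of 1] by auto

lemma val_power_mem:
  assumes "isolated H" "x \<noteq> 0" "\<nu> x \<in> H" shows "\<nu> (x ^ n) \<in> H"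
  by (induction n) (use assms iso_zero iso_add val_mult in auto)

lemma val_powi_mem:
  assumes "isolated H" "x \<noteq> 0" "\<nu> x \<in> H" shows "\<nu> (x powi k) \<in> H"
proof (cases "0 \<le> k")
  case True then show ?thesis using val_power_mem[OF assms] by (simp add: power_int_def)
next
  case False
  then have "x powi k = inverse (x ^ nat (- k))" by (simp add: power_int_def power_inverse)
  then show ?thesis using val_power_mem[OF assms] val_inverse[of "x ^ nat (- k)"] iso_minus[OF assms(1)] assms(2) by simp
qed

lemma val_prod_mem:
  assumes "isolated H" "finite F" "\<And>i. i \<in> F \<Longrightarrow> f i \<noteq> 0 \<and> \<nu> (f i) \<in> H" shows "\<nu> (prod f F) \<in> H"
  using assms(2,3) by (induction F) (use iso_zero[OF assms(1)] iso_add[OF assms(1)] in \<open>auto simp: val_mult\<close>)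

lemma above_submodule:
  assumes H: "isolated H" and v: "v \<in> value_group \<nu>"
  shows "submodule_of (val_ring \<nu>) (above v H)"
  unfolding submodule_of_def
proof (intro conjI ballI)
  have up: "v < b \<and> b - v \<notin> H" if "v < a" "a - v \<notin> H" "a \<le> b" "a \<in> value_group \<nu>" for a b
  proof -
    have "0 \<le> a - v" "a - v \<le> b - v" "v < b" using that(1,3) by (auto simp: diff_right_mono)
    then show ?thesis using iso_convex[OF H _ value_group_diff[OF that(4) v], of "b - v"] that(2) by blast
  qed
  show "0 \<in> above v H" unfolding above_def by simp
  fix x y assume y: "y \<in> above v H"
  show "x + y \<in> above v H" if "x \<in> above v H"
  proof (cases "x = 0 \<or> y = 0 \<or> x + y = 0")
    case True then show ?thesis using that y by (auto simp: above_def)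
  next
    case False
    then have "min (\<nu> x) (\<nu> y) \<le> \<nu> (x + y)" by (intro val_add) auto
    moreover have "v < min (\<nu> x) (\<nu> y) \<and> min (\<nu> x) (\<nu> y) - v \<notin> H \<and> min (\<nu> x) (\<nu> y) \<in> value_group \<nu>"
      using False that y value_groupI[of x] value_groupI[of y] by (auto simp: min_def above_def)
    ultimately show ?thesis using up[of "min (\<nu> x) (\<nu> y)" "\<nu> (x + y)"] by (simp add: above_def)
  qed
  show "x * y \<in> above v H" if "x \<in> val_ring \<nu>"
  proof (cases "x = 0 \<or> y = 0")
    case True then show ?thesis by (auto simp: above_def)
  next
    case False
    then have "\<nu> y \<le> \<nu> (x * y)" using that by (auto simp: val_mult val_ring_def)
    moreover have "v < \<nu> y \<and> \<nu> y - v \<notin> H \<and> \<nu> y \<in> value_group \<nu>"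
      using False y value_groupI[of y] by (auto simp: above_def)
    ultimately show ?thesis using up[of "\<nu> y" "\<nu> (x * y)"] by (simp add: above_def)
  qed
qed

lemma val_ring_subring: "is_subring (val_ring \<nu>)"
  unfolding is_subring_def
proof (intro conjI ballI)
  show "1 \<in> val_ring \<nu>" by (simp add: val_ring_def)
  fix x y assume xy: "x \<in> val_ring \<nu>" "y \<in> val_ring \<nu>"
  show "x * y \<in> val_ring \<nu>" using xy by (cases "x = 0 \<or> y = 0") (auto simp: val_ring_def val_mult)
  show "x - y \<in> val_ring \<nu>"
  proof (cases "x = 0 \<or> y = 0 \<or> x - y = 0")
    case False
    then have "min (\<nu> x) (\<nu> y) \<le> \<nu> (x - y)" using val_add[of x "- y"] by simp
    moreover have "0 \<le> min (\<nu> x) (\<nu> y)" using xy False by (auto simp: val_ring_def)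
    ultimately have "0 \<le> \<nu> (x - y)" by order
    then show ?thesis by (simp add: val_ring_def)
  qed (use xy in \<open>auto simp: val_ring_def\<close>)
qed

lemma val_prime_subset: "val_prime H \<subseteq> val_ring \<nu>"
  unfolding above_def val_ring_def by auto

lemma val_prime_is_prime: 
  assumes H: "isolated H" shows "is_prime (val_ring \<nu>) (val_prime H)"
  unfolding is_prime_def is_ideal_def
proof (intro conjI ballI impI)
  show "submodule_of (val_ring \<nu>) (val_prime H)" using above_submodule[OF H] value_groupI[of 1] by simp
  show "val_prime H \<subseteq> val_ring \<nu>" by (rule val_prime_subset)
  show "1 \<notin> val_prime H" by (simp add: above_def)
  fix a b assume ab: "a \<in> val_ring \<nu>" "b \<in> val_ring \<nu>" "a * b \<in> val_prime H"
  show "a \<in> val_prime H \<or> b \<in> val_prime H"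
  proof (rule ccontr)
    assume n: "\<not> ?thesis"
    then have nz: "a \<noteq> 0" "b \<noteq> 0" by (auto simp: above_def)
    then have "\<nu> a \<in> H" "\<nu> b \<in> H" using n ab iso_zero[OF H] by (auto simp: above_def val_ring_def not_less)
    then have "\<nu> (a * b) \<in> H" using val_mult nz iso_add[OF H] by simp
    then show False using ab(3) nz by (simp add: above_def)
  qed
qed

lemma val_prime_antimono: "H \<subseteq> G \<Longrightarrow> val_prime G \<subseteq> val_prime H"
  unfolding above_def by auto

lemma not_val_prime: 
  assumes "isolated H" "x \<in> val_ring \<nu>" "x \<notin> val_prime H" shows "x \<noteq> 0" "\<nu> x \<in> H" "0 \<le> \<nu> x"
  using assms iso_zero[OF assms(1)] by (auto simp: above_def val_ring_def not_less)

lemma contract_val_prime: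
  "is_subring A \<Longrightarrow> A \<subseteq> val_ring \<nu> \<Longrightarrow> isolated H \<Longrightarrow> is_prime A (val_prime H \<inter> A)"
  using contract_prime val_prime_is_prime by blast

lemma val_diff_neq:
  assumes "x \<noteq> 0" "y \<noteq> 0" "\<nu> x < \<nu> y" shows "x - y \<noteq> 0" "\<nu> (x - y) = \<nu> x"
  using val_add_eq[of x "- y"] assms by auto

end

lemma lspan_times:
  assumes "submodule_of A M" "x \<in> lspan A W" "y \<in> lspan A Y" "\<And>a b. a \<in> W \<Longrightarrow> b \<in> Y \<Longrightarrow> a * b \<in> M"
  shows "x * y \<in> M"
  using assms(2)
proof induction
  case lspan_zero then show ?case using submodule_zero[OF assms(1)] by simp
next
  case (lspan_step a w x)
  have "w * y \<in> M" using assms(3)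
  proof induction
    case lspan_zero then show ?case using submodule_zero[OF assms(1)] by simp
  next
    case (lspan_step b v y)
    have "b * (w * v) + w * y \<in> M" 
      using assms(4)[OF \<open>w \<in> W\<close> lspan_step(2)] lspan_step submoduleD[OF assms(1)] by blast
    then show ?case by (simp add: algebra_simps)
  qed
  then have "a * (w * y) + x * y \<in> M" using lspan_step submoduleD[OF assms(1)] by blast
  then show ?case by (simp add: algebra_simps)
qed

lemma lspan_lspan_union:
  assumes A: "is_subring A" shows "lspan A (W \<union> lspan A Y) = lspan A (W \<union> Y)"
proof
  have "lspan A Y \<subseteq> lspan A (W \<union> Y)" by (rule lspan_mono[OF A]) auto
  moreover have "W \<subseteq> lspan A (W \<union> Y)" using lspan_superset[OF A] by blast
  ultimately show "lspan A (W \<union> lspan A Y) \<subseteq> lspan A (W \<union> Y)"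
    by (intro lspan_least lspan_submodule[OF A]) auto
  show "lspan A (W \<union> Y) \<subseteq> lspan A (W \<union> lspan A Y)"
    by (rule lspan_mono[OF A]) (use lspan_superset[OF A] in auto)
qed

section \<open>Initial forms at one level of the valuation\<close>

text \<open>
  One level of the valuation: \<open>H\<close> and \<open>G\<close> are consecutive isolated subgroups, and \<open>z\<close> lists
  parameters whose values are independent in \<open>G / H\<close>.  The assumption \<open>arch\<close> says that \<open>G / H\<close> has rank one.
\<close>

locale valuation_level = valued_field \<nu> for \<nu> :: "'a::field \<Rightarrow> 'g::linordered_ab_group_add" +
  fixes A :: "'a set" and H G :: "'g set" and L :: "'i set" and z :: "'i \<Rightarrow> 'a"
  assumes noeth: "noeth A" and AV: "A \<subseteq> val_ring \<nu>" and loc: "is_local A (val_prime {0} \<inter> A)"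
    and isoH: "isolated H" and isoG: "isolated G" and HG: "H \<subseteq> G"
    and finL: "finite L" and zA: "p \<in> L \<Longrightarrow> z p \<in> A" and z0: "p \<in> L \<Longrightarrow> z p \<noteq> 0"
    and zpos: "p \<in> L \<Longrightarrow> 0 < \<nu> (z p)" and zG: "p \<in> L \<Longrightarrow> \<nu> (z p) \<in> G"
    and indep: "\<nu> (\<Prod>p\<in>L. z p powi c p) \<in> H \<Longrightarrow> p \<in> L \<Longrightarrow> c p = 0"
    and arch: "g \<in> G \<Longrightarrow> p \<in> L \<Longrightarrow> \<exists>N. g < \<nu> (z p ^ N)"
    and gens: "val_prime H \<inter> A = lspan A (z ` L \<union> (val_prime G \<inter> A))"
begin

definition expo :: "('i \<Rightarrow> nat) set" where "expo = {m. \<forall>p. p \<notin> L \<longrightarrow> m p = 0}"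
definition mon :: "('i \<Rightarrow> nat) \<Rightarrow> 'a" where "mon m = (\<Prod>p\<in>L. z p ^ m p)"
abbreviation w :: "('i \<Rightarrow> nat) \<Rightarrow> 'g" where "w m \<equiv> \<nu> (mon m)"
abbreviation U :: "'a set" where "U \<equiv> val_prime G \<inter> A"
text \<open>
  The ideal generated by the monomials with exponents in \<open>E\<close>, always taken modulo the next
  smaller prime of the valuation.
\<close>

definition mono_ideal :: "('i \<Rightarrow> nat) set \<Rightarrow> 'a set" where "mono_ideal E = lspan A (mon ` E \<union> U)"
definition up_closed :: "('i \<Rightarrow> nat) set \<Rightarrow> bool" where
  "up_closed E \<longleftrightarrow> E \<subseteq> expo \<and> (\<forall>m\<in>E. \<forall>p\<in>L. m(p := Suc (m p)) \<in> E)"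

lemma subA: "is_subring A" using noeth noethD by blast

lemma U_prime: "is_prime A U" using contract_val_prime[OF subA AV isoG] .
lemma Q_prime: "is_prime A (val_prime H \<inter> A)" using contract_val_prime[OF subA AV isoH] .

lemma mon_nz: "mon m \<noteq> 0" unfolding mon_def using z0 finL by auto
lemma mon_A: "mon m \<in> A" unfolding mon_def using zA by (intro subring_prod[OF subA] subring_power[OF subA]) auto
lemma w_nonneg: "0 \<le> w m" unfolding mon_def using z0 zpos by (intro val_prod_nonneg) (auto intro!: val_power_nonneg simp: less_imp_le)
lemma mon_add: "mon (\<lambda>p. m p + n p) = mon m * mon n" unfolding mon_def by (simp add: power_add prod.distrib)
lemma w_add: "w (\<lambda>p. m p + n p) = w m + w n" using mon_add mon_nz val_mult by simp

lemma mon_Suc: "p \<in> L \<Longrightarrow> mon (m(p := Suc (m p))) = z p * mon m"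
  unfolding mon_def using finL by (simp add: prod.remove[of L p] ac_simps)

lemma mon_single: "p \<in> L \<Longrightarrow> mon ((\<lambda>_. 0)(p := 1)) = z p"
  using mon_Suc[of p "\<lambda>_. 0"] by (simp add: mon_def)

lemma w_Suc: "p \<in> L \<Longrightarrow> w m < w (m(p := Suc (m p)))"
  using mon_Suc mon_nz z0 zpos by (simp add: val_mult)

lemma w_G: "w m \<in> G"
  unfolding mon_def by (rule val_prod_mem[OF isoG finL]) (use z0 zG val_power_mem[OF isoG] in auto)

text \<open>
  Distinct monomials have values distinct even modulo \<open>H\<close>; this is what makes a term of least value
  dominate a sum.
\<close>

lemma w_inj:
  assumes "m \<in> expo" "n \<in> expo" "w m - w n \<in> H" shows "m = n"
proof
  fix p
  have "mon m / mon n = (\<Prod>p\<in>L. z p powi (int (m p) - int (n p)))"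
    unfolding mon_def prod_dividef[symmetric] by (rule prod.cong) (auto simp: power_int_diff z0)
  then have "\<nu> (\<Prod>p\<in>L. z p powi (int (m p) - int (n p))) \<in> H" 
    using val_divide[OF mon_nz mon_nz, of m n] assms(3) by simp
  from indep[OF this, of p] show "m p = n p" using assms(1,2) by (cases "p \<in> L") (auto simp: expo_def)
qed

text \<open>
  The rank one assumption makes every expansion up to a bounded value finite.
\<close>

lemma finite_w_le:
  assumes "v \<in> G" shows "finite {m \<in> expo. w m \<le> v}"
proof -
  have "\<exists>N. \<forall>p\<in>L. v < \<nu> (z p ^ N)"
  proof -
    obtain f where f: "\<And>p. p \<in> L \<Longrightarrow> v < \<nu> (z p ^ f p)" using arch[OF assms] by metis
    have "v < \<nu> (z p ^ (\<Sum>p\<in>L. f p))" if "p \<in> L" for p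
    proof -
      have "f p \<le> (\<Sum>p\<in>L. f p)" using member_le_sum[OF that, of f] finL by simp
      then have "\<nu> (z p ^ f p) \<le> \<nu> (z p ^ (\<Sum>p\<in>L. f p))" using val_power_mono z0 zpos that less_imp_le by metis
      then show ?thesis using f[OF that] by order
    qed
    then show ?thesis by blast
  qed
  then obtain N where N: "\<And>p. p \<in> L \<Longrightarrow> v < \<nu> (z p ^ N)" by blast
  have "m p \<in> {..<N}" if m: "w m \<le> v" and p: "p \<in> L" for m p
  proof (rule ccontr)
    assume "m p \<notin> {..<N}"
    then have "\<nu> (z p ^ N) \<le> \<nu> (z p ^ m p)" using val_power_mono z0 zpos p by (simp add: less_imp_le)
    moreover have "w m = \<nu> (z p ^ m p) + \<nu> (\<Prod>q\<in>L - {p}. z q ^ m q)"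
      unfolding mon_def using p finL z0 by (simp add: prod.remove[of L p] val_mult)
    moreover have "0 \<le> \<nu> (\<Prod>q\<in>L - {p}. z q ^ m q)"
      using z0 zpos by (intro val_prod_nonneg) (auto intro!: val_power_nonneg simp: less_imp_le)
    ultimately have "\<nu> (z p ^ N) \<le> w m" by (simp add: add_increasing2)
    then show False using N[OF p] m by order
  qed
  then have "{m \<in> expo. w m \<le> v} \<subseteq> {m. \<forall>p. (p \<in> L \<longrightarrow> m p \<in> {..<N}) \<and> (p \<notin> L \<longrightarrow> m p = 0)}"
    unfolding expo_def by blast
  moreover have "finite {m. \<forall>p. (p \<in> L \<longrightarrow> m p \<in> {..<N}) \<and> (p \<notin> L \<longrightarrow> m p = 0)}"
    by (rule finite_set_of_finite_funs) (use finL in auto)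
  ultimately show ?thesis by (rule finite_subset)
qed

lemma mono_ideal_ideal: "is_ideal A (mono_ideal E)"
  unfolding mono_ideal_def using mon_A by (intro lspan_ideal[OF subA]) auto

lemma mono_ideal_mono: "E \<subseteq> F \<Longrightarrow> mono_ideal E \<subseteq> mono_ideal F"
  unfolding mono_ideal_def by (intro lspan_mono[OF subA]) auto

lemma U_mono_ideal: "U \<subseteq> mono_ideal E" 
  unfolding mono_ideal_def by (rule subsetI, rule lspan_superset[OF subA]) simp

lemma mon_mono_ideal: "m \<in> E \<Longrightarrow> mon m \<in> mono_ideal E"
  unfolding mono_ideal_def by (rule lspan_superset[OF subA]) simp

lemma up_closed_Un: "up_closed E \<Longrightarrow> up_closed F \<Longrightarrow> up_closed (E \<union> F)"
  unfolding up_closed_def by blast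

lemma up_closed_gt: "up_closed E \<Longrightarrow> up_closed {m \<in> E. v < w m}"
  unfolding up_closed_def using w_Suc by (auto intro: less_trans)

text \<open>
  Take the exponent \<open>m\<close> of least value in \<open>E - F\<close>: either its coefficient is outside
  the prime of \<open>H\<close>, or the coefficient is a combination of the \<open>z p\<close>, so that the term may be distributed
  over exponents of larger value and \<open>m\<close> disappears from the finite set of exponents still to be treated.
  The set \<open>F\<close> stands for monomials that are considered to be zero.
\<close>

lemma initial_form:
  assumes "up_closed E" "up_closed F" "h \<in> mono_ideal (E \<union> F)" "v \<in> G"
  shows "(\<exists>m\<in>E - F. \<exists>u\<in>A - val_prime H. h - u * mon m \<in> mono_ideal ({m' \<in> E. w m < w m'} \<union> F)) \<or> 
         h \<in> mono_ideal ({m' \<in> E. v < w m'} \<union> F)"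
  using assms(1,3)
proof (induction "card {m \<in> E - F. w m \<le> v}" arbitrary: E rule: less_induct)
  case (less E)
  let ?S = "{m \<in> E - F. w m \<le> v}"
  have Ex: "E \<subseteq> expo" using less.prems(1) by (simp add: up_closed_def)
  have fin: "finite ?S" by (rule finite_subset[OF _ finite_w_le[OF assms(4)]]) (use Ex in blast)
  show ?case
  proof (cases "?S = {}")
    case True
    then have "E \<union> F \<subseteq> {m' \<in> E. v < w m'} \<union> F" by (auto simp: not_le)
    then show ?thesis using less.prems(2) mono_ideal_mono by blast
  next
    case False
    have "\<exists>m. is_arg_min w (\<lambda>m. m \<in> ?S) m" by (rule ex_is_arg_min_if_finite[OF fin False])
    then obtain m where m: "m \<in> ?S" "\<And>m'. m' \<in> ?S \<Longrightarrow> w m \<le> w m'"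
      unfolding is_arg_min_linorder by blast
    \<comment> \<open>All exponents of \<open>E\<close> other than \<open>m\<close> are in \<open>E1\<close> or in \<open>F\<close>, by minimality of \<open>m\<close>.\<close>
    define E1 where "E1 = {m' \<in> E. w m < w m'}"
    have up1: "up_closed E1" unfolding E1_def using up_closed_gt[OF less.prems(1)] .
    have sub: "E \<union> F \<subseteq> insert m (E1 \<union> F)"
    proof
      fix n assume n: "n \<in> E \<union> F"
      show "n \<in> insert m (E1 \<union> F)"
      proof (cases "n \<in> F \<or> w m < w n")
        case True then show ?thesis using n by (auto simp: E1_def)
      next
        case False
        then have "n \<in> ?S" using n m(1) by auto
        then have "w n = w m" using m(2)[of n] False by auto
        then have "n = m" using w_inj[of n m] Ex \<open>n \<in> ?S\<close> m(1) iso_zero[OF isoH] by auto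
        then show ?thesis by simp
      qed
    qed
    have "h \<in> mono_ideal (insert m (E1 \<union> F))" using less.prems(2) mono_ideal_mono[OF sub] by blast
    then have "h \<in> lspan A (insert (mon m) (mon ` (E1 \<union> F) \<union> U))" unfolding mono_ideal_def by simp
    then obtain a x where ax: "h = a * mon m + x" "a \<in> A" "x \<in> mono_ideal (E1 \<union> F)" 
      unfolding lspan_insert[OF subA] mono_ideal_def by blast
    show ?thesis
    proof (cases "a \<in> val_prime H")
      case False
      then have "h - a * mon m \<in> mono_ideal ({m' \<in> E. w m < w m'} \<union> F)" using ax by (simp add: E1_def)
      then show ?thesis using m(1) False ax(2) by blast
    next
      case True
      note I1 = mono_ideal_ideal[of "E1 \<union> F"]
      have "a * mon m \<in> mono_ideal (E1 \<union> F)"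
      proof (rule lspan_times[OF ideal_submodule[OF I1]])
        show "a \<in> lspan A (z ` L \<union> U)" using True ax(2) gens by blast
        show "mon m \<in> lspan A {mon m}" using lspan_superset[OF subA] by blast
        fix b c assume bc: "b \<in> z ` L \<union> U" "c \<in> {mon m}"
        show "b * c \<in> mono_ideal (E1 \<union> F)"
        proof (cases "b \<in> U")
          case True
          then have "b * c \<in> U" using bc mon_A ideal_mult2[OF prime_ideal[OF U_prime]] by blast
          then show ?thesis using U_mono_ideal by blast
        next
          case False
          then obtain p where p: "p \<in> L" "b = z p" using bc by blast
          have "m(p := Suc (m p)) \<in> E1" unfolding E1_def using less.prems(1) m(1) p w_Suc by (auto simp: up_closed_def)
          then have "mon (m(p := Suc (m p))) \<in> mono_ideal (E1 \<union> F)" using mon_mono_ideal by blast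
          then show ?thesis using mon_Suc[OF p(1)] p bc by simp
        qed
      qed
      then have h1: "h \<in> mono_ideal (E1 \<union> F)" using ax ideal_add[OF I1] by simp
      have "{m \<in> E1 - F. w m \<le> v} \<subset> ?S" using m(1) by (auto simp: E1_def)
      then have "card {m \<in> E1 - F. w m \<le> v} < card ?S" using fin by (rule psubset_card_mono[rotated])
      from less.hyps[OF this up1 h1] show ?thesis
      proof (elim disjE)
        assume "\<exists>n\<in>E1 - F. \<exists>u\<in>A - val_prime H. h - u * mon n \<in> mono_ideal ({m' \<in> E1. w n < w m'} \<union> F)"
        then obtain n u where n: "n \<in> E1 - F" "u \<in> A - val_prime H" 
          "h - u * mon n \<in> mono_ideal ({m' \<in> E1. w n < w m'} \<union> F)" by blast
        have "{m' \<in> E1. w n < w m'} \<union> F \<subseteq> {m' \<in> E. w n < w m'} \<union> F" by (auto simp: E1_def)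
        then have "h - u * mon n \<in> mono_ideal ({m' \<in> E. w n < w m'} \<union> F)" using n(3) mono_ideal_mono by blast
        moreover have "n \<in> E - F" using n(1) by (auto simp: E1_def)
        ultimately show ?thesis using n(2) by blast
      next
        assume "h \<in> mono_ideal ({m' \<in> E1. v < w m'} \<union> F)"
        moreover have "{m' \<in> E1. v < w m'} \<union> F \<subseteq> {m' \<in> E. v < w m'} \<union> F" by (auto simp: E1_def)
        ultimately show ?thesis using mono_ideal_mono by blast
      qed
    qed
  qed
qed

text \<open>
  All terms besides the initial one have value larger by an amount outside \<open>H\<close>, while the
  coefficient of the initial term has its value in \<open>H\<close>.
\<close>

lemma initial_form_value:
  assumes "m \<in> expo" "u \<in> A - val_prime H" "\<And>m'. m' \<in> E \<Longrightarrow> m' \<in> expo \<and> w m < w m'"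
    and "h - u * mon m \<in> mono_ideal E"
  shows "h \<noteq> 0" "\<nu> h = \<nu> u + w m" "\<nu> u \<in> H"
proof -
  note u = not_val_prime[OF isoH, of u]
  have u': "u \<noteq> 0" "\<nu> u \<in> H" "0 \<le> \<nu> u" using u assms(2) AV by auto
  have wv: "w m \<in> value_group \<nu>" using value_groupI mon_nz by blast
  have "mono_ideal E \<subseteq> above (w m) H" unfolding mono_ideal_def
  proof (rule lspan_least)
    show "submodule_of A (above (w m) H)" 
      using above_submodule[OF isoH wv] AV unfolding submodule_of_def by blast
    have "mon m' \<in> above (w m) H" if "m' \<in> E" for m'
      unfolding above_def using assms(3)[OF that] w_inj[of m' m] assms(1) by force
    moreover have "x \<in> above (w m) H" if "x \<in> U" for x
    proof (cases "x = 0")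
      case False
      then have x: "0 < \<nu> x" "\<nu> x \<notin> G" using that by (auto simp: above_def)
      then have "w m < \<nu> x" using iso_convex[OF isoG w_G[of m] value_groupI[OF False]] by force
      moreover have "\<nu> x - w m \<notin> H" using iso_add[OF isoG _ w_G, of "\<nu> x - w m" m] x(2) HG by auto
      ultimately show ?thesis by (simp add: above_def)
    qed (simp add: above_def)
    ultimately show "mon ` E \<union> U \<subseteq> above (w m) H" by blast
  qed
  then have x: "h - u * mon m \<in> above (w m) H" using assms(4) by blast
  have v: "\<nu> (u * mon m) = \<nu> u + w m" using u'(1) mon_nz val_mult by blast
  have "h - u * mon m = 0 \<or> \<nu> (u * mon m) < \<nu> (h - u * mon m)"
  proof (cases "h - u * mon m = 0")
    case False
    then have "0 \<le> \<nu> (h - u * mon m) - w m" "\<nu> (h - u * mon m) - w m \<notin> H" using x by (auto simp: above_def)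
    then have "\<not> \<nu> (h - u * mon m) - w m \<le> \<nu> u" 
      using iso_convex[OF isoH u'(2) value_group_diff[OF value_groupI[OF False] wv]] by blast
    then show ?thesis using v by (simp add: not_le less_diff_eq)
  qed simp
  from val_add_eq[OF _ this] show "h \<noteq> 0" "\<nu> h = \<nu> u + w m" "\<nu> u \<in> H" using v u' mon_nz by auto
qed

lemma value_of_mono_ideal:
  assumes "up_closed E" "h \<in> mono_ideal E" "h \<notin> val_prime G"
  shows "\<exists>m\<in>E. \<nu> h - w m \<in> H"
proof -
  have hA: "h \<in> A" using ideal_sub[OF mono_ideal_ideal assms(2)] .
  then have h: "h \<noteq> 0" "\<nu> h \<in> G" "0 \<le> \<nu> h" using not_val_prime[OF isoG, of h] assms(3) AV by auto
  have up0: "up_closed {}" by (simp add: up_closed_def)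
  have "h \<notin> mono_ideal {m' \<in> E. \<nu> h < w m'}"
  proof
    assume *: "h \<in> mono_ideal {m' \<in> E. \<nu> h < w m'}"
    have "mono_ideal {m' \<in> E. \<nu> h < w m'} \<subseteq> above (\<nu> h) {0}" unfolding mono_ideal_def
    proof (rule lspan_least)
      show "submodule_of A (above (\<nu> h) {0})" 
        using above_submodule[OF iso_triv value_groupI[OF h(1)]] AV unfolding submodule_of_def by blast
      have "x \<in> above (\<nu> h) {0}" if "x \<in> U" for x
      proof (cases "x = 0")
        case False
        then have x: "0 < \<nu> x" "\<nu> x \<notin> G" using that by (auto simp: above_def)
        then have "\<nu> h < \<nu> x" using iso_convex[OF isoG h(2) value_groupI[OF False]] by force
        then show ?thesis by (auto simp: above_def)
      qed (simp add: above_def)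
      then show "mon ` {m' \<in> E. \<nu> h < w m'} \<union> U \<subseteq> above (\<nu> h) {0}" by (auto simp: above_def)
    qed
    then show False using * h(1) by (auto simp: above_def)
  qed
  then obtain m u where m: "m \<in> E" "u \<in> A - val_prime H" "h - u * mon m \<in> mono_ideal {m' \<in> E. w m < w m'}"
    using initial_form[OF assms(1) up0 _ h(2), of h, unfolded Un_empty_right Diff_empty, OF assms(2)] by blast
  have Ex: "E \<subseteq> expo" using assms(1) by (simp add: up_closed_def)
  have "\<nu> h = \<nu> u + w m \<and> \<nu> u \<in> H"
    by (intro conjI; rule initial_form_value[OF _ m(2) _ m(3)]) (use m(1) Ex in blast)+
  then show ?thesis using m(1) by (intro bexI[of _ m]) (simp_all add: algebra_simps)
qed

section \<open>The primes between consecutive levels\<close>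

definition involving :: "'i set \<Rightarrow> ('i \<Rightarrow> nat) set" where
  "involving S = {m \<in> expo. \<exists>p\<in>S. m p \<noteq> 0}"

text \<open>
  The ideal generated by \<open>z ` S\<close> and the next smaller prime, closed in the topology given by the
  values.  Primality is
  shown for the closure, and only afterwards that taking the closure adds nothing.
\<close>

definition closure_ideal :: "'i set \<Rightarrow> 'a set" where
  "closure_ideal S = {f \<in> A. \<forall>v\<in>G. f \<in> mono_ideal ({m \<in> expo. v < w m} \<union> involving S)}"

definition has_initial :: "'i set \<Rightarrow> 'a \<Rightarrow> bool" where
  "has_initial S f \<longleftrightarrow> (\<exists>m\<in>expo - involving S. \<exists>u\<in>A - val_prime H. 
     f - u * mon m \<in> mono_ideal ({m' \<in> expo. w m < w m'} \<union> involving S))"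

lemma up_expo: "up_closed expo" unfolding up_closed_def expo_def by auto
lemma up_involving: "up_closed (involving S)" unfolding up_closed_def involving_def expo_def by auto

lemma expo_add: "m \<in> expo \<Longrightarrow> n \<in> expo \<Longrightarrow> (\<lambda>p. m p + n p) \<in> expo" unfolding expo_def by auto

lemma mem_mono_ideal_expo: assumes "f \<in> A" shows "f \<in> mono_ideal expo"
proof -
  have "(\<lambda>_. 0) \<in> expo" "mon (\<lambda>_. 0) = 1" by (auto simp: expo_def mon_def)
  then have "1 \<in> mono_ideal expo" using mon_mono_ideal by metis
  then show ?thesis using ideal_mult[OF mono_ideal_ideal assms] by fastforce
qed

lemma closure_or_initial: 
  assumes "f \<in> A" "f \<notin> closure_ideal S" shows "has_initial S f"
proof -
  obtain v where v: "v \<in> G" "f \<notin> mono_ideal ({m \<in> expo. v < w m} \<union> involving S)"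
    using assms unfolding closure_ideal_def by blast
  have "f \<in> mono_ideal (expo \<union> involving S)" 
    using mem_mono_ideal_expo[OF assms(1)] mono_ideal_mono[of expo "expo \<union> involving S"] by blast
  from initial_form[OF up_expo up_involving this v(1)] v(2) show ?thesis unfolding has_initial_def by blast
qed

text \<open>
  If \<open>f\<close> had an initial term \<open>u m\<close> without \<open>S\<close> and also lay in the closure, then \<open>u m\<close> would be a
  combination of monomials that involve \<open>S\<close> or have larger value, and its value would be congruent to
  the value of one of these, against the independence of the values.
\<close>

lemma initial_not_closure:
  assumes "has_initial S f" shows "f \<notin> closure_ideal S"
proof
  assume f: "f \<in> closure_ideal S"
  obtain m u where m: "m \<in> expo - involving S" "u \<in> A - val_prime H"
    "f - u * mon m \<in> mono_ideal ({m' \<in> expo. w m < w m'} \<union> involving S)" (is "_ \<in> mono_ideal ?E")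
    using assms unfolding has_initial_def by blast
  have "f \<in> mono_ideal ?E" using f w_G unfolding closure_ideal_def by blast
  then have "f - (f - u * mon m) \<in> mono_ideal ?E" using m(3) ideal_diff[OF subA mono_ideal_ideal] by blast
  then have um: "u * mon m \<in> mono_ideal ?E" by simp
  have u: "u \<noteq> 0" "\<nu> u \<in> H" using not_val_prime[OF isoH, of u] m(2) AV by auto
  then have v: "\<nu> (u * mon m) = \<nu> u + w m" using mon_nz val_mult by blast
  then have "\<nu> (u * mon m) \<in> G" using u HG w_G iso_add[OF isoG] by auto
  then have "u * mon m \<notin> val_prime G" using u mon_nz by (auto simp: above_def)
  moreover have "up_closed ?E" using up_closed_Un[OF up_closed_gt[OF up_expo] up_involving] .
  ultimately obtain m' where m': "m' \<in> ?E" "\<nu> (u * mon m) - w m' \<in> H" using value_of_mono_ideal um by blast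
  have "w m - w m' \<in> H" using iso_diff[OF isoH m'(2) u(2)] v by (simp add: algebra_simps)
  then have "m = m'" using w_inj[of m m'] m(1) m'(1) by (auto simp: involving_def)
  then show False using m(1) m'(1) by auto
qed

lemma mono_ideal_times:
  assumes "x \<in> mono_ideal ({m \<in> expo. a < w m} \<union> involving S)" 
    and "y \<in> mono_ideal ({m \<in> expo. b \<le> w m} \<union> involving S)"
  shows "x * y \<in> mono_ideal ({m \<in> expo. a + b < w m} \<union> involving S)" (is "_ \<in> mono_ideal ?E")
proof (rule lspan_times[OF ideal_submodule[OF mono_ideal_ideal] assms[unfolded mono_ideal_def]])
  fix c d assume c: "c \<in> mon ` ({m \<in> expo. a < w m} \<union> involving S) \<union> U"
    and d: "d \<in> mon ` ({m \<in> expo. b \<le> w m} \<union> involving S) \<union> U"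
  show "c * d \<in> mono_ideal ?E"
  proof (cases "c \<in> U \<or> d \<in> U")
    case True
    have "c \<in> A" "d \<in> A" using c d mon_A by auto
    then have "c * d \<in> U" using True ideal_mult[OF prime_ideal[OF U_prime]] ideal_mult2[OF prime_ideal[OF U_prime]] by blast
    then show ?thesis using U_mono_ideal by blast
  next
    case False
    then obtain m n where mn: "c = mon m" "d = mon n" "m \<in> {m \<in> expo. a < w m} \<union> involving S"
      "n \<in> {m \<in> expo. b \<le> w m} \<union> involving S" using c d by blast
    have "(\<lambda>p. m p + n p) \<in> ?E" 
      using mn(3,4) expo_add[of m n] w_add[of m n] by (auto simp: involving_def add_less_le_mono)
    from mon_mono_ideal[OF this] show ?thesis using mon_add mn by simp
  qed
qed

text \<open>
  The initial terms multiply, as values of monomials add and monomials without \<open>S\<close> are closed under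
  products.
\<close>

lemma initial_mult:
  assumes "has_initial S f" "has_initial S g" shows "has_initial S (f * g)"
proof -
  obtain m u where m: "m \<in> expo - involving S" "u \<in> A - val_prime H"
    "f - u * mon m \<in> mono_ideal ({m' \<in> expo. w m < w m'} \<union> involving S)" 
    using assms(1) unfolding has_initial_def by blast
  obtain n t where n: "n \<in> expo - involving S" "t \<in> A - val_prime H"
    "g - t * mon n \<in> mono_ideal ({m' \<in> expo. w n < w m'} \<union> involving S)" 
    using assms(2) unfolding has_initial_def by blast
  have tn: "t * mon n \<in> mono_ideal ({m' \<in> expo. w n \<le> w m'} \<union> involving S)"
    by (rule ideal_mult[OF mono_ideal_ideal _ mon_mono_ideal]) (use n(1,2) in auto)
  have um: "u * mon m \<in> mono_ideal ({m' \<in> expo. w m \<le> w m'} \<union> involving S)"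
    by (rule ideal_mult[OF mono_ideal_ideal _ mon_mono_ideal]) (use m(1,2) in auto)
  have "mono_ideal ({m' \<in> expo. w n < w m'} \<union> involving S) \<subseteq> mono_ideal ({m' \<in> expo. w n \<le> w m'} \<union> involving S)"
    by (intro mono_ideal_mono) auto
  then have "(g - t * mon n) + t * mon n \<in> mono_ideal ({m' \<in> expo. w n \<le> w m'} \<union> involving S)"
    using n(3) tn ideal_add[OF mono_ideal_ideal] by blast
  then have g: "g \<in> mono_ideal ({m' \<in> expo. w n \<le> w m'} \<union> involving S)" by simp
  have 1: "(f - u * mon m) * g \<in> mono_ideal ({m' \<in> expo. w m + w n < w m'} \<union> involving S)"
    by (rule mono_ideal_times[OF m(3) g])
  have 2: "(g - t * mon n) * (u * mon m) \<in> mono_ideal ({m' \<in> expo. w n + w m < w m'} \<union> involving S)"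
    by (rule mono_ideal_times[OF n(3) um])
  let ?k = "\<lambda>p. m p + n p"
  have "(f - u * mon m) * g + (g - t * mon n) * (u * mon m) \<in> mono_ideal ({m' \<in> expo. w ?k < w m'} \<union> involving S)"
    unfolding w_add by (rule ideal_add[OF mono_ideal_ideal 1]) (use 2 in \<open>simp add: add.commute\<close>)
  then have "f * g - (u * t) * mon ?k \<in> mono_ideal ({m' \<in> expo. w ?k < w m'} \<union> involving S)"
    by (simp add: mon_add algebra_simps)
  moreover have "?k \<in> expo - involving S" using m(1) n(1) expo_add by (auto simp: involving_def)
  moreover have "u * t \<in> A - val_prime H" 
    using m(2) n(2) subring_mult[OF subA] prime_mult[OF Q_prime, of u t] by blast
  ultimately show ?thesis unfolding has_initial_def by blast
qed

lemma closure_ideal_ideal: "is_ideal A (closure_ideal S)"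
  unfolding is_ideal_def submodule_of_def closure_ideal_def
  using subringD[OF subA] idealD[OF mono_ideal_ideal] by auto

lemma closure_ideal_prime: "is_prime A (closure_ideal S)"
  unfolding is_prime_def
proof (intro conjI ballI impI)
  show "is_ideal A (closure_ideal S)" by (rule closure_ideal_ideal)
  have "(\<lambda>_. 0) \<in> expo - involving S" "mon (\<lambda>_. 0) = 1" by (auto simp: expo_def mon_def involving_def)
  moreover have "1 \<in> A - val_prime H" using subring_one[OF subA] prime_one[OF Q_prime] by blast
  ultimately have "has_initial S 1" unfolding has_initial_def 
    by (intro bexI[of _ "\<lambda>_. 0"] bexI[of _ 1]) (auto simp: ideal_zero[OF mono_ideal_ideal])
  then show "1 \<notin> closure_ideal S" by (rule initial_not_closure)
  fix a b assume "a \<in> A" "b \<in> A" "a * b \<in> closure_ideal S"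
  then show "a \<in> closure_ideal S \<or> b \<in> closure_ideal S"
    using closure_or_initial initial_mult initial_not_closure by blast
qed

lemma single_expo: "p \<in> L \<Longrightarrow> (\<lambda>_. 0)(p := 1) \<in> expo"
  by (auto simp: expo_def)

lemma param_notin_closure: 
  assumes "p \<in> L" "p \<notin> S" shows "z p \<notin> closure_ideal S"
proof (rule initial_not_closure)
  let ?e = "(\<lambda>_. 0)(p := 1)"
  have "?e \<in> expo - involving S" using single_expo assms by (auto simp: involving_def)
  moreover have "1 \<in> A - val_prime H" using subring_one[OF subA] prime_one[OF Q_prime] by blast
  moreover have "z p - 1 * mon ?e \<in> mono_ideal E" for E 
    using mon_single[OF assms(1)] ideal_zero[OF mono_ideal_ideal] by simp
  ultimately show "has_initial S (z p)" unfolding has_initial_def by blast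
qed

lemma gens_closure: 
  assumes "S \<subseteq> L" shows "lspan A (z ` S \<union> U) \<subseteq> closure_ideal S"
proof (rule lspan_least[OF ideal_submodule[OF closure_ideal_ideal]])
  have "U \<subseteq> closure_ideal S" unfolding closure_ideal_def using subsetD[OF U_mono_ideal] by auto
  moreover have "z p \<in> closure_ideal S" if p: "p \<in> S" for p
  proof -
    have "(\<lambda>_. 0)(p := 1) \<in> involving S" using single_expo[of p] p assms by (auto simp: involving_def)
    then have "mon ((\<lambda>_. 0)(p := 1)) \<in> mono_ideal ({m \<in> expo. v < w m} \<union> involving S)" for v
      using mon_mono_ideal by blast
    then show ?thesis using mon_single[of p] p assms zA unfolding closure_ideal_def by auto
  qed
  ultimately show "z ` S \<union> U \<subseteq> closure_ideal S" by blast
qed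

lemma closure_ideal_mono: "S \<subseteq> T \<Longrightarrow> closure_ideal S \<subseteq> closure_ideal T"
proof
  fix f assume S: "S \<subseteq> T" and f: "f \<in> closure_ideal S"
  have "f \<in> mono_ideal ({m \<in> expo. v < w m} \<union> involving T)" if "v \<in> G" for v
  proof (rule subsetD[OF mono_ideal_mono])
    show "f \<in> mono_ideal ({m \<in> expo. v < w m} \<union> involving S)" using f that by (simp add: closure_ideal_def)
    show "{m \<in> expo. v < w m} \<union> involving S \<subseteq> {m \<in> expo. v < w m} \<union> involving T" 
      using S by (auto simp: involving_def)
  qed
  then show "f \<in> closure_ideal T" using f by (simp add: closure_ideal_def)
qed

text \<open>
  Downward induction on \<open>S\<close>, starting from all parameters of the level, where both sides are the prime
  of \<open>H\<close>.  If \<open>p\<close> is removed, an element of the smaller prime has the form \<open>a z\<^sub>p + x\<close> with \<open>x\<close> generated by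
  the remaining parameters; as \<open>z\<^sub>p\<close> is outside the smaller prime, \<open>a\<close> lies in it, and Nakayama's lemma
  applies.  This avoids any appeal to completeness or to the intersection of the powers of an ideal.
\<close>

lemma closure_eq_gens: 
  assumes "S \<subseteq> L" shows "closure_ideal S = lspan A (z ` S \<union> U)"
  using assms
proof (induction "card (L - S)" arbitrary: S)
  case 0
  then have S: "S = L" using finL by auto
  have "closure_ideal L \<subseteq> val_prime H \<inter> A"
  proof
    fix f assume f: "f \<in> closure_ideal L"
    let ?E = "{m \<in> expo. 0 < w m} \<union> involving L"
    have "f \<in> mono_ideal ?E" using f iso_zero[OF isoG] unfolding closure_ideal_def by blast
    moreover have "mono_ideal ?E \<subseteq> val_prime H \<inter> A"
    proof -
      have pos: "0 < w m \<and> w m \<notin> H" if m: "m \<in> ?E" for m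
      proof -
        have "m \<noteq> (\<lambda>_. 0)" using m by (auto simp: involving_def mon_def)
        moreover have "m \<in> expo" "(\<lambda>_. 0) \<in> expo" using m by (auto simp: involving_def expo_def)
        ultimately have "w m \<notin> H" using w_inj[of m "\<lambda>_. 0"] by (auto simp: mon_def)
        then have "w m \<noteq> 0" using iso_zero[OF isoH] by auto
        then show ?thesis using \<open>w m \<notin> H\<close> w_nonneg[of m] by simp
      qed
      show ?thesis unfolding mono_ideal_def
      proof (rule lspan_least[OF ideal_submodule[OF prime_ideal[OF Q_prime]]])
        have "mon m \<in> val_prime H" if "m \<in> ?E" for m using pos[OF that] by (simp add: above_def)
        then show "mon ` ?E \<union> U \<subseteq> val_prime H \<inter> A" using val_prime_antimono[OF HG] mon_A by blast
      qed
    qed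
    ultimately show "f \<in> val_prime H \<inter> A" by blast
  qed
  then show ?case using gens gens_closure[of L] S by blast
next
  case (Suc n)
  then have "L - S \<noteq> {}" by force
  then obtain p where p: "p \<in> L" "p \<notin> S" by blast
  have "insert p (L - insert p S) = L - S" using p by blast
  moreover have "card (insert p (L - insert p S)) = Suc (card (L - insert p S))"
    by (rule card_insert_disjoint) (use finL in auto)
  ultimately have "n = card (L - insert p S)" using Suc(2) by simp
  then have IH: "closure_ideal (insert p S) = lspan A (z ` insert p S \<union> U)" 
    by (rule Suc(1)) (use Suc(3) p in simp)
  have N: "is_ideal A (lspan A (z ` S \<union> U))" using zA Suc(3) by (intro lspan_ideal[OF subA]) auto
  have "closure_ideal S \<subseteq> lspan A (z ` S \<union> U)"
  proof (rule nakayama[OF loc noeth _ N closure_ideal_ideal])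
    show "z p \<in> val_prime {0} \<inter> A" using zpos[OF p(1)] zA[OF p(1)] by (auto simp: above_def)
    fix g assume g: "g \<in> closure_ideal S"
    then have "g \<in> lspan A (insert (z p) (z ` S \<union> U))" using closure_ideal_mono[of S "insert p S"] IH by auto
    then obtain a x where ax: "g = a * z p + x" "a \<in> A" "x \<in> lspan A (z ` S \<union> U)" unfolding lspan_insert[OF subA] by blast
    have "g - x \<in> closure_ideal S" using g ax(3) gens_closure[OF Suc(3)] ideal_diff[OF subA closure_ideal_ideal] by blast
    then have "a * z p \<in> closure_ideal S" using ax(1) by simp
    then have "a \<in> closure_ideal S" 
      using prime_mult[OF closure_ideal_prime ax(2) zA[OF p(1)]] param_notin_closure[OF p] by blast
    moreover have "g - z p * a \<in> lspan A (z ` S \<union> U)" using ax by (simp add: mult.commute)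
    ultimately show "\<exists>y\<in>closure_ideal S. g - z p * y \<in> lspan A (z ` S \<union> U)" by blast
  qed
  then show ?case using gens_closure[OF Suc(3)] by blast
qed

theorem level_prime_seq:
  assumes "distinct ps" "S \<inter> set ps = {}" "S \<union> set ps \<subseteq> L"
  shows "prime_seq A (lspan A (z ` S \<union> U)) (map z ps)"
  using assms
proof (induction ps arbitrary: S)
  case Nil then show ?case using closure_eq_gens[of S] closure_ideal_prime[of S] by simp
next
  case (Cons p ps)
  have "lspan A (insert (z p) (lspan A (z ` S \<union> U))) = lspan A (z ` insert p S \<union> U)"
    using lspan_lspan_union[OF subA, of "{z p}" "z ` S \<union> U"] by simp
  moreover have "prime_seq A (lspan A (z ` insert p S \<union> U)) (map z ps)"
    using Cons by (intro Cons.IH) auto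
  moreover have "is_prime A (lspan A (z ` S \<union> U))" "z p \<notin> lspan A (z ` S \<union> U)"
    using closure_eq_gens[of S] closure_ideal_prime[of S] param_notin_closure[of p S] Cons.prems by auto
  ultimately show ?case using Cons.prems zA by auto
qed

lemma initial_form_of_element:
  assumes "f \<in> A" "f \<notin> val_prime G"
  obtains m u where "m \<in> expo" "u \<in> A - val_prime H" "f - u * mon m \<in> mono_ideal {m' \<in> expo. w m < w m'}"
proof -
  have up0: "up_closed {}" by (simp add: up_closed_def)
  have "\<nu> f \<in> G" using not_val_prime[OF isoG _ assms(2)] assms(1) AV by blast
  have "f \<notin> closure_ideal {}"
    using closure_eq_gens[of "{}"] assms lspan_ideal_eq[OF subA prime_ideal[OF U_prime]] by auto
  from closure_or_initial[OF assms(1) this] show ?thesis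
    using that unfolding has_initial_def by (auto simp: involving_def)
qed

end

section \<open>Framed rings\<close>

text \<open>
  A valuation of finite rank \<open>t\<close> with its chain of isolated subgroups; \<open>r\<close> gives the number of
  parameters of each level.
\<close>

locale valuation_chain = valued_field \<nu> for \<nu> :: "'a::field \<Rightarrow> 'g::linordered_ab_group_add" +
  fixes t :: nat and \<Gamma> :: "nat \<Rightarrow> 'g set" and r :: "nat \<Rightarrow> nat"
  assumes chain_zero: "\<Gamma> 0 = {0}" and chain_top: "\<Gamma> t = value_group \<nu>" and chain_strict: "i < t \<Longrightarrow> \<Gamma> i \<subset> \<Gamma> (Suc i)"
    and chain_all: "{H. isolated H} = \<Gamma> ` {0..t}"
begin

abbreviation J :: "(nat \<times> nat) set" where "J \<equiv> param_index t r"
text \<open>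
  The prime \<open>P\<^sub>j\<close> of the valuation ring.
\<close>

abbreviation PP :: "nat \<Rightarrow> 'a set" where "PP j \<equiv> val_prime (\<Gamma> (j - 1))"

definition level_mon :: "(nat \<times> nat \<Rightarrow> 'a) \<Rightarrow> nat \<Rightarrow> (nat \<Rightarrow> int) \<Rightarrow> 'a" where
  "level_mon z j c = (\<Prod>l\<in>{1..r j}. z (j, l) powi c l)"

text \<open>
  The basis condition on values, expressed through Laurent monomials in the field instead of
  integer combinations in the quotient group.
\<close>

definition bases :: "(nat \<times> nat \<Rightarrow> 'a) \<Rightarrow> bool" where
  "bases z \<longleftrightarrow> (\<forall>j\<in>{1..t}. (\<forall>l\<in>{1..r j}. z (j, l) \<noteq> 0 \<and> \<nu> (z (j, l)) \<in> \<Gamma> j) \<and>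
     (\<forall>c. \<nu> (level_mon z j c) \<in> \<Gamma> (j - 1) \<longrightarrow> (\<forall>l\<in>{1..r j}. c l = 0)) \<and>
     (\<forall>g\<in>\<Gamma> j. \<exists>c. g - \<nu> (level_mon z j c) \<in> \<Gamma> (j - 1)))"

text \<open>
  The invariant carried through all primitive transforms.  The index \<open>j = t + 1\<close>, where the condition
  is trivial, is included so that inductions over the levels need no separate start.
\<close>

definition framed :: "'a set \<Rightarrow> (nat \<times> nat \<Rightarrow> 'a) \<Rightarrow> bool" where
  "framed A z \<longleftrightarrow> noeth A \<and> A \<subseteq> val_ring \<nu> \<and> (\<forall>x\<in>A. x \<noteq> 0 \<longrightarrow> \<nu> x = 0 \<longrightarrow> inverse x \<in> A) \<and> bases z \<and>
     (\<forall>j\<in>{1..Suc t}. PP j \<inter> A = lspan A (z ` {p \<in> J. j \<le> fst p}))"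

lemma finite_J: "finite J" by (simp add: param_index_def)

lemma chain_iso: "i \<le> t \<Longrightarrow> isolated (\<Gamma> i)" using chain_all by force

lemma chain_mono: "i \<le> j \<Longrightarrow> j \<le> t \<Longrightarrow> \<Gamma> i \<subseteq> \<Gamma> j"
proof (induction j)
  case (Suc j) then show ?case using chain_strict[of j] by (cases "i = Suc j") auto
qed simp

lemma J_cases: "p \<in> J \<Longrightarrow> \<exists>j l. p = (j, l) \<and> j \<in> {1..t} \<and> l \<in> {1..r j}"
  by (auto simp: param_index_def)

lemma val_ideal_eq: "val_ideal \<nu> = val_prime {0}"
  unfolding val_ideal_def above_def by auto

lemma PP_one: "PP 1 = val_ideal \<nu>" using val_ideal_eq chain_zero by simp

lemma PP_top: "PP (Suc t) = {0}" unfolding above_def using chain_top value_groupI by auto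

lemma PP_prime: "j \<in> {1..Suc t} \<Longrightarrow> is_prime (val_ring \<nu>) (PP j)"
  using val_prime_is_prime chain_iso[of "j - 1"] by auto

lemma PP_antimono: "i \<le> j \<Longrightarrow> 1 \<le> i \<Longrightarrow> j \<le> Suc t \<Longrightarrow> PP j \<subseteq> PP i"
  by (intro val_prime_antimono chain_mono) auto

lemma framedD:
  assumes "framed A z"
  shows framed_noeth: "noeth A" and framed_V: "A \<subseteq> val_ring \<nu>" and framed_bases: "bases z" 
    and framed_inverse: "x \<in> A \<Longrightarrow> x \<noteq> 0 \<Longrightarrow> \<nu> x = 0 \<Longrightarrow> inverse x \<in> A"
    and framed_gens: "j \<in> {1..Suc t} \<Longrightarrow> PP j \<inter> A = lspan A (z ` {p \<in> J. j \<le> fst p})"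
    and framed_subring: "is_subring A"
  using assms noethD unfolding framed_def by blast+

lemma basesD:
  assumes "bases z" "j \<in> {1..t}"
  shows bases_nz: "l \<in> {1..r j} \<Longrightarrow> z (j, l) \<noteq> 0" and bases_mem: "l \<in> {1..r j} \<Longrightarrow> \<nu> (z (j, l)) \<in> \<Gamma> j"
    and bases_indep: "\<nu> (level_mon z j c) \<in> \<Gamma> (j - 1) \<Longrightarrow> l \<in> {1..r j} \<Longrightarrow> c l = 0"
    and bases_span: "g \<in> \<Gamma> j \<Longrightarrow> \<exists>c. g - \<nu> (level_mon z j c) \<in> \<Gamma> (j - 1)"
  using assms unfolding bases_def by blast+

lemma bases_J: 
  assumes "bases z" "p \<in> J" shows "z p \<noteq> 0" "\<nu> (z p) \<in> \<Gamma> (fst p)"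
  using J_cases[OF assms(2)] basesD[OF assms(1)] by auto

lemma prod_powi_single: 
  "finite L \<Longrightarrow> l \<in> L \<Longrightarrow> (\<Prod>i\<in>L. (f i :: 'a) powi (if i = l then k else 0)) = f l powi k"
  by (subst prod.remove[of L l]) (auto intro!: prod.neutral)

lemma bases_notin: 
  assumes "bases z" "p \<in> J" shows "\<nu> (z p) \<notin> \<Gamma> (fst p - 1)"
proof
  assume *: "\<nu> (z p) \<in> \<Gamma> (fst p - 1)"
  obtain j l where p: "p = (j, l)" "j \<in> {1..t}" "l \<in> {1..r j}" using J_cases[OF assms(2)] by blast
  have "level_mon z j (\<lambda>i. if i = l then 1 else 0) = z p"
    unfolding level_mon_def using prod_powi_single[of "{1..r j}" l "\<lambda>i. z (j, i)" 1] p by simp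
  then show False using bases_indep[OF assms(1) p(2), of "\<lambda>i. if i = l then 1 else 0" l] * p by simp
qed

lemma bases_val_inj:
  assumes "bases z" "p \<in> J" "q \<in> J" "\<nu> (z p) = \<nu> (z q)" shows "p = q"
proof -
  have level: "fst p \<le> fst q" if "p \<in> J" "q \<in> J" "\<nu> (z p) = \<nu> (z q)" for p q
  proof (rule ccontr)
    assume "\<not> fst p \<le> fst q"
    then have "\<Gamma> (fst q) \<subseteq> \<Gamma> (fst p - 1)" using J_cases[OF that(1)] by (intro chain_mono) auto
    then show False using bases_J(2)[OF assms(1) that(2)] bases_notin[OF assms(1) that(1)] that(3) by auto
  qed
  obtain j l where p: "p = (j, l)" "j \<in> {1..t}" "l \<in> {1..r j}" using J_cases[OF assms(2)] by blast
  obtain k where q: "q = (j, k)" "k \<in> {1..r j}" 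
    using J_cases[OF assms(3)] level[OF assms(2,3,4)] level[OF assms(3,2)] assms(4) p by auto
  show ?thesis
  proof (rule ccontr)
    assume "p \<noteq> q"
    then have lk: "l \<noteq> k" using p q by auto
    define c :: "nat \<Rightarrow> int" where "c i = (if i = l then 1 else 0) + (if i = k then -1 else 0)" for i
    have z: "z (j, i) \<noteq> 0" if "i \<in> {1..r j}" for i using bases_nz[OF assms(1) p(2) that] .
    have "level_mon z j c = (\<Prod>i\<in>{1..r j}. z (j, i) powi (if i = l then 1 else 0) * z (j, i) powi (if i = k then -1 else 0))"
      unfolding level_mon_def c_def by (rule prod.cong[OF refl], rule power_int_add) (use z in auto)
    also have "\<dots> = z p * inverse (z q)"
      using prod_powi_single[of "{1..r j}" l "\<lambda>i. z (j, i)" 1] prod_powi_single[of "{1..r j}" k "\<lambda>i. z (j, i)" "-1"] p q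
      by (simp add: prod.distrib power_int_minus)
    finally have "level_mon z j c = z p / z q" by (simp add: field_class.field_divide_inverse)
    then have "\<nu> (level_mon z j c) = 0" using val_divide z p q assms(4) by simp
    moreover have "j - 1 \<le> t" using p(2) by auto
    ultimately have "c l = 0" using bases_indep[OF assms(1) p(2) _ p(3), of c] iso_zero[OF chain_iso] by simp
    then show False using lk by (simp add: c_def)
  qed
qed

lemma framed_pos: 
  assumes "framed A z" "p \<in> J" shows "0 < \<nu> (z p)" "z p \<in> A" "z p \<in> PP (fst p)"
proof -
  have "z p \<in> lspan A (z ` {p \<in> J. 1 \<le> fst p})"
    using J_cases[OF assms(2)] assms(2) by (intro lspan_superset framed_subring[OF assms(1)]) auto
  then have "z p \<in> PP 1 \<inter> A" using framed_gens[OF assms(1), of 1] by simp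
  then show "0 < \<nu> (z p)" "z p \<in> A" using bases_J[OF framed_bases[OF assms(1)] assms(2)] by (auto simp: above_def)
  then show "z p \<in> PP (fst p)" using bases_notin[OF framed_bases[OF assms(1)] assms(2)] by (simp add: above_def)
qed

text \<open>
  A value of level \<open>j\<close> is positive and outside \<open>\<Gamma>\<^bsub>j-1\<^esub>\<close>, so by convexity it exceeds all
  values of lower level.
\<close>

lemma level_le:
  assumes "framed A z" "p \<in> J" "q \<in> J" "\<nu> (z q) < \<nu> (z p)" shows "fst q \<le> fst p"
proof (rule ccontr)
  assume *: "\<not> fst q \<le> fst p"
  have q: "fst q - 1 \<le> t" "fst p \<le> fst q - 1" using * J_cases[OF assms(3)] by auto
  have "\<nu> (z p) \<in> \<Gamma> (fst q - 1)" 
    using bases_J(2)[OF framed_bases[OF assms(1)] assms(2)] chain_mono[OF q(2,1)] by blast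
  then have "\<nu> (z q) \<in> \<Gamma> (fst q - 1)"
    using iso_convex[OF chain_iso[OF q(1)], of "\<nu> (z p)" "\<nu> (z q)"] framed_pos[OF assms(1,3)] assms(4) 
      value_groupI[of "z q"] bases_J(1)[OF framed_bases[OF assms(1)] assms(3)] by auto
  then show False using bases_notin[OF framed_bases[OF assms(1)] assms(3)] by simp
qed

lemma framed_local: "framed A z \<Longrightarrow> is_local A (val_prime {0} \<inter> A)"
proof -
  assume F: "framed A z"
  have p: "is_prime A (val_prime {0} \<inter> A)" using contract_val_prime[OF framed_subring[OF F] framed_V[OF F] iso_triv] .
  have "inverse x \<in> A" if "x \<in> A - (val_prime {0} \<inter> A)" for x
    using framed_inverse[OF F, of x] that framed_V[OF F] not_val_prime[OF iso_triv, of x] by auto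
  then show ?thesis unfolding is_local_def using p framed_subring[OF F] prime_ideal prime_one by blast
qed

lemma framed_in_max: 
  assumes "framed A z" "p \<in> J" shows "z p \<in> val_prime {0} \<inter> A"
proof -
  have "0 < \<nu> (z p)" "z p \<in> A" using framed_pos[OF assms] by auto
  moreover then have "\<nu> (z p) \<noteq> 0" by auto
  ultimately show ?thesis by (simp add: above_def)
qed

text \<open>
  The values bounded by multiples of \<open>\<nu> x\<close> form an isolated subgroup, which is not contained in
  \<open>\<Gamma>\<^bsub>j-1\<^esub>\<close> and so contains the next one.
\<close>

lemma chain_archimedean:
  assumes j: "j \<in> {1..t}" and g: "g \<in> \<Gamma> j" and x: "x \<noteq> 0" "0 < \<nu> x" "\<nu> x \<notin> \<Gamma> (j - 1)"
  shows "\<exists>N. g < \<nu> (x ^ N)"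
proof -
  define C where "C = {h \<in> value_group \<nu>. \<exists>N. h \<le> \<nu> (x ^ N) \<and> - h \<le> \<nu> (x ^ N)}"
  have "isolated C" unfolding isolated_def
  proof (intro conjI ballI impI)
    show "C \<subseteq> value_group \<nu>" unfolding C_def by blast
    show "0 \<in> C" unfolding C_def using value_groupI[of 1] by (auto intro!: exI[of _ 0])
    show "a - b \<in> C" if ab: "a \<in> C" "b \<in> C" for a b
    proof -
      obtain N M where *: "a \<le> \<nu> (x ^ N)" "- a \<le> \<nu> (x ^ N)" "b \<le> \<nu> (x ^ M)" "- b \<le> \<nu> (x ^ M)"
        using ab unfolding C_def by blast
      have e: "\<nu> (x ^ (N + M)) = \<nu> (x ^ N) + \<nu> (x ^ M)" using x(1) val_mult by (simp add: power_add)
      have "a - b \<le> \<nu> (x ^ (N + M))" "- (a - b) \<le> \<nu> (x ^ (N + M))" 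
        unfolding e using add_mono[OF *(1,4)] add_mono[OF *(2,3)] by auto
      then show ?thesis unfolding C_def using ab value_group_diff C_def by blast
    qed
    show "b \<in> C" if ab: "a \<in> C" "b \<in> value_group \<nu>" "0 \<le> b" "b \<le> a" for a b
    proof -
      obtain N where N: "a \<le> \<nu> (x ^ N)" using ab(1) unfolding C_def by blast
      have 1: "b \<le> \<nu> (x ^ N)" by (rule order.trans[OF ab(4) N])
      have "- b \<le> b" using ab(3) by simp
      from order.trans[OF this 1] 1 have "b \<le> \<nu> (x ^ N) \<and> - b \<le> \<nu> (x ^ N)" by simp
      then show ?thesis unfolding C_def using ab(2) by blast
    qed
  qed
  then have "C \<in> \<Gamma> ` {0..t}" using chain_all by blast
  then obtain i where i: "i \<le> t" "C = \<Gamma> i" by auto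
  have "- \<nu> x \<le> \<nu> x" using x(2) by simp
  then have "\<nu> x \<le> \<nu> (x ^ 1) \<and> - \<nu> x \<le> \<nu> (x ^ 1)" by simp
  then have "\<nu> x \<in> C" unfolding C_def using value_groupI[OF x(1)] by blast
  moreover have "\<Gamma> i \<subseteq> \<Gamma> (j - 1)" if "i \<le> j - 1" using that j by (intro chain_mono) auto
  ultimately have "\<not> i \<le> j - 1" using i x(3) by blast
  then have "\<Gamma> j \<subseteq> C" using i chain_mono[of j i] by auto
  then obtain N where N: "g \<le> \<nu> (x ^ N)" using g unfolding C_def by blast
  have "\<nu> (x ^ N) < \<nu> (x ^ Suc N)" using x val_mult by simp
  then show ?thesis using N by (intro exI[of _ "Suc N"]) order
qed

lemma framed_level:
  assumes F: "framed A z" and j: "j \<in> {1..t}"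
  shows "valuation_level \<nu> A (\<Gamma> (j - 1)) (\<Gamma> j) {1..r j} (\<lambda>l. z (j, l))"
proof unfold_locales
  note B = framed_bases[OF F] 
  have J: "(j, l) \<in> J" if "l \<in> {1..r j}" for l using that j by (simp add: param_index_def)
  show "noeth A" "A \<subseteq> val_ring \<nu>" "is_local A (val_prime {0} \<inter> A)" 
    using framed_noeth[OF F] framed_V[OF F] framed_local[OF F] .
  show "isolated (\<Gamma> (j - 1))" "isolated (\<Gamma> j)" using chain_iso j by auto
  show "\<Gamma> (j - 1) \<subseteq> \<Gamma> j" using chain_mono j by auto
  show "finite {1..r j}" by simp
  show "z (j, l) \<in> A" "0 < \<nu> (z (j, l))" if "l \<in> {1..r j}" for l using framed_pos[OF F J[OF that]] by auto
  show "z (j, l) \<noteq> 0" "\<nu> (z (j, l)) \<in> \<Gamma> j" if "l \<in> {1..r j}" for l using basesD[OF B j] that by auto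
  show "c l = 0" if "\<nu> (\<Prod>p\<in>{1..r j}. z (j, p) powi c p) \<in> \<Gamma> (j - 1)" "l \<in> {1..r j}" for c l
    using bases_indep[OF B j] that unfolding level_mon_def by blast
  show "\<exists>N. g < \<nu> (z (j, l) ^ N)" if "g \<in> \<Gamma> j" "l \<in> {1..r j}" for g l
    using chain_archimedean[OF j that(1) bases_J(1)[OF B J[OF that(2)]] framed_pos(1)[OF F J[OF that(2)]]] 
      bases_notin[OF B J[OF that(2)]] by simp
  have split: "z ` {p \<in> J. j \<le> fst p} = (\<lambda>l. z (j, l)) ` {1..r j} \<union> z ` {p \<in> J. Suc j \<le> fst p}"
  proof -
    have "{p \<in> J. j = fst p} = Pair j ` {1..r j}" using j by (auto simp: param_index_def)
    moreover have "{p \<in> J. j \<le> fst p} = {p \<in> J. j = fst p} \<union> {p \<in> J. Suc j \<le> fst p}"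
      by (auto simp: Suc_le_eq)
    ultimately have "{p \<in> J. j \<le> fst p} = Pair j ` {1..r j} \<union> {p \<in> J. Suc j \<le> fst p}" by simp
    then show ?thesis by (simp add: image_Un image_image)
  qed
  show "PP j \<inter> A = lspan A ((\<lambda>l. z (j, l)) ` {1..r j} \<union> val_prime (\<Gamma> j) \<inter> A)"
    using framed_gens[OF F, of j] framed_gens[OF F, of "Suc j"] j 
    by (simp add: split lspan_lspan_union[OF framed_subring[OF F]])
qed

text \<open>
  The regular sequences of the single levels are concatenated; the ideal generated by the parameters
  of level \<open>j\<close> and \<open>P\<^bsub>j+1\<^esub>\<close> is \<open>P\<^sub>j\<close>.
\<close>

lemma framed_prime_seq:
  assumes F: "framed A z" and j: "j \<in> {1..Suc t}"
  shows "\<exists>ps. distinct ps \<and> set ps = {p \<in> J. fst p < j} \<and> prime_seq A (PP j \<inter> A) (map z ps)"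
proof -
  have "Suc i \<le> Suc t \<Longrightarrow> \<exists>ps. distinct ps \<and> set ps = {p \<in> J. fst p < Suc i} \<and> prime_seq A (PP (Suc i) \<inter> A) (map z ps)" for i
  proof (induction i)
    case 0
    have "{p \<in> J. fst p < Suc 0} = {}" by (auto simp: param_index_def)
    moreover have "is_prime A (PP (Suc 0) \<inter> A)" 
      using contract_val_prime[OF framed_subring[OF F] framed_V[OF F] chain_iso[of 0]] by simp
    ultimately show ?case by (intro exI[of _ "[]"]) auto
  next
    case (Suc i)
    then obtain ps where ps: "distinct ps" "set ps = {p \<in> J. fst p < Suc i}" "prime_seq A (PP (Suc i) \<inter> A) (map z ps)" by auto
    let ?j = "Suc i"
    have j: "?j \<in> {1..t}" using Suc.prems by simp
    interpret L: valuation_level \<nu> A "\<Gamma> (?j - 1)" "\<Gamma> ?j" "{1..r ?j}" "\<lambda>l. z (?j, l)" by (rule framed_level[OF F j])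
    have "prime_seq A (lspan A ((\<lambda>l. z (?j, l)) ` {} \<union> (val_prime (\<Gamma> ?j) \<inter> A))) (map (\<lambda>l. z (?j, l)) [1..<Suc (r ?j)])"
      by (rule L.level_prime_seq) auto
    then have 1: "prime_seq A (PP (Suc ?j) \<inter> A) (map (\<lambda>l. z (?j, l)) [1..<Suc (r ?j)])"
      using lspan_ideal_eq[OF framed_subring[OF F] prime_ideal[OF L.U_prime]] by simp
    have "prime_seq A (PP (Suc ?j) \<inter> A) (map (\<lambda>l. z (?j, l)) [1..<Suc (r ?j)] @ map z ps)"
    proof (rule prime_seq_append[OF framed_subring[OF F] 1])
      have "set (map (\<lambda>l. z (?j, l)) [1..<Suc (r ?j)]) = (\<lambda>l. z (?j, l)) ` {1..r ?j}" by auto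
      then show "prime_seq A (lspan A (set (map (\<lambda>l. z (?j, l)) [1..<Suc (r ?j)]) \<union> PP (Suc ?j) \<inter> A)) (map z ps)"
        using ps(3) L.gens by simp
    qed
    moreover have "map (\<lambda>l. z (?j, l)) [1..<Suc (r ?j)] @ map z ps = map z (map (Pair ?j) [1..<Suc (r ?j)] @ ps)" by simp
    moreover have "distinct (map (Pair ?j) [1..<Suc (r ?j)] @ ps)"
      using ps(1,2) by (auto simp: distinct_map inj_on_def)
    moreover have "set (map (Pair ?j) [1..<Suc (r ?j)] @ ps) = {p \<in> J. fst p < Suc ?j}"
    proof -
      have "{p \<in> J. ?j = fst p} = Pair ?j ` {1..r ?j}" using j by (auto simp: param_index_def)
      moreover have "{p \<in> J. fst p < Suc ?j} = {p \<in> J. ?j = fst p} \<union> {p \<in> J. fst p < ?j}"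
        by (auto simp: less_Suc_eq)
      ultimately have "{p \<in> J. fst p < Suc ?j} = Pair ?j ` {1..r ?j} \<union> {p \<in> J. fst p < ?j}" by simp
      moreover have "set (map (Pair ?j) [1..<Suc (r ?j)]) = Pair ?j ` {1..r ?j}" 
        unfolding set_map set_upt atLeastLessThanSuc_atLeastAtMost ..
      ultimately show ?thesis using ps(2) by simp
    qed
    ultimately show ?case by metis
  qed
  then show ?thesis using j by (cases j) auto
qed

lemma framed_chain_exists:
  assumes F: "framed A z" and j: "j \<in> {1..Suc t}"
  shows "\<exists>q. prime_chain_from A (PP j \<inter> A) (card {p \<in> J. fst p < j}) q"
proof -
  obtain ps where ps: "distinct ps" "set ps = {p \<in> J. fst p < j}" "prime_seq A (PP j \<inter> A) (map z ps)" 
    using framed_prime_seq[OF assms] by blast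
  have "card {p \<in> J. fst p < j} = length (map z ps)" using distinct_card[OF ps(1)] ps(2) by simp
  then show ?thesis using prime_seq_chain[OF framed_subring[OF F] ps(3)] by metis
qed

lemma framed_chain_bound:
  assumes F: "framed A z" and j: "j \<in> {1..Suc t}" and q: "prime_chain_from A (PP j \<inter> A) d q"
  shows "d \<le> card {p \<in> J. fst p < j}"
proof (rule height_theorem[OF framed_noeth[OF F] framed_local[OF F] _ _ _ _ q])
  show "finite (z ` {p \<in> J. fst p < j})" "card (z ` {p \<in> J. fst p < j}) \<le> card {p \<in> J. fst p < j}"
    using finite_J by (auto intro: card_image_le)
  show "z ` {p \<in> J. fst p < j} \<subseteq> val_prime {0} \<inter> A" using framed_in_max[OF F] by blast
  fix p assume p: "is_prime A p" "PP j \<inter> A \<subseteq> p" "z ` {p \<in> J. fst p < j} \<subseteq> p"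
  have "z ` {p \<in> J. 1 \<le> fst p} \<subseteq> p"
  proof
    fix x assume "x \<in> z ` {p \<in> J. 1 \<le> fst p}"
    then obtain a where a: "a \<in> J" "x = z a" by blast
    show "x \<in> p"
    proof (cases "fst a < j")
      case False
      then have "z a \<in> lspan A (z ` {p \<in> J. j \<le> fst p})" using a by (intro lspan_superset framed_subring[OF F]) auto
      then show ?thesis using framed_gens[OF F j] p(2) a by blast
    qed (use a p in blast)
  qed
  then have "PP 1 \<inter> A \<subseteq> p" using framed_gens[OF F, of 1] lspan_least[OF ideal_submodule[OF prime_ideal[OF p(1)]]] by simp
  moreover have "p \<subseteq> val_prime {0} \<inter> A" using local_proper_ideal[OF framed_local[OF F]] p(1) by (simp add: is_prime_def)
  ultimately show "p = val_prime {0} \<inter> A" using PP_one val_ideal_eq by auto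
qed

lemma framed_nonzerodiv:
  assumes F: "framed A z" and j: "j \<in> {1..Suc t}" and pq: "p \<in> J" "q \<in> J" "p \<noteq> q" "fst p < j" "fst q < j"
  shows "nonzerodiv_mod A (lspan A (insert (z q) (PP j \<inter> A))) (z p)"
proof -
  obtain ps where ps: "distinct ps" "set ps = {p \<in> J. fst p < j}" "prime_seq A (PP j \<inter> A) (map z ps)" 
    using framed_prime_seq[OF assms(1,2)] by blast
  have inj: "inj_on z J" using bases_val_inj[OF framed_bases[OF F]] by (auto simp: inj_on_def)
  show ?thesis
  proof (rule prime_seq_permute[OF framed_local[OF F] framed_noeth[OF F] ps(3)])
    show "set (map z ps) \<subseteq> val_prime {0} \<inter> A" using ps(2) framed_in_max[OF F] by auto
    show "distinct (map z ps)" using ps inj by (auto simp: distinct_map inj_on_def)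
    show "z p \<in> set (map z ps)" "z q \<in> set (map z ps)" using ps(2) pq by auto
    show "z p \<noteq> z q" using inj pq by (auto simp: inj_on_def)
  qed
qed

section \<open>Primitive transforms of framed rings\<close>

lemma level_mon_nz: "bases z \<Longrightarrow> j \<in> {1..t} \<Longrightarrow> level_mon z j c \<noteq> 0"
  unfolding level_mon_def using bases_nz by (auto simp: power_int_eq_0_iff)

lemma level_mon_divide:
  assumes "l \<in> {1..r j}" "y \<noteq> 0"
  shows "level_mon (z((j, l) := z (j, l) / y)) j c = level_mon z j c / y powi c l"
proof -
  have "level_mon (z((j, l) := z (j, l) / y)) j c = (\<Prod>i\<in>{1..r j}. z (j, i) powi c i * (y powi - c l) powi (if i = l then 1 else 0))"
    unfolding level_mon_def 
    by (rule prod.cong) (auto simp: power_int_mult_distrib power_int_inverse power_int_minus field_class.field_divide_inverse)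
  also have "\<dots> = level_mon z j c * y powi - c l"
    unfolding level_mon_def prod.distrib using prod_powi_single[of "{1..r j}" l "\<lambda>_. y powi - c l" 1] assms(1) by simp
  finally show ?thesis by (simp add: power_int_minus field_class.field_divide_inverse)
qed

lemma level_mon_shift:
  assumes "l \<in> {1..r j}" "z (j, l) \<noteq> 0"
  shows "level_mon z j (c(l := c l + d)) = level_mon z j c * z (j, l) powi d"
proof -
  have "level_mon z j (c(l := c l + d)) = (\<Prod>i\<in>{1..r j}. z (j, i) powi c i * z (j, i) powi (if i = l then d else 0))"
    unfolding level_mon_def by (rule prod.cong) (auto simp: power_int_add assms(2))
  then show ?thesis unfolding level_mon_def prod.distrib 
    using prod_powi_single[of "{1..r j}" l "\<lambda>i. z (j, i)" d] assms(1) by simp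
qed

text \<open>
  If \<open>q\<close> has lower level than \<open>p\<close>, the value of the new parameter is the old one modulo
  \<open>\<Gamma>\<^bsub>j-1\<^esub>\<close>; otherwise the basis changes by an elementary operation.
\<close>

lemma bases_transform:
  assumes B: "bases z" and p: "p \<in> J" and q: "q \<in> J" and pq: "p \<noteq> q" "fst q \<le> fst p"
  shows "bases (z(p := z p / z q))"
  unfolding bases_def
proof (intro ballI)
  let ?z = "z(p := z p / z q)"
  fix j assume j: "j \<in> {1..t}"
  have ij: "isolated (\<Gamma> j)" "isolated (\<Gamma> (j - 1))" using chain_iso j by auto
  obtain l where l: "p = (fst p, l)" "l \<in> {1..r (fst p)}" "fst p \<in> {1..t}" using J_cases[OF p] by auto
  have zq: "z q \<noteq> 0" "z p \<noteq> 0" using bases_J(1)[OF B] p q by auto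
  show "(\<forall>l\<in>{1..r j}. ?z (j, l) \<noteq> 0 \<and> \<nu> (?z (j, l)) \<in> \<Gamma> j) \<and>
     (\<forall>c. \<nu> (level_mon ?z j c) \<in> \<Gamma> (j - 1) \<longrightarrow> (\<forall>l\<in>{1..r j}. c l = 0)) \<and>
     (\<forall>g\<in>\<Gamma> j. \<exists>c. g - \<nu> (level_mon ?z j c) \<in> \<Gamma> (j - 1))"
  proof (cases "j = fst p")
    case False
    then have e: "?z (j, i) = z (j, i)" for i by auto
    have "level_mon ?z j c = level_mon z j c" for c unfolding level_mon_def e ..
    then show ?thesis using B j e unfolding bases_def by auto
  next
    case True
    have pj: "p = (j, l)" "l \<in> {1..r j}" using l True by auto
    have zp: "\<nu> (z p) \<in> \<Gamma> j" using bases_J(2)[OF B p] True by simp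
    have "\<nu> (z q) \<in> \<Gamma> j" using bases_J(2)[OF B q] chain_mono[of "fst q" j] pq(2) True j by auto
    then have "\<nu> (z p / z q) \<in> \<Gamma> j" using val_divide[OF zq(2,1)] iso_diff[OF ij(1) zp] by simp
    then have 1: "\<forall>l\<in>{1..r j}. ?z (j, l) \<noteq> 0 \<and> \<nu> (?z (j, l)) \<in> \<Gamma> j"
      using basesD(1,2)[OF B j] zq by auto
    have eq: "level_mon ?z j c = level_mon z j c / z q powi c l" for c
      unfolding pj(1) using level_mon_divide[OF pj(2) zq(1), of z c] pj(1) by simp
    show ?thesis
    proof (cases "fst q < j")
      case True
      then have "\<Gamma> (fst q) \<subseteq> \<Gamma> (j - 1)" using j by (intro chain_mono) auto
      then have "\<nu> (z q) \<in> \<Gamma> (j - 1)" using bases_J(2)[OF B q] by blast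
      then have k: "\<nu> (z q powi k) \<in> \<Gamma> (j - 1)" for k using val_powi_mem[OF ij(2) zq(1)] by blast
      have v: "\<nu> (level_mon ?z j c) = \<nu> (level_mon z j c) - \<nu> (z q powi c l)" for c
        unfolding eq using val_divide[OF level_mon_nz[OF B j]] zq(1) by simp
      have "\<nu> (level_mon z j c) \<in> \<Gamma> (j - 1)" if "\<nu> (level_mon ?z j c) \<in> \<Gamma> (j - 1)" for c
        using iso_add[OF ij(2) that k[of "c l"]] v[of c] by simp
      then have 2: "\<forall>c. \<nu> (level_mon ?z j c) \<in> \<Gamma> (j - 1) \<longrightarrow> (\<forall>l\<in>{1..r j}. c l = 0)" 
        using bases_indep[OF B j] by blast
      have "g - \<nu> (level_mon ?z j c) \<in> \<Gamma> (j - 1)" if "g - \<nu> (level_mon z j c) \<in> \<Gamma> (j - 1)" for c g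
      proof -
        have e: "g - \<nu> (level_mon ?z j c) = (g - \<nu> (level_mon z j c)) + \<nu> (z q powi c l)" unfolding v by simp
        show ?thesis unfolding e using iso_add[OF ij(2) that k[of "c l"]] .
      qed
      then have "\<forall>g\<in>\<Gamma> j. \<exists>c. g - \<nu> (level_mon ?z j c) \<in> \<Gamma> (j - 1)" using bases_span[OF B j] by blast
      then show ?thesis using 1 2 by blast
    next
      case False
      then have qj: "fst q = j" using pq(2) \<open>j = fst p\<close> by simp
      then obtain k where k: "q = (j, k)" "k \<in> {1..r j}" using J_cases[OF q] by auto
      then have kl: "k \<noteq> l" using pj(1) pq(1) by auto
      note k = k kl
      have v: "level_mon ?z j c = level_mon z j (c(k := c k + - c l))" for c
        using eq[of c] level_mon_shift[of k j z c "- c l", OF k(2) bases_nz[OF B j k(2)]] k(1)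
        by (simp add: power_int_minus field_class.field_divide_inverse)
      have "\<forall>i\<in>{1..r j}. c i = 0" if "\<nu> (level_mon ?z j c) \<in> \<Gamma> (j - 1)" for c
      proof -
        have *: "(c(k := c k + - c l)) i = 0" if "i \<in> {1..r j}" for i
          using bases_indep[OF B j _ that, of "c(k := c k + - c l)"] v[of c] \<open>\<nu> (level_mon ?z j c) \<in> \<Gamma> (j - 1)\<close> by simp
        have "c l = 0" using *[OF pj(2)] k(3) by simp
        then have "c k = 0" using *[OF k(2)] by simp
        show ?thesis
        proof
          fix i assume "i \<in> {1..r j}"
          then show "c i = 0" using *[of i] \<open>c k = 0\<close> by (cases "i = k") auto
        qed
      qed
      then have 2: "\<forall>c. \<nu> (level_mon ?z j c) \<in> \<Gamma> (j - 1) \<longrightarrow> (\<forall>l\<in>{1..r j}. c l = 0)" by blast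
      have "\<exists>c. g - \<nu> (level_mon ?z j c) \<in> \<Gamma> (j - 1)" if g: "g \<in> \<Gamma> j" for g
      proof -
        obtain c where c: "g - \<nu> (level_mon z j c) \<in> \<Gamma> (j - 1)" using bases_span[OF B j g] by blast
        have "(c(k := c k + c l))(k := (c(k := c k + c l)) k + - (c(k := c k + c l)) l) = c" using k(3) by auto
        then have "level_mon ?z j (c(k := c k + c l)) = level_mon z j c" unfolding v by (rule arg_cong)
        then show ?thesis using c by metis
      qed
      then show ?thesis using 1 2 by blast
    qed
  qed
qed

lemma nonzerodiv_power: 
  assumes "is_subring A" "nonzerodiv_mod A I b" "b \<in> A" "c \<in> A" "c * b ^ n \<in> I" shows "c \<in> I"
  using assms(4,5)
proof (induction n arbitrary: c)
  case (Suc n)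
  then have "c * b \<in> I" using Suc.IH[of "c * b"] subring_mult[OF assms(1) _ assms(3)] by (simp add: mult.assoc)
  then show ?case using assms(2) Suc.prems unfolding nonzerodiv_mod_def by blast
qed simp

lemma polys_below_denominator:
  assumes "is_subring A" "y * d \<in> A" "d \<in> A" "b \<in> polys_below A y (Suc n)" shows "d ^ n * b \<in> A"
  using assms(4)
proof (induction n arbitrary: b)
  case 0 then show ?case by auto
next
  case (Suc n)
  then obtain a b' where ab: "b = a * y ^ Suc n + b'" "a \<in> A" "b' \<in> polys_below A y (Suc n)" by auto
  have "d ^ Suc n * b = a * (y * d) ^ Suc n + d * (d ^ n * b')" 
    unfolding ab(1) power_mult_distrib by (simp add: algebra_simps)
  then show ?case using Suc.IH[OF ab(3)] ab(2) assms(1-3) by (auto intro!: subring_add subring_mult subring_power)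
qed

lemma adjoin_decompose:
  assumes A: "is_subring A" and b: "b \<in> adjoin A {y}"
  shows "\<exists>a\<in>A. \<exists>b'\<in>adjoin A {y}. b = a + y * b'"
proof -
  note B = is_subring_adjoin[of A "{y}"]
  have AB: "A \<subseteq> adjoin A {y}" "y \<in> adjoin A {y}" using adjoin_superset[of A "{y}"] by auto
  have "b \<in> polys_below A y n \<Longrightarrow> ?thesis" for n
  proof (induction n arbitrary: b)
    case 0
    then have "b = 0 + y * 0" by simp
    then show ?case using subring_zero[OF A] subring_zero[OF B] by blast
  next
    case (Suc n)
    then obtain a d where ad: "b = a * y ^ n + d" "a \<in> A" "d \<in> polys_below A y n" by auto
    obtain a' d' where ad': "a' \<in> A" "d' \<in> adjoin A {y}" "d = a' + y * d'" using Suc.IH[OF ad(3)] by blast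
    show ?case
    proof (cases n)
      case 0
      then have "b = a + y * 0" using ad by simp
      then show ?thesis using ad(2) subring_zero[OF B] by blast
    next
      case (Suc k)
      have "b = a' + y * (a * y ^ k + d')" using ad(1) ad'(3) Suc by (simp add: algebra_simps)
      moreover have "a * y ^ k + d' \<in> adjoin A {y}" 
        using ad(2) ad'(2) AB by (auto intro!: subring_add[OF B] subring_mult[OF B] subring_power[OF B])
      ultimately show ?thesis using ad'(1) by blast
    qed
  qed
  then show ?thesis using b adjoin_eq_polys[OF A] by blast
qed

text \<open>
  Only the generation of \<open>P\<^sub>j\<close> by parameters needs an argument, and it suffices to treat elements \<open>b\<close> of
  \<open>B = A[y]\<close>.  If \<open>p\<close> has level at least \<open>j\<close>, then \<open>y \<in> P\<^sub>j\<close>, and only the constant term of \<open>b\<close> matters.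
  Otherwise the degree of \<open>b\<close> in \<open>y\<close> is lowered: clearing denominators shows \<open>a z\<^sub>p\<^sup>n \<in> (z\<^sub>q) + P\<^sub>j\<close> for
  the leading coefficient \<open>a\<close>, hence \<open>a = c z\<^sub>q + d\<close> with \<open>d \<in> P\<^sub>j\<close>, and \<open>c z\<^sub>q y\<^sup>n = c z\<^sub>p y\<^bsup>n-1\<^esup>\<close>.
\<close>

theorem framed_transform:
  assumes F: "framed A z" and p: "p \<in> J" and q: "q \<in> J" and lt: "\<nu> (z q) < \<nu> (z p)"
    and A': "A' = localize (adjoin A {z p / z q}) (adjoin A {z p / z q} - val_ideal \<nu>)"
  shows "framed A' (z(p := z p / z q))" "A \<subseteq> A'"
proof -
  define y where "y = z p / z q"
  let ?z = "z(p := y)"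
  define B where "B = adjoin A {y}"
  have A: "is_subring A" using framed_subring[OF F] .
  have nz: "z p \<noteq> 0" "z q \<noteq> 0" using bases_J[OF framed_bases[OF F]] p q by auto
  have y: "y \<noteq> 0" "\<nu> y = \<nu> (z p) - \<nu> (z q)" "0 < \<nu> y" using nz val_divide lt by (auto simp: y_def)
  have pq: "p \<noteq> q" using lt by auto
  have le: "fst q \<le> fst p" using level_le[OF F p q lt] .
  have bz: "bases ?z" unfolding y_def using bases_transform[OF framed_bases[OF F] p q pq le] .
  have Bs: "is_subring B" unfolding B_def by (rule is_subring_adjoin)
  have AB: "A \<subseteq> B" "y \<in> B" unfolding B_def using adjoin_superset[of A "{y}"] by auto
  have BV: "B \<subseteq> val_ring \<nu>" unfolding B_def
    using framed_V[OF F] y by (intro adjoin_least[OF val_ring_subring]) (auto simp: val_ring_def)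
  define m0 where "m0 = val_prime {0} \<inter> B"
  have m0: "is_prime B m0" unfolding m0_def using contract_val_prime[OF Bs BV iso_triv] .
  define S where "S = B - m0"
  have A'S: "A' = localize B S" unfolding A' S_def m0_def B_def y_def val_ideal_eq by (rule arg_cong) blast
  have S: "mult_set B S" unfolding S_def by (rule prime_complement_mult_set[OF Bs m0])
  have Sv: "s \<noteq> 0" "\<nu> s = 0" "s \<in> B" if "s \<in> S" for s
    using that not_val_prime[OF iso_triv, of s] BV unfolding S_def m0_def by auto
  have BA': "B \<subseteq> A'" unfolding A'S using localize_superset[OF S] .
  show "A \<subseteq> A'" using AB BA' by blast
  have Nt: "noeth A'" unfolding A'S B_def 
    using noeth_localize[OF hilbert_basis[OF framed_noeth[OF F]]] S unfolding B_def by blast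
  have As: "is_subring A'" using Nt noethD by blast
  have Sinv: "inverse s \<in> A'" if "s \<in> S" for s
    unfolding A'S using localize_memI[OF subring_one[OF Bs] that] by (simp add: inverse_eq_divide)
  have A'V: "A' \<subseteq> val_ring \<nu>"
  proof
    fix x assume "x \<in> A'"
    then obtain b s where bs: "b \<in> B" "s \<in> S" "x = b / s" unfolding A'S by (rule localize_memE)
    show "x \<in> val_ring \<nu>"
    proof (cases "b = 0")
      case False
      then show ?thesis using bs Sv[OF bs(2)] val_divide[of b s] BV by (auto simp: val_ring_def)
    qed (use bs in \<open>simp add: val_ring_def\<close>)
  qed
  have A'inv: "inverse x \<in> A'" if x: "x \<in> A'" "x \<noteq> 0" "\<nu> x = 0" for x
  proof -
    obtain b s where bs: "b \<in> B" "s \<in> S" "x = b / s" using x(1) unfolding A'S by (rule localize_memE)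
    have "b \<noteq> 0" using bs x(2) by auto
    then have "\<nu> b = 0" using bs Sv[OF bs(2)] val_divide[of b s] x(3) by simp
    then have "b \<in> S" unfolding S_def m0_def using bs(1) \<open>b \<noteq> 0\<close> by (auto simp: above_def)
    then have "s / b \<in> A'" unfolding A'S using Sv[OF bs(2)] localize_memI by blast
    then show ?thesis using bs(3) by simp
  qed
  have zpos: "0 < \<nu> (?z a)" "?z a \<in> A'" if "a \<in> J" for a
    using framed_pos(1,2)[OF F that] y AB BA' by auto
  have gens: "PP j \<inter> A' = lspan A' (?z ` {a \<in> J. j \<le> fst a})" if j: "j \<in> {1..Suc t}" for j
  proof
    let ?I = "lspan A' (?z ` {a \<in> J. j \<le> fst a})"
    have jt: "j - 1 \<le> t" using j by auto
    have Pj: "is_prime A' (PP j \<inter> A')" using contract_val_prime[OF As A'V chain_iso[OF jt]] .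
    have Pv: "is_prime (val_ring \<nu>) (PP j)" using PP_prime[OF j] .
    have zP: "?z a \<in> PP j" if a: "a \<in> J" "j \<le> fst a" for a
    proof -
      have "\<nu> (?z a) \<notin> \<Gamma> (fst a - 1)" using bases_notin[OF bz a(1)] .
      moreover have "fst a - 1 \<le> t" using J_cases[OF a(1)] by auto
      then have "\<Gamma> (j - 1) \<subseteq> \<Gamma> (fst a - 1)" using a(2) by (intro chain_mono) auto
      ultimately show ?thesis using zpos(1)[OF a(1)] unfolding above_def by auto
    qed
    show "?I \<subseteq> PP j \<inter> A'"
      by (rule lspan_least[OF ideal_submodule[OF prime_ideal[OF Pj]]]) (use zP zpos(2) in blast)
    have Is: "submodule_of A' ?I" by (rule lspan_submodule[OF As])
    have IsA: "submodule_of A ?I" using Is \<open>A \<subseteq> A'\<close> unfolding submodule_of_def by blast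
    have zI: "?z a \<in> ?I" if "a \<in> J" "j \<le> fst a" for a using that by (intro lspan_superset[OF As]) auto
    have oldI: "PP j \<inter> A \<subseteq> ?I" unfolding framed_gens[OF F j]
    proof (rule lspan_least[OF IsA])
      show "z ` {a \<in> J. j \<le> fst a} \<subseteq> ?I"
      proof
        fix x assume "x \<in> z ` {a \<in> J. j \<le> fst a}"
        then obtain a where a: "a \<in> J" "j \<le> fst a" "x = z a" by blast
        show "x \<in> ?I"
        proof (cases "a = p")
          case True
          then have "x = z q * ?z a" using a nz by (simp add: y_def)
          moreover have "z q \<in> A'" using zpos(2)[OF q] pq by simp
          ultimately show ?thesis using submodule_smult[OF Is _ zI[OF a(1,2)]] by simp
        next
          case False then show ?thesis using zI[OF a(1,2)] a by simp
        qed
      qed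
    qed
    have PB: "b \<in> ?I" if b: "b \<in> B" "b \<in> PP j" for b
    proof (cases "j \<le> fst p")
      case True
      obtain a b' where ab: "a \<in> A" "b' \<in> B" "b = a + y * b'" using adjoin_decompose[OF A] b(1) unfolding B_def by blast
      have yP: "y \<in> PP j" using zP[OF p True] by simp
      have "y * b' \<in> PP j" using ideal_mult2[OF prime_ideal[OF Pv] _ yP] ab(2) BV by blast
      then have "b - y * b' \<in> PP j" using ideal_diff[OF val_ring_subring prime_ideal[OF Pv] b(2)] by blast
      then have "a \<in> ?I" using ab oldI by auto
      moreover have "y * b' \<in> ?I" using submodule_smult2[OF Is _ zI[OF p True]] ab(2) BA' by auto
      ultimately show ?thesis using ab(3) submodule_add[OF Is] by simp
    next
      case False
      let ?K = "lspan A (insert (z q) (PP j \<inter> A))"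
      have Np: "is_prime A (PP j \<inter> A)" using contract_val_prime[OF A framed_V[OF F] chain_iso[OF jt]] .
      have nzd: "nonzerodiv_mod A ?K (z p)" using framed_nonzerodiv[OF F j p q pq] False le by auto
      have zA: "z p \<in> A" "z q \<in> A" using framed_pos[OF F] p q by auto
      have yq: "y * z q = z p" using nz by (simp add: y_def)
      have K: "?K = {c * z q + k | c k. c \<in> A \<and> k \<in> PP j \<inter> A}" 
        by (rule lspan_union_ideal[OF A prime_ideal[OF Np]])
      have "b \<in> PP j \<Longrightarrow> b \<in> polys_below A y n \<Longrightarrow> b \<in> ?I" for n
      proof (induction n arbitrary: b)
        case 0 then show ?case using submodule_zero[OF Is] by simp
      next
        case (Suc n)
        then obtain a b' where ab: "b = a * y ^ n + b'" "a \<in> A" "b' \<in> polys_below A y n" by auto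
        show ?case
        proof (cases n)
          case 0
          then have "b \<in> PP j \<inter> A" using ab Suc.prems by simp
          then show ?thesis using oldI by blast
        next
          case (Suc k)
          have "z q ^ n * b \<in> A" using polys_below_denominator[OF A _ zA(2) Suc.prems(2)] yq zA by simp
          moreover have "z q ^ n * b \<in> PP j" 
            using ideal_mult[OF prime_ideal[OF Pv] _ Suc.prems(1)] subring_power[OF A zA(2)] framed_V[OF F] by blast
          ultimately have 1: "z q ^ n * b \<in> PP j \<inter> A" by blast
          have 2: "z q ^ k * b' \<in> A" 
            by (rule polys_below_denominator[OF A _ zA(2)]) (use ab(3) yq zA Suc in \<open>simp_all del: polys_below.simps\<close>)
          \<comment> \<open>Clearing denominators isolates the leading coefficient modulo \<open>z\<^sub>q\<close>.\<close>
          have "z q ^ n * b = a * (y * z q) ^ n + z q * (z q ^ k * b')"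
            unfolding ab(1) Suc power_mult_distrib by (simp add: algebra_simps)
          then have "a * z p ^ n = (- (z q ^ k * b')) * z q + z q ^ n * b" unfolding yq by (simp add: algebra_simps)
          then have "a * z p ^ n \<in> ?K" unfolding K using 1 subring_minus[OF A 2] by blast
          then have "a \<in> ?K" using nonzerodiv_power[OF A nzd zA(1) ab(2)] by blast
          then obtain c d where cd: "a = c * z q + d" "c \<in> A" "d \<in> PP j \<inter> A" unfolding K by blast
          have "a * y ^ n = c * (y * z q) * y ^ k + d * y ^ n" unfolding cd(1) Suc by (simp add: algebra_simps)
          then have bb: "b = ((c * z p) * y ^ k + b') + d * y ^ n" unfolding yq ab(1) by simp
          have dy: "d * y ^ n \<in> PP j" "d * y ^ n \<in> ?I"
            using ideal_mult2[OF prime_ideal[OF Pv], of "y ^ n" d] subring_power[OF Bs AB(2), of n] BV cd(3) 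
              submodule_smult2[OF Is, of "y ^ n" d] BA' oldI by auto
          have "(c * z p) * y ^ k + 0 \<in> polys_below A y (Suc k)"
            using submodule_zero[OF polys_below_submodule[OF A]] subring_mult[OF A cd(2) zA(1)] by (intro polys_below_SucI)
          then have "(c * z p) * y ^ k + b' \<in> polys_below A y n" 
            using submodule_add[OF polys_below_submodule[OF A], of "(c * z p) * y ^ k" y n b'] ab(3) Suc by (simp del: polys_below.simps)
          moreover have "b - d * y ^ n \<in> PP j" using ideal_diff[OF val_ring_subring prime_ideal[OF Pv] Suc.prems(1) dy(1)] .
          then have "(c * z p) * y ^ k + b' \<in> PP j" using bb by simp
          ultimately have "(c * z p) * y ^ k + b' \<in> ?I" using Suc.IH by blast
          then show ?thesis using bb dy(2) submodule_add[OF Is] by simp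
        qed
      qed
      then show ?thesis using b unfolding B_def adjoin_eq_polys[OF A] by blast
    qed
    show "PP j \<inter> A' \<subseteq> ?I"
    proof
      fix f assume f: "f \<in> PP j \<inter> A'"
      then obtain b s where bs: "b \<in> B" "s \<in> S" "f = b / s" unfolding A'S using localize_memE by blast
      have "b = s * f" using bs Sv by simp
      then have "b \<in> PP j" using f ideal_mult[OF prime_ideal[OF Pv], of s f] Sv(3)[OF bs(2)] BV by auto
      then have "inverse s * b \<in> ?I" using submodule_smult[OF Is Sinv[OF bs(2)] PB[OF bs(1)]] by blast
      then show "f \<in> ?I" using bs(3) by (simp add: field_class.field_divide_inverse mult.commute)
    qed
  qed
  show "framed A' (z(p := z p / z q))" unfolding framed_def using Nt A'V A'inv bz gens unfolding y_def by auto
qed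

end

section \<open>Monomialization\<close>

lemma lspan_finite:
  assumes "is_subring A" "x \<in> lspan A W" 
  shows "\<exists>Y. finite Y \<and> Y \<subseteq> W \<and> x \<in> lspan A Y"
  using assms(2)
proof induction
  case lspan_zero then show ?case by (intro exI[of _ "{}"]) (auto intro: lspan.lspan_zero)
next
  case (lspan_step a v y)
  then obtain Y where Y: "finite Y" "Y \<subseteq> W" "y \<in> lspan A Y" by blast
  then have "y \<in> lspan A (insert v Y)" using lspan_mono[OF assms(1), of Y "insert v Y"] by blast
  then have "a * v + y \<in> lspan A (insert v Y)" using lspan_step(1) by (intro lspan.lspan_step) auto
  then show ?case using Y lspan_step(2) by (intro exI[of _ "insert v Y"]) auto
qed

context valuation_chain
begin

definition laurent :: "(nat \<times> nat \<Rightarrow> 'a) \<Rightarrow> (nat \<times> nat \<Rightarrow> int) \<Rightarrow> 'a" where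
  "laurent z c = (\<Prod>p\<in>J. z p powi c p)"

definition laurent_monomials :: "(nat \<times> nat \<Rightarrow> 'a) \<Rightarrow> 'a set" where "laurent_monomials z = range (laurent z)"
definition monomials :: "(nat \<times> nat \<Rightarrow> 'a) \<Rightarrow> 'a set" where "monomials z = {laurent z c | c. \<forall>p\<in>J. 0 \<le> c p}"

text \<open>
  A primitive transform without the requirement that the parameters are very good, which
  framedness implies.
\<close>

definition prim_step :: "'a set \<times> (nat \<times> nat \<Rightarrow> 'a) \<Rightarrow> 'a set \<times> (nat \<times> nat \<Rightarrow> 'a) \<Rightarrow> bool" where
  "prim_step = (\<lambda>(A, z) (A', z'). \<exists>p\<in>J. \<exists>q\<in>J. \<nu> (z q) < \<nu> (z p) \<and> z' = z(p := z p / z q) \<and>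
     A' = localize (adjoin A {z p / z q}) (adjoin A {z p / z q} - val_ideal \<nu>))"

lemma laurent_nz: "bases z \<Longrightarrow> laurent z c \<noteq> 0"
  unfolding laurent_def using bases_J(1) finite_J by (auto simp: power_int_eq_0_iff)

lemma laurent_add: "bases z \<Longrightarrow> laurent z (\<lambda>p. c p + d p) = laurent z c * laurent z d"
  unfolding laurent_def prod.distrib[symmetric] by (rule prod.cong) (auto simp: power_int_add bases_J)

lemma laurent_minus: "laurent z (\<lambda>p. - c p) = inverse (laurent z c)"
  unfolding laurent_def by (simp add: power_int_minus prod_inversef[symmetric] comp_def)

lemma laurent_single: "p \<in> J \<Longrightarrow> laurent z (\<lambda>q. if q = p then k else 0) = z p powi k"
  unfolding laurent_def using prod_powi_single[OF finite_J] by blast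

lemma laurent_levels: "laurent z c = (\<Prod>j\<in>{1..t}. level_mon z j (\<lambda>l. c (j, l)))"
  unfolding laurent_def level_mon_def param_index_def by (subst prod.Sigma) auto

lemma laurent_transform:
  assumes "bases z" "p \<in> J" "q \<in> J" "p \<noteq> q"
  shows "laurent z c = laurent (z(p := z p / z q)) (c(q := c q + c p))"
proof -
  have nz: "z p \<noteq> 0" "z q \<noteq> 0" using bases_J[OF assms(1)] assms by auto
  have "laurent (z(p := z p / z q)) (c(q := c q + c p)) = 
    (\<Prod>a\<in>J. z a powi c a * (z q powi - c p) powi (if a = p then 1 else 0) * (z q powi c p) powi (if a = q then 1 else 0))"
    unfolding laurent_def using assms nz 
    by (intro prod.cong) (auto simp: power_int_mult_distrib power_int_inverse power_int_minus power_int_add field_class.field_divide_inverse)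
  also have "\<dots> = laurent z c * (z q powi - c p) * (z q powi c p)"
    unfolding laurent_def prod.distrib using prod_powi_single[OF finite_J assms(2), of "\<lambda>_. z q powi - c p" 1]
     prod_powi_single[OF finite_J assms(3), of "\<lambda>_. z q powi c p" 1] by simp
  also have "\<dots> = laurent z c" using nz by (simp add: power_int_minus)
  finally show ?thesis by simp
qed

text \<open>
  The highest level on which the exponents do not vanish would give a relation modulo the preceding
  isolated subgroup.
\<close>

lemma laurent_indep:
  assumes B: "bases z" and v: "\<nu> (laurent z c) = 0" and p: "p \<in> J"
  shows "c p = 0"
proof -
  have lm: "\<nu> (level_mon z j d) \<in> \<Gamma> j" if "j \<in> {1..t}" for j d
    unfolding level_mon_def using that bases_nz[OF B that] bases_mem[OF B that] chain_iso[of j]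
    by (intro val_prod_mem) (auto simp: power_int_eq_0_iff intro!: val_powi_mem)
  have "n \<le> t \<Longrightarrow> \<nu> (\<Prod>j\<in>{1..n}. level_mon z j (\<lambda>l. c (j, l))) = 0 \<Longrightarrow> \<forall>j\<in>{1..n}. \<forall>l\<in>{1..r j}. c (j, l) = 0" for n
  proof (induction n)
    case (Suc n)
    let ?R = "\<Prod>j\<in>{1..n}. level_mon z j (\<lambda>l. c (j, l))"
    let ?S = "level_mon z (Suc n) (\<lambda>l. c (Suc n, l))"
    have n: "Suc n \<in> {1..t}" using Suc.prems by simp
    have R: "?R \<noteq> 0" using level_mon_nz[OF B] Suc.prems(1) by simp
    have "level_mon z j (\<lambda>l. c (j, l)) \<noteq> 0 \<and> \<nu> (level_mon z j (\<lambda>l. c (j, l))) \<in> \<Gamma> n" if "j \<in> {1..n}" for j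
      using that lm[of j] level_mon_nz[OF B, of j] Suc.prems(1) chain_mono[of j n] by auto
    then have "\<nu> ?R \<in> \<Gamma> n" using Suc.prems(1) by (intro val_prod_mem chain_iso) auto
    moreover have "\<nu> (?R * ?S) = 0" using Suc.prems(2) by simp
    then have vs: "\<nu> ?S = - \<nu> ?R" using val_mult[OF R level_mon_nz[OF B n]] by (simp add: eq_neg_iff_add_eq_0 add.commute)
    ultimately have "\<nu> ?S \<in> \<Gamma> n" using iso_minus chain_iso Suc.prems(1) by simp
    then have z: "\<forall>l\<in>{1..r (Suc n)}. c (Suc n, l) = 0" using bases_indep[OF B n, of "\<lambda>l. c (Suc n, l)"] by simp
    then have "?S = 1" unfolding level_mon_def by simp
    then have "\<nu> ?R = 0" using vs by simp
    then show ?case using Suc.IH Suc.prems(1) z by (auto simp: le_Suc_eq)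
  qed simp
  then show ?thesis using v J_cases[OF p] unfolding laurent_levels by blast
qed

lemma laurent_val_zero: "bases z \<Longrightarrow> y \<in> laurent_monomials z \<Longrightarrow> \<nu> y = 0 \<Longrightarrow> y = 1"
proof -
  assume B: "bases z" and y: "y \<in> laurent_monomials z" "\<nu> y = 0"
  obtain c where c: "y = laurent z c" using y(1) unfolding laurent_monomials_def by blast
  then have "c p = 0" if "p \<in> J" for p using laurent_indep[OF B _ that] y(2) by simp
  then show "y = 1" unfolding c laurent_def by (intro prod.neutral) simp
qed

lemma monomials_laurent: "monomials z \<subseteq> laurent_monomials z" unfolding monomials_def laurent_monomials_def by blast

lemma monomials_one: "1 \<in> monomials z"
  unfolding monomials_def by (rule CollectI, rule exI[of _ "\<lambda>_. 0"]) (simp add: laurent_def)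

lemma monomials_times: "bases z \<Longrightarrow> x \<in> monomials z \<Longrightarrow> y \<in> monomials z \<Longrightarrow> x * y \<in> monomials z"
proof -
  assume B: "bases z" and "x \<in> monomials z" "y \<in> monomials z"
  then obtain c d where *: "x = laurent z c" "y = laurent z d" "\<forall>p\<in>J. 0 \<le> c p" "\<forall>p\<in>J. 0 \<le> d p" unfolding monomials_def by blast
  show "x * y \<in> monomials z" unfolding monomials_def
    by (rule CollectI, rule exI[of _ "\<lambda>p. c p + d p"]) (use * laurent_add[OF B] in auto)
qed

lemma laurent_divide: "bases z \<Longrightarrow> x \<in> laurent_monomials z \<Longrightarrow> y \<in> laurent_monomials z \<Longrightarrow> x / y \<in> laurent_monomials z"
proof -
  assume B: "bases z" and "x \<in> laurent_monomials z" "y \<in> laurent_monomials z"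
  then obtain c d where "x = laurent z c" "y = laurent z d" unfolding laurent_monomials_def by blast
  then have "x / y = laurent z (\<lambda>p. c p + - d p)" 
    using laurent_add[OF B, of c "\<lambda>p. - d p"] laurent_minus[of z d] by (simp add: field_class.field_divide_inverse)
  then show ?thesis unfolding laurent_monomials_def by blast
qed

lemma param_monomial: "p \<in> J \<Longrightarrow> z p \<in> monomials z"
  unfolding monomials_def by (rule CollectI, rule exI[of _ "\<lambda>q. if q = p then 1 else 0"]) (auto simp: laurent_single)

lemma monomial_exponents: assumes y: "y \<in> monomials z" obtains a :: "nat \<times> nat \<Rightarrow> nat" where "y = (\<Prod>p\<in>J. z p ^ a p)"
proof -
  obtain c where c: "y = laurent z c" "\<forall>p\<in>J. 0 \<le> c p" using y unfolding monomials_def by blast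
  then have "y = (\<Prod>p\<in>J. z p ^ nat (c p))" unfolding laurent_def by (auto intro!: prod.cong simp: power_int_def)
  then show ?thesis by (rule that)
qed

lemma monomials_framed: 
  assumes "framed A z" "y \<in> monomials z" shows "y \<in> A" "y \<noteq> 0" "0 \<le> \<nu> y"
proof -
  note A = framed_subring[OF assms(1)]
  obtain a where a: "y = (\<Prod>p\<in>J. z p ^ a p)" using monomial_exponents[OF assms(2)] .
  show "y \<in> A" unfolding a using framed_pos(2)[OF assms(1)] by (intro subring_prod[OF A] subring_power[OF A])
  then have "y \<in> val_ring \<nu>" using framed_V[OF assms(1)] by blast
  moreover have "y \<noteq> 0" using laurent_nz[OF framed_bases[OF assms(1)]] assms(2) unfolding monomials_def by auto
  ultimately show "y \<noteq> 0" "0 \<le> \<nu> y" by (auto simp: val_ring_def)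
qed

lemma prim_step_framed:
  assumes "framed A z" "prim_step (A, z) (A', z')"
  shows "framed A' z'" "A \<subseteq> A'" "laurent_monomials z \<subseteq> laurent_monomials z'" "monomials z \<subseteq> monomials z'"
proof -
  obtain p q where pq: "p \<in> J" "q \<in> J" "\<nu> (z q) < \<nu> (z p)" "z' = z(p := z p / z q)"
    "A' = localize (adjoin A {z p / z q}) (adjoin A {z p / z q} - val_ideal \<nu>)"
    using assms(2) unfolding prim_step_def by auto
  show "framed A' z'" "A \<subseteq> A'" using framed_transform[OF assms(1) pq(1,2,3,5)] pq(4) by auto
  have e: "laurent z c = laurent z' (c(q := c q + c p))" for c
    unfolding pq(4) using laurent_transform[OF framed_bases[OF assms(1)] pq(1,2)] pq(3) by blast
  then show "laurent_monomials z \<subseteq> laurent_monomials z'" unfolding laurent_monomials_def by blast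
  show "monomials z \<subseteq> monomials z'"
  proof
    fix y assume "y \<in> monomials z"
    then obtain c where c: "y = laurent z c" "\<forall>p\<in>J. 0 \<le> c p" unfolding monomials_def by blast
    then show "y \<in> monomials z'" unfolding monomials_def using e[of c] pq(1,2) 
      by (intro CollectI exI[of _ "c(q := c q + c p)"]) auto
  qed
qed

abbreviation prim_steps :: "'a set \<times> (nat \<times> nat \<Rightarrow> 'a) \<Rightarrow> 'a set \<times> (nat \<times> nat \<Rightarrow> 'a) \<Rightarrow> bool" where
  "prim_steps \<equiv> prim_step\<^sup>*\<^sup>*"

lemma prim_steps_framed:
  assumes "prim_steps (A, z) (A', z')" "framed A z"
  shows "framed A' z' \<and> A \<subseteq> A' \<and> laurent_monomials z \<subseteq> laurent_monomials z' \<and> monomials z \<subseteq> monomials z'"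
  using assms
proof (induction "(A', z')" arbitrary: A' z' rule: rtranclp_induct)
  case base then show ?case by simp
next
  case (step y)
  obtain A1 z1 where y: "y = (A1, z1)" by (cases y)
  have 1: "framed A1 z1 \<and> A \<subseteq> A1 \<and> laurent_monomials z \<subseteq> laurent_monomials z1 \<and> monomials z \<subseteq> monomials z1" 
    using step(3)[OF y step(4)] .
  have "prim_step (A1, z1) (A', z')" using step(2) y by simp
  from prim_step_framed[OF conjunct1[OF 1] this] 1 show ?case by blast
qed

lemma prim_step_exists:
  assumes F: "framed A z" and pq: "p \<in> J" "q \<in> J" "\<nu> (z q) < \<nu> (z p)"
  obtains A' where "prim_step (A, z) (A', z(p := z p / z q))"
  using assms unfolding prim_step_def by blast

text \<open>
  A step \<open>z\<^sub>p = z\<^sub>p' z\<^sub>q\<close> replaces the exponent of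
  \<open>z\<^sub>q\<close> by the sum of both exponents.  It is applied to a variable with the largest exponent and one with the
  smallest, in the order prescribed by their values: if the extreme exponents are \<open>a > 0 > - b\<close>, then one
  of them is replaced by \<open>a - b\<close>, which lies strictly between, so either the number of extreme exponents or
  the range of the exponents shrinks.  The exponents cannot all become nonpositive, as the value of the
  Laurent monomial is positive.
\<close>

lemma principalize_aux:
  assumes "framed A z" "0 < \<nu> (laurent z c)" "\<And>p. p \<in> J \<Longrightarrow> c p \<le> int a \<and> - int b \<le> c p"
  shows "\<exists>A' z'. prim_steps (A, z) (A', z') \<and> laurent z c \<in> monomials z'"
  using assms
proof (induction "(a + b) * (card J + 1) + card {p \<in> J. c p = int a \<or> c p = - int b}" arbitrary: A z c a b rule: less_induct)
  \<comment> \<open>The measure counts the range \<open>a + b\<close> first, then the exponents at its two ends, which are at most \<open>card J\<close> many.\<close>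
  case less
  note F = less.prems(1)
  have B: "bases z" using framed_bases[OF F] .
  let ?E = "\<lambda>c a b. {p \<in> J. c p = int a \<or> c p = - int b}"
  have cE: "card (?E c a b) \<le> card J" for c a b using finite_J by (intro card_mono) auto
  consider "b = 0" | "a = 0" | "b > 0" "\<forall>q\<in>J. c q \<noteq> - int b" | "a > 0" "\<forall>p\<in>J. c p \<noteq> int a" 
    | p q where "a > 0" "b > 0" "p \<in> J" "q \<in> J" "c p = int a" "c q = - int b"
    using neq0_conv by metis
  then show ?case
  proof cases
    case 1
    then have "laurent z c \<in> monomials z" unfolding monomials_def using less.prems(3) by auto
    then show ?thesis by blast
  next
    case 2
    then have "\<forall>p\<in>J. 0 \<le> - c p" using less.prems(3) by simp
    then have "laurent z (\<lambda>p. - c p) \<in> monomials z" unfolding monomials_def by (intro CollectI exI[of _ "\<lambda>p. - c p"]) simp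
    then have "0 \<le> \<nu> (laurent z (\<lambda>p. - c p))" using monomials_framed[OF F] by blast
    then have False using less.prems(2) val_inverse[OF laurent_nz[OF B]] by (simp add: laurent_minus)
    then show ?thesis ..
  next
    case 3
    then obtain b' where b': "b = Suc b'" by (cases b) auto
    have "(a + b') * (card J + 1) + card (?E c a b') < (a + b) * (card J + 1) + card (?E c a b)"
      using cE[of c a b'] by (simp add: b')
    moreover have "c p \<le> int a \<and> - int b' \<le> c p" if "p \<in> J" for p using less.prems(3)[OF that] 3 that b' by force
    ultimately show ?thesis using less.hyps[OF _ F less.prems(2)] by blast
  next
    case 4
    then obtain a' where a': "a = Suc a'" by (cases a) auto
    have "(a' + b) * (card J + 1) + card (?E c a' b) < (a + b) * (card J + 1) + card (?E c a b)"
      using cE[of c a' b] by (simp add: a')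
    moreover have "c p \<le> int a' \<and> - int b \<le> c p" if "p \<in> J" for p using less.prems(3)[OF that] 4 that a' by force
    ultimately show ?thesis using less.hyps[OF _ F less.prems(2)] by blast
  next
    case 5
    have step: ?thesis if xy: "x \<in> J" "y \<in> J" "\<nu> (z y) < \<nu> (z x)" "x \<noteq> y" "c y = int a \<or> c y = - int b" "c y + c x = int a - int b" for x y
    proof -
      obtain A' where A': "prim_step (A, z) (A', z(x := z x / z y))" using prim_step_exists[OF F xy(1-3)] .
      define c' where "c' = c(y := c y + c x)"
      have e: "laurent z c = laurent (z(x := z x / z y)) c'" unfolding c'_def using laurent_transform[OF B xy(1,2,4)] .
      have F': "framed A' (z(x := z x / z y))" using prim_step_framed[OF F A'] by blast
      have "?E c' a b \<subseteq> ?E c a b - {y}" using xy 5 by (auto simp: c'_def)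
      moreover have "y \<in> ?E c a b" using xy by simp
      ultimately have "?E c' a b \<subset> ?E c a b" by blast
      then have "card (?E c' a b) < card (?E c a b)" using finite_J by (intro psubset_card_mono) auto
      then have m: "(a + b) * (card J + 1) + card (?E c' a b) < (a + b) * (card J + 1) + card (?E c a b)" by simp
      have "c' p \<le> int a \<and> - int b \<le> c' p" if "p \<in> J" for p 
        using less.prems(3)[OF that] xy(6) by (auto simp: c'_def)
      then obtain A'' z'' where "prim_steps (A', z(x := z x / z y)) (A'', z'')" "laurent z c \<in> monomials z''"
        using less.hyps[OF m F' less.prems(2)[unfolded e]] unfolding e by blast
      then show ?thesis using converse_rtranclp_into_rtranclp[of prim_step, OF A'] by blast
    qed
    have pq: "p \<noteq> q" using 5 by auto
    then have "\<nu> (z p) \<noteq> \<nu> (z q)" using bases_val_inj[OF B 5(3,4)] by blast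
    then consider "\<nu> (z q) < \<nu> (z p)" | "\<nu> (z p) < \<nu> (z q)" using linorder_neqE by blast
    then show ?thesis
    proof cases
      case 1 then show ?thesis using step[of p q] 5 pq by simp
    next
      case 2 then show ?thesis using step[of q p] 5 pq by simp
    qed
  qed
qed

lemma principalize_one:
  assumes F: "framed A z" and y: "y \<in> laurent_monomials z" "0 \<le> \<nu> y"
  shows "\<exists>A' z'. prim_steps (A, z) (A', z') \<and> y \<in> monomials z'"
proof (cases "\<nu> y = 0")
  case True
  then have "y \<in> monomials z" using laurent_val_zero[OF framed_bases[OF F] y(1)] monomials_one by simp
  then show ?thesis by blast
next
  case False
  obtain c where c: "y = laurent z c" using y(1) unfolding laurent_monomials_def by blast
  define a where "a = nat (\<Sum>p\<in>J. \<bar>c p\<bar>)"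
  have "c p \<le> int a \<and> - int a \<le> c p" if "p \<in> J" for p
  proof -
    have "\<bar>c p\<bar> \<le> (\<Sum>p\<in>J. \<bar>c p\<bar>)" using finite_J that by (intro member_le_sum) auto
    then have "\<bar>c p\<bar> \<le> int a" unfolding a_def by simp
    then show ?thesis by linarith
  qed
  then show ?thesis using principalize_aux[OF F, of c a a] y(2) False c by auto
qed

lemma principalize:
  assumes F: "framed A z" and "finite Y" "Y \<subseteq> laurent_monomials z" "\<And>y. y \<in> Y \<Longrightarrow> 0 \<le> \<nu> y"
  shows "\<exists>A' z'. prim_steps (A, z) (A', z') \<and> Y \<subseteq> monomials z'"
  using assms(2-)
proof (induction Y)
  case empty then show ?case by blast
next
  case (insert y Y)
  then obtain A1 z1 where 1: "prim_steps (A, z) (A1, z1)" "Y \<subseteq> monomials z1" by auto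
  note F1 = prim_steps_framed[OF 1(1) F]
  have "y \<in> laurent_monomials z1" using F1 insert.prems(1) by blast
  then obtain A2 z2 where 2: "prim_steps (A1, z1) (A2, z2)" "y \<in> monomials z2" 
    using principalize_one[OF conjunct1[OF F1]] insert.prems(2) by blast
  have "monomials z1 \<subseteq> monomials z2" using prim_steps_framed[OF 2(1)] F1 by blast
  then show ?case using 1 2 rtranclp_trans[OF 1(1) 2(1)] by blast
qed

text \<open>
  Divide by the initial monomial of level \<open>j\<close>.  All other terms of the expansion are multiples of
  Laurent monomials in \<open>P\<^sub>j\<close>, which are turned into monomials; the cofactor is then congruent
  modulo \<open>P\<^sub>j\<close> to a coefficient outside \<open>P\<^sub>j\<close>.
\<close>

lemma reduce_level:
  assumes F: "framed A z" and j: "j \<in> {1..t}" and g: "g \<in> A" "g \<notin> PP (Suc j)"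
  shows "\<exists>A' z' \<mu> g'. prim_steps (A, z) (A', z') \<and> \<mu> \<in> monomials z' \<and> g' \<in> A' \<and> g' \<notin> PP j \<and> g = \<mu> * g'"
proof -
  interpret L: valuation_level \<nu> A "\<Gamma> (j - 1)" "\<Gamma> j" "{1..r j}" "\<lambda>l. z (j, l)" by (rule framed_level[OF F j])
  have B: "bases z" using framed_bases[OF F] .
  have iso: "isolated (\<Gamma> (j - 1))" "isolated (\<Gamma> j)" using L.isoH L.isoG by auto
  obtain m u where m: "m \<in> L.expo" "u \<in> A - PP j" "g - u * L.mon m \<in> L.mono_ideal {m' \<in> L.expo. L.w m < L.w m'}"
    using L.initial_form_of_element[OF g(1)] g(2) by auto
  define E where "E = {m' \<in> L.expo. L.w m < L.w m'}"
  define W where "W = L.mon ` E \<union> z ` {p \<in> J. Suc j \<le> fst p}"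
  have "L.mono_ideal E = lspan A W" unfolding L.mono_ideal_def W_def
    using framed_gens[OF F, of "Suc j"] j lspan_lspan_union[OF framed_subring[OF F]] by simp
  then have "g - u * L.mon m \<in> lspan A W" using m(3) by (simp add: E_def)
  then obtain Y where Y: "finite Y" "Y \<subseteq> W" "g - u * L.mon m \<in> lspan A Y" 
    using lspan_finite[OF framed_subring[OF F]] by blast
  have lmon: "L.mon n \<in> monomials z" for n
  proof -
    have "L.mon n = laurent z (\<lambda>(i, l). if i = j then int (n l) else 0)"
    proof -
      have "laurent z (\<lambda>(i, l). if i = j then int (n l) else 0) = (\<Prod>i\<in>{1..t}. if i = j then L.mon n else 1)"
        unfolding laurent_levels level_mon_def L.mon_def by (rule prod.cong) auto
      then show ?thesis using j by simp
    qed
    then show ?thesis unfolding monomials_def by (intro CollectI exI conjI) auto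
  qed
  have wv: "L.w m \<in> value_group \<nu>" using value_groupI L.mon_nz by blast
  have pos: "y / L.mon m \<in> laurent_monomials z \<and> y / L.mon m \<in> PP j" if y: "y \<in> W" for y
  proof -
    have nz: "y \<noteq> 0" and lm: "y \<in> monomials z" using y lmon param_monomial L.mon_nz bases_J(1)[OF B] unfolding W_def by auto
    have v: "\<nu> (y / L.mon m) = \<nu> y - L.w m" using val_divide nz L.mon_nz by blast
    have "L.w m < \<nu> y \<and> \<nu> y - L.w m \<notin> \<Gamma> (j - 1)"
    proof (cases "y \<in> L.mon ` E")
      case True
      then obtain m' where m': "m' \<in> L.expo" "y = L.mon m'" "L.w m < L.w m'" unfolding E_def by blast
      then have "m' \<noteq> m" by auto
      then show ?thesis using L.w_inj[OF m'(1) m(1)] m' by auto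
    next
      case False
      then obtain p where p: "p \<in> J" "Suc j \<le> fst p" "y = z p" using y unfolding W_def by blast
      have "fst p - 1 \<le> t" using J_cases[OF p(1)] by auto
      then have "\<Gamma> j \<subseteq> \<Gamma> (fst p - 1)" using p(2) by (intro chain_mono) auto
      then have n: "\<nu> y \<notin> \<Gamma> j" using bases_notin[OF B p(1)] p(3) by auto
      have "0 \<le> \<nu> y" using framed_pos(1)[OF F p(1)] p(3) by simp
      then have "\<not> \<nu> y \<le> L.w m" using iso_convex[OF iso(2) L.w_G value_groupI[OF nz]] n by blast
      moreover have "\<nu> y - L.w m \<notin> \<Gamma> j" using iso_add[OF iso(2) _ L.w_G, of "\<nu> y - L.w m" m] n by auto
      ultimately show ?thesis using L.HG by auto
    qed
    then have "y / L.mon m \<in> PP j" using v by (simp add: above_def)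
    moreover have "y / L.mon m \<in> laurent_monomials z" using laurent_divide[OF B] lm lmon monomials_laurent by blast
    ultimately show ?thesis by blast
  qed
  \<comment> \<open>The finitely many Laurent monomials that have to become monomials.\<close>
  define Y' where "Y' = (\<lambda>y. y / L.mon m) ` Y"
  have "finite Y'" "Y' \<subseteq> laurent_monomials z" using Y pos unfolding Y'_def by auto
  moreover have "0 \<le> \<nu> y" if y: "y \<in> Y'" for y
  proof -
    obtain x where x: "x \<in> W" "y = x / L.mon m" using y Y(2) unfolding Y'_def by blast
    have "x \<noteq> 0" using x(1) lmon param_monomial L.mon_nz bases_J(1)[OF B] unfolding W_def by auto
    then show ?thesis using pos[OF x(1)] x(2) L.mon_nz by (auto simp: above_def)
  qed
  ultimately obtain A' z' where A': "prim_steps (A, z) (A', z')" "Y' \<subseteq> monomials z'" using principalize[OF F] by blast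
  have F': "framed A' z'" "A \<subseteq> A'" "monomials z \<subseteq> monomials z'" using prim_steps_framed[OF A'(1) F] by auto
  have jt: "j \<in> {1..Suc t}" using j by auto
  have Pp: "is_prime (val_ring \<nu>) (PP j)" using PP_prime[OF jt] .
  have Pid: "is_prime A' (PP j \<inter> A')" using contract_val_prime[OF framed_subring[OF F'(1)] framed_V[OF F'(1)] iso(1)] .
  have "(g - u * L.mon m) / L.mon m \<in> PP j \<inter> A'"
    using Y(3)
  proof (induction)
    case lspan_zero then show ?case using ideal_zero[OF prime_ideal[OF Pid]] by simp
  next
    case (lspan_step a x y)
    have "x / L.mon m \<in> Y'" unfolding Y'_def using lspan_step(2) by (rule imageI)
    then have "x / L.mon m \<in> PP j \<inter> A'" using pos[of x] lspan_step(2) Y(2) A'(2) monomials_framed(1)[OF F'(1)] by blast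
    then have "a * (x / L.mon m) + y / L.mon m \<in> PP j \<inter> A'"
      using lspan_step F'(2) ideal_add[OF prime_ideal[OF Pid]] ideal_mult[OF prime_ideal[OF Pid]] by blast
    then show ?case by (simp add: add_divide_distrib)
  qed
  then have e: "g / L.mon m - u \<in> PP j \<inter> A'" using L.mon_nz by (simp add: diff_divide_distrib)
  have uA: "u \<in> A'" using m(2) F'(2) by blast
  have gA: "(g / L.mon m - u) + u \<in> A'" using e uA subring_add[OF framed_subring[OF F'(1)]] by blast
  have "g / L.mon m \<notin> PP j"
  proof
    assume "g / L.mon m \<in> PP j"
    then have "g / L.mon m - (g / L.mon m - u) \<in> PP j" using e ideal_diff[OF val_ring_subring prime_ideal[OF Pp]] by blast
    then show False using m(2) by simp
  qed
  moreover have "g = L.mon m * (g / L.mon m)" using L.mon_nz by simp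
  moreover have "L.mon m \<in> monomials z'" using lmon F'(3) by blast
  moreover have "g / L.mon m \<in> A'" using gA by simp
  ultimately show ?thesis using A'(1) by blast
qed

theorem monomialize:
  assumes F: "framed A z" and f: "f \<in> A" "f \<noteq> 0"
  shows "\<exists>A' z' \<mu> u. prim_steps (A, z) (A', z') \<and> \<mu> \<in> monomials z' \<and> u \<in> A' \<and> u \<noteq> 0 \<and> \<nu> u = 0 \<and> f = \<mu> * u"
proof -
  have "d \<le> t \<Longrightarrow> \<exists>A' z' \<mu> g. prim_steps (A, z) (A', z') \<and> \<mu> \<in> monomials z' \<and> g \<in> A' \<and> g \<notin> PP (Suc t - d) \<and> f = \<mu> * g" for d
  proof (induction d)
    case 0
    have "f \<notin> PP (Suc t - 0)" using PP_top f by simp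
    then show ?case using monomials_one f(1) by (intro exI[of _ A] exI[of _ z] exI[of _ 1] exI[of _ f]) auto
  next
    case (Suc d)
    then obtain A1 z1 \<mu> g where 1: "prim_steps (A, z) (A1, z1)" "\<mu> \<in> monomials z1" "g \<in> A1" "g \<notin> PP (Suc t - d)" "f = \<mu> * g" by auto
    note F1 = prim_steps_framed[OF 1(1) F]
    let ?j = "Suc t - Suc d"
    have "?j \<in> {1..t}" "Suc t - d = Suc ?j" using Suc.prems by auto
    then obtain A2 z2 \<mu>' g' where 2: "prim_steps (A1, z1) (A2, z2)" "\<mu>' \<in> monomials z2" "g' \<in> A2" "g' \<notin> PP ?j" "g = \<mu>' * g'"
      using reduce_level[OF conjunct1[OF F1] _ 1(3), of ?j] 1(4) by metis
    note F2 = prim_steps_framed[OF 2(1) conjunct1[OF F1]]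
    have "\<mu> * \<mu>' \<in> monomials z2" using monomials_times[OF framed_bases[OF conjunct1[OF F2]]] F2 1(2) 2(2) by blast
    moreover have "f = (\<mu> * \<mu>') * g'" using 1(5) 2(5) by simp
    ultimately show ?case using rtranclp_trans[OF 1(1) 2(1)] 2(3,4) by blast
  qed
  from this[of t] obtain A1 z1 \<mu> g where 1: "prim_steps (A, z) (A1, z1)" "\<mu> \<in> monomials z1" "g \<in> A1" "g \<notin> PP 1" "f = \<mu> * g" by auto
  have "g \<in> val_ring \<nu>" using prim_steps_framed[OF 1(1) F] framed_V 1(3) by blast
  then have "g \<noteq> 0 \<and> \<nu> g = 0" using not_val_prime[OF iso_triv, of g] 1(4) PP_one val_ideal_eq by auto
  then show ?thesis using 1 by blast
qed

lemma monomialize_all: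
  assumes F: "framed A z" and "finite W" "W \<subseteq> A - {0}"
  shows "\<exists>A' z'. prim_steps (A, z) (A', z') \<and> (\<forall>f\<in>W. \<exists>\<mu>\<in>monomials z'. \<exists>u\<in>A'. u \<noteq> 0 \<and> \<nu> u = 0 \<and> f = \<mu> * u)"
  using assms(2-)
proof (induction W)
  case empty then show ?case by blast
next
  case (insert f W)
  then obtain A1 z1 where 1: "prim_steps (A, z) (A1, z1)" "\<forall>f\<in>W. \<exists>\<mu>\<in>monomials z1. \<exists>u\<in>A1. u \<noteq> 0 \<and> \<nu> u = 0 \<and> f = \<mu> * u" by auto
  note F1 = prim_steps_framed[OF 1(1) F]
  have "f \<in> A1" "f \<noteq> 0" using F1 insert.prems by auto
  then obtain A2 z2 \<mu> u where 2: "prim_steps (A1, z1) (A2, z2)" "\<mu> \<in> monomials z2" "u \<in> A2" "u \<noteq> 0" "\<nu> u = 0" "f = \<mu> * u"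
    using monomialize[OF conjunct1[OF F1]] by metis
  have "monomials z1 \<subseteq> monomials z2" "A1 \<subseteq> A2" using prim_steps_framed[OF 2(1)] F1 by auto
  then have "\<forall>f\<in>W. \<exists>\<mu>\<in>monomials z2. \<exists>u\<in>A2. u \<noteq> 0 \<and> \<nu> u = 0 \<and> f = \<mu> * u" using 1(2) by blast
  then show ?case using rtranclp_trans[OF 1(1) 2(1)] 2 by blast
qed

text \<open>
  After monomializing generators and making the quotients by the monomial of least value genuine
  monomials, the generator with that monomial divides all others.
\<close>

theorem principalize_ideal:
  assumes F: "framed A z" and I: "is_ideal A I" "I \<noteq> {0}"
  shows "\<exists>A' z' \<mu>. prim_steps (A, z) (A', z') \<and> \<mu> \<in> monomials z' \<and> lspan A' I = lspan A' {\<mu>}"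
proof -
  note A = framed_subring[OF F]
  obtain W0 where W0: "finite W0" "W0 \<subseteq> I" "I = lspan A W0" using noeth_fg[OF framed_noeth[OF F] I(1)] .
  define W where "W = W0 - {0}"
  have W: "finite W" "W \<subseteq> A - {0}" using W0 ideal_sub[OF I(1)] unfolding W_def by auto
  have "I \<subseteq> lspan A W" unfolding W0(3)
  proof (rule lspan_least[OF lspan_submodule[OF A]])
    show "W0 \<subseteq> lspan A W" using lspan_superset[OF A, of _ W] lspan_zero[of A W] unfolding W_def by blast
  qed
  have "W \<noteq> {}"
  proof
    assume "W = {}"
    then have "I \<subseteq> lspan A {}" using \<open>I \<subseteq> lspan A W\<close> by simp
    also have "\<dots> \<subseteq> {0}" by (rule lspan_least) (auto simp: submodule_of_def)
    finally show False using I ideal_zero[OF I(1)] by blast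
  qed
  obtain A1 z1 where 1: "prim_steps (A, z) (A1, z1)" "\<forall>f\<in>W. \<exists>\<mu>\<in>monomials z1. \<exists>u\<in>A1. u \<noteq> 0 \<and> \<nu> u = 0 \<and> f = \<mu> * u" 
    using monomialize_all[OF F W] by blast
  have F1: "framed A1 z1" using prim_steps_framed[OF 1(1) F] by blast
  obtain \<mu> u where mu: "\<And>f. f \<in> W \<Longrightarrow> \<mu> f \<in> monomials z1" "\<And>f. f \<in> W \<Longrightarrow> u f \<in> A1 \<and> u f \<noteq> 0 \<and> \<nu> (u f) = 0" 
    "\<And>f. f \<in> W \<Longrightarrow> f = \<mu> f * u f" using 1(2) by metis
  have "\<exists>f. is_arg_min (\<lambda>f. \<nu> (\<mu> f)) (\<lambda>f. f \<in> W) f" by (rule ex_is_arg_min_if_finite[OF W(1) \<open>W \<noteq> {}\<close>])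
  then obtain f0 where f0: "f0 \<in> W" "\<And>f. f \<in> W \<Longrightarrow> \<nu> (\<mu> f0) \<le> \<nu> (\<mu> f)" unfolding is_arg_min_linorder by blast
  define Y where "Y = (\<lambda>f. \<mu> f / \<mu> f0) ` W"
  have nz: "\<mu> f \<noteq> 0" if "f \<in> W" for f using monomials_framed(2)[OF F1] mu(1)[OF that] by blast
  have "finite Y" using W(1) unfolding Y_def by simp
  moreover have "\<mu> f / \<mu> f0 \<in> laurent_monomials z1" if "f \<in> W" for f
    using laurent_divide[OF framed_bases[OF F1]] mu(1)[OF that] mu(1)[OF f0(1)] monomials_laurent by blast
  then have "Y \<subseteq> laurent_monomials z1" unfolding Y_def by blast
  moreover have "0 \<le> \<nu> y" if "y \<in> Y" for y
    using that f0 nz val_divide unfolding Y_def by auto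
  ultimately obtain A2 z2 where 2: "prim_steps (A1, z1) (A2, z2)" "Y \<subseteq> monomials z2" using principalize[OF F1] by metis
  have F2: "framed A2 z2" "A1 \<subseteq> A2" "monomials z1 \<subseteq> monomials z2" using prim_steps_framed[OF 2(1) F1] by auto
  have AA: "A \<subseteq> A2" using prim_steps_framed[OF 1(1) F] F2 by blast
  note A2 = framed_subring[OF F2(1)]
  have "lspan A2 I \<subseteq> lspan A2 {\<mu> f0}"
  proof (rule lspan_least[OF lspan_submodule[OF A2]])
    have "f \<in> lspan A2 {\<mu> f0}" if f: "f \<in> W" for f
    proof -
      have "\<mu> f / \<mu> f0 \<in> A2" using monomials_framed(1)[OF F2(1)] 2(2) f unfolding Y_def by blast
      moreover have "u f \<in> A2" using mu(2)[OF f] F2(2) by blast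
      ultimately have "(\<mu> f / \<mu> f0 * u f) * \<mu> f0 + 0 \<in> lspan A2 {\<mu> f0}" 
        by (intro lspan_step lspan_zero subring_mult[OF A2]) auto
      moreover have "(\<mu> f / \<mu> f0 * u f) * \<mu> f0 + 0 = f" using mu(3)[OF f] nz[OF f0(1)] by simp
      ultimately show ?thesis by simp
    qed
    then have "lspan A W \<subseteq> lspan A2 {\<mu> f0}"
      using lspan_submodule[OF A2, of "{\<mu> f0}"] AA by (intro lspan_least) (auto simp: submodule_of_def)
    then show "I \<subseteq> lspan A2 {\<mu> f0}" using \<open>I \<subseteq> lspan A W\<close> by blast
  qed
  moreover have "lspan A2 {\<mu> f0} \<subseteq> lspan A2 I"
  proof (rule lspan_least[OF lspan_submodule[OF A2]])
    have "f0 \<in> I" using f0(1) W0(2) unfolding W_def by blast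
    moreover have "inverse (u f0) \<in> A2" using framed_inverse[OF F2(1)] mu(2)[OF f0(1)] F2(2) by blast
    ultimately have "inverse (u f0) * f0 + 0 \<in> lspan A2 I" by (intro lspan_step lspan_zero)
    moreover have "inverse (u f0) * f0 + 0 = \<mu> f0" using mu(2,3)[OF f0(1)] by (metis add.right_neutral mult.left_commute mult.right_neutral left_inverse)
    ultimately show "{\<mu> f0} \<subseteq> lspan A2 I" by simp
  qed
  moreover have "\<mu> f0 \<in> monomials z2" using mu(1)[OF f0(1)] F2(3) by blast
  ultimately show ?thesis using rtranclp_trans[OF 1(1) 2(1)] by blast
qed

theorem monomialize_fraction:
  assumes F: "framed A z" and g: "g \<in> A" "h \<in> A" "h \<noteq> 0" and f: "f = g / h" "f \<noteq> 0" "0 \<le> \<nu> f"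
  shows "\<exists>A' z' \<mu> u. prim_steps (A, z) (A', z') \<and> \<mu> \<in> monomials z' \<and> u \<in> A' \<and> u \<noteq> 0 \<and> \<nu> u = 0 \<and> f = \<mu> * u"
proof -
  have g0: "g \<noteq> 0" using f by auto
  obtain A1 z1 where 1: "prim_steps (A, z) (A1, z1)" "\<forall>f\<in>{g, h}. \<exists>\<mu>\<in>monomials z1. \<exists>u\<in>A1. u \<noteq> 0 \<and> \<nu> u = 0 \<and> f = \<mu> * u" 
    using monomialize_all[OF F, of "{g, h}"] g g0 by blast
  have F1: "framed A1 z1" using prim_steps_framed[OF 1(1) F] by blast
  obtain \<mu> u \<mu>' u' where *: "\<mu> \<in> monomials z1" "u \<in> A1" "u \<noteq> 0" "\<nu> u = 0" "g = \<mu> * u" 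
    "\<mu>' \<in> monomials z1" "u' \<in> A1" "u' \<noteq> 0" "\<nu> u' = 0" "h = \<mu>' * u'" using 1(2) by auto
  have nz: "\<mu> \<noteq> 0" "\<mu>' \<noteq> 0" using monomials_framed(2)[OF F1] * by auto
  have fe: "f = (\<mu> / \<mu>') * (u / u')" using f(1) * by simp
  have "\<nu> (u / u') = 0" using val_divide * by simp
  then have "\<nu> f = \<nu> (\<mu> / \<mu>')" unfolding fe using val_mult[of "\<mu> / \<mu>'" "u / u'"] nz *(3,8) by simp
  moreover have "\<mu> / \<mu>' \<in> laurent_monomials z1" using laurent_divide[OF framed_bases[OF F1]] * monomials_laurent by blast
  ultimately obtain A2 z2 where 2: "prim_steps (A1, z1) (A2, z2)" "\<mu> / \<mu>' \<in> monomials z2" using principalize_one[OF F1] f(3) by metis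
  have F2: "framed A2 z2" "A1 \<subseteq> A2" using prim_steps_framed[OF 2(1) F1] by auto
  have "u / u' \<in> A2" using subring_mult[OF framed_subring[OF F2(1)], of u "inverse u'"] framed_inverse[OF F2(1), of u'] * F2(2)
    by (auto simp: field_class.field_divide_inverse)
  then show ?thesis using rtranclp_trans[OF 1(1) 2(1)] 2(2) fe \<open>\<nu> (u / u') = 0\<close> *(3,8) 
    by (intro exI[of _ A2] exI[of _ z2] exI[of _ "\<mu> / \<mu>'"] exI[of _ "u / u'"]) auto
qed

end

section \<open>Subrings of a field and their quotients as HOL-Algebra rings\<close>

lemma ring_on_simps [simp]:
  "carrier (ring_on A) = A" "monoid.mult (ring_on A) = (*)" "one (ring_on A) = 1"
  "ring.zero (ring_on A) = 0" "add (ring_on A) = (+)"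
  by (simp_all add: ring_of_type_algebra_def)

lemma ring_on_cring: 
  assumes "is_subring A" shows "cring (ring_on A)"
proof -
  interpret cring "ring_of_type_algebra :: 'a ring" by (rule cring_from_type_algebra)
  have "subcring A (ring_of_type_algebra :: 'a ring)"
    by (rule subcringI') (use assms in \<open>simp add: subring_iff_is_subring\<close>)
  then show ?thesis using subcring_iff[of A] by simp
qed

lemma ring_on_a_inv: "is_subring A \<Longrightarrow> a \<in> A \<Longrightarrow> \<ominus>\<^bsub>ring_on A\<^esub> a = - a"
proof -
  assume A: "is_subring A" and a: "a \<in> A"
  interpret cring "ring_on A" by (rule ring_on_cring[OF A])
  show ?thesis using minus_equality[of "- a" a] a subring_minus[OF A] by simp
qed

lemma ideal_iff:
  assumes A: "is_subring A" shows "ideal I (ring_on A) \<longleftrightarrow> is_ideal A I"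
proof
  interpret cring "ring_on A" by (rule ring_on_cring[OF A])
  show "is_ideal A I" if "ideal I (ring_on A)"
  proof -
    interpret I: ideal I "ring_on A" by fact
    show ?thesis unfolding is_ideal_def submodule_of_def
      using I.zero_closed I.a_closed I.I_l_closed I.a_subset by auto
  qed
  show "ideal I (ring_on A)" if I: "is_ideal A I"
  proof (rule idealI)
    show "ring (ring_on A)" by (rule ring_axioms)
    show "subgroup I (add_monoid (ring_on A))"
    proof (rule add.subgroupI)
      show "I \<subseteq> carrier (ring_on A)" using ideal_sub[OF I] by auto
      show "I \<noteq> {}" using ideal_zero[OF I] by blast
      show "\<ominus>\<^bsub>ring_on A\<^esub> a \<in> I" if "a \<in> I" for a 
        using ring_on_a_inv[OF A] ideal_minus[OF A I that] ideal_sub[OF I that] by simp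
      show "a \<oplus>\<^bsub>ring_on A\<^esub> b \<in> I" if "a \<in> I" "b \<in> I" for a b using ideal_add[OF I that] by simp
    qed
  qed (use ideal_mult[OF I] ideal_mult2[OF I] in auto)
qed

lemma primeideal_iff:
  assumes A: "is_subring A" shows "primeideal p (ring_on A) \<longleftrightarrow> is_prime A p"
proof
  show "is_prime A p" if "primeideal p (ring_on A)"
  proof -
    interpret p: primeideal p "ring_on A" by fact
    have I: "is_ideal A p" using p.ideal_axioms ideal_iff[OF A] by simp
    have "1 \<notin> p" using p.I_notcarr ideal_one_eq[OF I] by auto
    then show ?thesis unfolding is_prime_def using I p.I_prime by auto
  qed
  show "primeideal p (ring_on A)" if p: "is_prime A p"
  proof (rule primeidealI)
    show "ideal p (ring_on A)" using prime_ideal[OF p] ideal_iff[OF A] by simp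
    show "cring (ring_on A)" by (rule ring_on_cring[OF A])
    show "carrier (ring_on A) \<noteq> p" using prime_one[OF p] subring_one[OF A] by auto
  qed (use prime_mult[OF p] in auto)
qed

lemma genideal_eq:
  assumes A: "is_subring A" and "W \<subseteq> A" shows "genideal (ring_on A) W = lspan A W"
  unfolding genideal_def
proof
  show "\<Inter>{I. ideal I (ring_on A) \<and> W \<subseteq> I} \<subseteq> lspan A W"
    using lspan_ideal[OF A assms(2)] lspan_superset[OF A] by (auto simp: ideal_iff[OF A])
  show "lspan A W \<subseteq> \<Inter>{I. ideal I (ring_on A) \<and> W \<subseteq> I}"
    using lspan_least[OF ideal_submodule] by (auto simp: ideal_iff[OF A])
qed

lemma noetherian_iff:
  assumes A: "is_subring A" shows "noetherian_ring (ring_on A) \<longleftrightarrow> noeth A"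
proof
  interpret cring "ring_on A" by (rule ring_on_cring[OF A])
  show "noeth A" if "noetherian_ring (ring_on A)"
  proof -
    interpret N: noetherian_ring "ring_on A" by fact
    show ?thesis unfolding noeth_def
    proof (intro conjI allI impI A)
      fix I assume "is_ideal A I"
      then obtain W where "W \<subseteq> A" "finite W" "I = genideal (ring_on A) W" 
        using N.finetely_gen[of I] ideal_iff[OF A] by auto
      then show "\<exists>W. finite W \<and> I = lspan A W" using genideal_eq[OF A] by blast
    qed
  qed
  show "noetherian_ring (ring_on A)" if N: "noeth A"
  proof (rule noetherian_ringI)
    fix I assume "ideal I (ring_on A)"
    then have I: "is_ideal A I" using ideal_iff[OF A] by simp
    obtain W where W: "finite W" "W \<subseteq> I" "I = lspan A W" using noeth_fg[OF N I] .
    then have "W \<subseteq> A" using ideal_sub[OF I] by blast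
    then show "\<exists>W\<subseteq>carrier (ring_on A). finite W \<and> I = genideal (ring_on A) W" using W genideal_eq[OF A] by auto
  qed
qed

definition is_maximal :: "'a::field set \<Rightarrow> 'a set \<Rightarrow> bool" where
  "is_maximal A M \<longleftrightarrow> is_ideal A M \<and> M \<noteq> A \<and> (\<forall>I. is_ideal A I \<longrightarrow> M \<subseteq> I \<longrightarrow> I = M \<or> I = A)"

lemma maximalideal_iff:
  assumes A: "is_subring A" shows "maximalideal M (ring_on A) \<longleftrightarrow> is_maximal A M"
proof
  show "is_maximal A M" if "maximalideal M (ring_on A)"
  proof -
    interpret M: maximalideal M "ring_on A" by fact
    have "I = M \<or> I = A" if "is_ideal A I" "M \<subseteq> I" for I
      using M.I_maximal[of I] that ideal_iff[OF A] ideal_sub[OF that(1)] by auto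
    then show ?thesis unfolding is_maximal_def using M.ideal_axioms M.I_notcarr ideal_iff[OF A] by auto
  qed
  show "maximalideal M (ring_on A)" if M: "is_maximal A M"
    by (rule maximalidealI) (use M in \<open>auto simp: is_maximal_def ideal_iff[OF A]\<close>)
qed

lemma local_maximal_unique:
  assumes L: "is_local A m" shows "is_maximal A M \<longleftrightarrow> M = m"
proof
  have m: "is_maximal A m" unfolding is_maximal_def
  proof (intro conjI allI impI)
    show "is_ideal A m" using local_ideal[OF L] .
    show "m \<noteq> A" using L subring_one[OF local_subring[OF L]] by (auto simp: is_local_def)
    fix I assume "is_ideal A I" "m \<subseteq> I"
    then show "I = m \<or> I = A" using local_proper_ideal[OF L, of I] ideal_one_eq[of A I] by blast
  qed
  show "is_maximal A M" if "M = m" using m that by simp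
  assume M: "is_maximal A M"
  then have i: "is_ideal A M" "M \<noteq> A" by (auto simp: is_maximal_def)
  then have "M \<subseteq> m" using local_proper_ideal[OF L, of M] ideal_one_eq[of A M] by blast
  then show "M = m" using M m by (auto simp: is_maximal_def)
qed

lemma local_ring_on:
  assumes L: "is_local A m" shows "local_ring (ring_on A)" "max_ideal (ring_on A) = m"
proof -
  have A: "is_subring A" using L local_subring by blast
  note * = maximalideal_iff[OF A] local_maximal_unique[OF L]
  show "local_ring (ring_on A)" unfolding local_ring_def using ring_on_cring[OF A] by (simp add: *)
  show "max_ideal (ring_on A) = m" unfolding max_ideal_def by (simp add: *)
qed

text \<open>
  A nonunit generates a proper ideal, which is contained in a maximal one.
\<close>

lemma local_ring_inverse:
  assumes N: "noeth A" and L: "local_ring (ring_on A)" and x: "x \<in> A" "x \<notin> max_ideal (ring_on A)" 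
  shows "inverse x \<in> A"
proof -
  have A: "is_subring A" using N noethD by blast
  have uniq: "\<exists>!M. is_maximal A M" using L unfolding local_ring_def maximalideal_iff[OF A] by blast
  have mx: "max_ideal (ring_on A) = (THE M. is_maximal A M)" unfolding max_ideal_def maximalideal_iff[OF A] ..
  have x0: "x \<noteq> 0"
  proof
    assume "x = 0"
    moreover have "is_maximal A (max_ideal (ring_on A))" unfolding mx by (rule theI'[OF uniq])
    ultimately show False using x ideal_zero unfolding is_maximal_def by blast
  qed
  let ?I = "lspan A {x}"
  have I: "is_ideal A ?I" using x by (intro lspan_ideal[OF A]) simp
  have "1 \<in> ?I"
  proof (rule ccontr)
    assume n: "1 \<notin> ?I"
    define C where "C = {K. is_ideal A K \<and> ?I \<subseteq> K \<and> 1 \<notin> K}"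
    have "C \<noteq> {}" "\<And>K. K \<in> C \<Longrightarrow> is_ideal A K" unfolding C_def using I n by auto
    then obtain M where M: "M \<in> C" "\<And>K. K \<in> C \<Longrightarrow> M \<subseteq> K \<Longrightarrow> K = M" using noeth_maximal[OF N, of C] by metis
    have "is_maximal A M" unfolding is_maximal_def
    proof (intro conjI allI impI)
      show "is_ideal A M" using M(1) C_def by blast
      show "M \<noteq> A" using M(1) subring_one[OF A] C_def by blast
      fix K assume "is_ideal A K" "M \<subseteq> K"
      then show "K = M \<or> K = A" using M ideal_one_eq[of A K] unfolding C_def by blast
    qed
    then have "max_ideal (ring_on A) = M" unfolding mx using uniq by (intro the1_equality)
    moreover have "x \<in> M" using M(1) lspan_superset[OF A, of x "{x}"] unfolding C_def by blast
    ultimately show False using x by blast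
  qed
  then obtain c where "c \<in> A" "1 = c * x + 0" unfolding lspan_insert[OF A] using lspan_least[of A "{0}" "{}"] 
    by (auto simp: submodule_of_def)
  then have "inverse x = c" using x0 by (simp add: inverse_unique mult.commute)
  then show ?thesis using \<open>c \<in> A\<close> by simp
qed

lemma Units_ring_on:
  assumes A: "is_subring A" shows "u \<in> Units (ring_on A) \<longleftrightarrow> u \<in> A \<and> u \<noteq> 0 \<and> inverse u \<in> A"
proof -
  have "x = inverse u" "u \<noteq> 0" if "x * u = 1" for x
    using that by (auto simp: inverse_unique mult.commute)
  then show ?thesis unfolding Units_def by (auto simp: mult.commute intro!: bexI[of _ "inverse u"])
qed

lemma krull_dim_ring_on:
  assumes A: "is_subring A" 
    and ex: "prime_chain_from A {0} n q" and ub: "\<And>d q. prime_chain_from A {0} d q \<Longrightarrow> d \<le> n"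
  shows "krull_dim (ring_on A) = enat n"
  unfolding krull_dim_def
proof (rule antisym)
  show "(SUP n \<in> {n. \<exists>p. (\<forall>i\<le>n. primeideal (p i) (ring_on A)) \<and> (\<forall>i<n. p i \<subset> p (Suc i))}. enat n) \<le> enat n"
  proof (rule SUP_least)
    fix d assume "d \<in> {n. \<exists>p. (\<forall>i\<le>n. primeideal (p i) (ring_on A)) \<and> (\<forall>i<n. p i \<subset> p (Suc i))}"
    then obtain p where p: "\<forall>i\<le>d. is_prime A (p i)" "\<forall>i<d. p i \<subset> p (Suc i)" unfolding primeideal_iff[OF A] by blast
    then have "prime_chain_from A {0} d p" unfolding prime_chain_from_def using ideal_zero[OF prime_ideal, of A "p 0"] by auto
    then show "enat d \<le> enat n" using ub by simp
  qed
  show "enat n \<le> (SUP n \<in> {n. \<exists>p. (\<forall>i\<le>n. primeideal (p i) (ring_on A)) \<and> (\<forall>i<n. p i \<subset> p (Suc i))}. enat n)"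
    by (rule SUP_upper) (use ex in \<open>auto simp: primeideal_iff[OF A] prime_chain_from_def\<close>)
qed

subsection \<open>Quotients\<close>

definition coset :: "'a::field set \<Rightarrow> 'a \<Rightarrow> 'a set" where
  "coset P a = {x + a | x. x \<in> P}"

lemma a_r_coset_ring_on: "P +>\<^bsub>ring_on A\<^esub> a = coset P a"
  by (auto simp: a_r_coset_def r_coset_def coset_def)

text \<open>
  The quotient \<open>D\<close> of a subring of the field by an ideal; its ideals are images of ideals above
  \<open>P\<close>, so that statements on \<open>D\<close> become statements on subsets of the field.
\<close>

locale subring_ideal =
  fixes A P :: "'a::field set"
  assumes subA: "is_subring A" and idP: "is_ideal A P"
begin

abbreviation D :: "'a set ring" where "D \<equiv> ring_on A Quot P"
abbreviation cl :: "'a \<Rightarrow> 'a set" where "cl \<equiv> coset P"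

sublocale R: cring "ring_on A" by (rule ring_on_cring[OF subA])
sublocale P: ideal P "ring_on A" using idP ideal_iff[OF subA] by simp

lemma cl_eq: "cl a = cl b \<longleftrightarrow> a - b \<in> P"
proof
  assume "cl a = cl b"
  then have "0 + a \<in> cl b" unfolding coset_def using ideal_zero[OF idP] by blast
  then show "a - b \<in> P" unfolding coset_def by (auto simp: diff_eq_eq)
next
  have *: "cl a \<subseteq> cl b" if ab: "a - b \<in> P" for a b
  proof
    fix y assume "y \<in> cl a"
    then obtain x where x: "x \<in> P" "y = x + a" unfolding coset_def by blast
    then have "y = (x + (a - b)) + b" "x + (a - b) \<in> P" using ideal_add[OF idP _ ab] by auto
    then show "y \<in> cl b" unfolding coset_def by blast
  qed
  assume ab: "a - b \<in> P"
  have "b - a \<in> P" using ideal_minus[OF subA idP ab] by simp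
  then show "cl a = cl b" using *[OF ab] *[of b a] by blast
qed

lemma carrier_D: "carrier D = cl ` A"
  unfolding FactRing_def A_RCOSETS_def' by (auto simp: a_r_coset_ring_on)

lemma mult_D: "a \<in> A \<Longrightarrow> b \<in> A \<Longrightarrow> cl a \<otimes>\<^bsub>D\<^esub> cl b = cl (a * b)"
  using P.rcoset_mult_add[of a b] by (simp add: FactRing_def a_r_coset_ring_on)

lemma add_D: "a \<in> A \<Longrightarrow> b \<in> A \<Longrightarrow> cl a \<oplus>\<^bsub>D\<^esub> cl b = cl (a + b)"
  using P.a_rcos_sum[of a b] by (simp add: FactRing_def a_r_coset_ring_on)

lemma one_D: "\<one>\<^bsub>D\<^esub> = cl 1" by (simp add: FactRing_def a_r_coset_ring_on)
lemma zero_D: "\<zero>\<^bsub>D\<^esub> = cl 0" by (simp add: FactRing_def coset_def)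

lemma ideal_D: "ideal K D \<longleftrightarrow> (\<exists>I. is_ideal A I \<and> P \<subseteq> I \<and> K = cl ` I)"
proof -
  have "(\<lambda>J. (+>\<^bsub>ring_on A\<^esub>) P ` J) ` {J. ideal J (ring_on A) \<and> P \<subseteq> J} = {J. ideal J D}"
    using R.quot_ideal_correspondence[OF P.ideal_axioms] unfolding bij_betw_def by blast
  moreover have "(+>\<^bsub>ring_on A\<^esub>) P = cl" by (rule ext) (rule a_r_coset_ring_on)
  ultimately have eq: "{J. ideal J D} = (`) cl ` {J. is_ideal A J \<and> P \<subseteq> J}" using ideal_iff[OF subA] by auto
  have "ideal K D \<longleftrightarrow> K \<in> {J. ideal J D}" by simp
  then show ?thesis unfolding eq by blast
qed

lemma cl_image_mem: "is_ideal A I \<Longrightarrow> P \<subseteq> I \<Longrightarrow> a \<in> A \<Longrightarrow> cl a \<in> cl ` I \<longleftrightarrow> a \<in> I"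
proof
  assume I: "is_ideal A I" "P \<subseteq> I" and "cl a \<in> cl ` I"
  then obtain b where b: "b \<in> I" "a - b \<in> P" using cl_eq by auto
  then have "(a - b) + b \<in> I" using I ideal_add[OF I(1)] by blast
  then show "a \<in> I" by simp
qed auto

lemma cl_image_subset: 
  assumes "is_ideal A I" "P \<subseteq> I" "is_ideal A K" "P \<subseteq> K" shows "cl ` I \<subseteq> cl ` K \<longleftrightarrow> I \<subseteq> K"
proof
  assume *: "cl ` I \<subseteq> cl ` K"
  show "I \<subseteq> K"
  proof
    fix x assume x: "x \<in> I"
    then have "cl x \<in> cl ` K" using * by blast
    then show "x \<in> K" using cl_image_mem[OF assms(3,4)] ideal_sub[OF assms(1) x] by blast
  qed
qed blast

lemma cring_D: "cring D" using P.quotient_is_cring R.cring_axioms by blast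

lemma primeideal_D: "primeideal K D \<longleftrightarrow> (\<exists>p. is_prime A p \<and> P \<subseteq> p \<and> K = cl ` p)"
proof
  assume "primeideal K D"
  then interpret K: primeideal K D .
  obtain p where p: "is_ideal A p" "P \<subseteq> p" "K = cl ` p" using K.ideal_axioms ideal_D by blast
  note mem = cl_image_mem[OF p(1,2)]
  have "1 \<notin> p"
  proof
    assume "1 \<in> p"
    then have "p = A" using ideal_one_eq[OF p(1)] by simp
    then show False using K.I_notcarr p(3) carrier_D by simp
  qed
  moreover have "a \<in> p \<or> b \<in> p" if "a \<in> A" "b \<in> A" "a * b \<in> p" for a b
    using K.I_prime[of "cl a" "cl b"] that mult_D[of a b] mem[of a] mem[of b] p(3) carrier_D by auto
  ultimately show "\<exists>p. is_prime A p \<and> P \<subseteq> p \<and> K = cl ` p" unfolding is_prime_def using p by blast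
next
  assume "\<exists>p. is_prime A p \<and> P \<subseteq> p \<and> K = cl ` p"
  then obtain p where p: "is_prime A p" "P \<subseteq> p" "K = cl ` p" by blast
  note mem = cl_image_mem[OF prime_ideal[OF p(1)] p(2)]
  show "primeideal K D"
  proof (rule primeidealI)
    show "ideal K D" using p prime_ideal ideal_D by blast
    show "cring D" by (rule cring_D)
    have "cl 1 \<notin> K" using mem[OF subring_one[OF subA]] prime_one[OF p(1)] p(3) by simp
    then show "carrier D \<noteq> K" using subring_one[OF subA] carrier_D by blast
    fix u v assume "u \<in> carrier D" "v \<in> carrier D" "u \<otimes>\<^bsub>D\<^esub> v \<in> K"
    then obtain a b where ab: "a \<in> A" "b \<in> A" "u = cl a" "v = cl b" "cl (a * b) \<in> K" using carrier_D mult_D by auto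
    then have "a * b \<in> p" using mem[OF subring_mult[OF subA ab(1,2)]] p(3) by simp
    then show "u \<in> K \<or> v \<in> K" using prime_mult[OF p(1) ab(1,2)] ab p(3) by blast
  qed
qed

lemma genideal_D:
  assumes "W \<subseteq> A" shows "genideal D (cl ` W) = cl ` lspan A (W \<union> P)"
proof -
  have sub: "W \<union> P \<subseteq> A" using assms ideal_sub[OF idP] by blast
  have I: "is_ideal A (lspan A (W \<union> P))" using lspan_ideal[OF subA sub] .
  have WP: "W \<subseteq> lspan A (W \<union> P)" "P \<subseteq> lspan A (W \<union> P)" using lspan_superset[OF subA] by blast+
  show ?thesis unfolding genideal_def
  proof
    show "\<Inter>{K. ideal K D \<and> cl ` W \<subseteq> K} \<subseteq> cl ` lspan A (W \<union> P)" using I WP ideal_D by blast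
    show "cl ` lspan A (W \<union> P) \<subseteq> \<Inter>{K. ideal K D \<and> cl ` W \<subseteq> K}"
    proof (rule Inter_greatest)
      fix K assume "K \<in> {K. ideal K D \<and> cl ` W \<subseteq> K}"
      then obtain I' where I': "is_ideal A I'" "P \<subseteq> I'" "K = cl ` I'" "cl ` W \<subseteq> K" using ideal_D[of K] by auto
      have "W \<subseteq> I'" using cl_image_mem[OF I'(1,2)] I'(3,4) assms by blast
      then have "lspan A (W \<union> P) \<subseteq> I'" using I' by (intro lspan_least ideal_submodule) auto
      then show "cl ` lspan A (W \<union> P) \<subseteq> K" using I'(3) by blast
    qed
  qed
qed

lemma noetherian_D: 
  assumes N: "noeth A" shows "noetherian_ring D"
proof (rule ring.noetherian_ringI)
  show "ring D" using cring_D cring.axioms(1) by blast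
  fix K assume "ideal K D"
  then obtain I where I: "is_ideal A I" "P \<subseteq> I" "K = cl ` I" using ideal_D by blast
  obtain W where W: "finite W" "W \<subseteq> I" "I = lspan A W" using noeth_fg[OF N I(1)] .
  have WA: "W \<subseteq> A" using W(2) ideal_sub[OF I(1)] by blast
  have "lspan A (W \<union> P) = I"
  proof
    show "lspan A (W \<union> P) \<subseteq> I" using W(2) I(2) by (intro lspan_least[OF ideal_submodule[OF I(1)]]) simp
    show "I \<subseteq> lspan A (W \<union> P)" unfolding W(3) by (rule lspan_mono[OF subA]) simp
  qed
  then have "K = genideal D (cl ` W)" using genideal_D[OF WA] I(3) by simp
  moreover have "cl ` W \<subseteq> carrier D" using WA carrier_D by blast
  ultimately show "\<exists>W\<subseteq>carrier D. finite W \<and> K = genideal D W" using W(1) by blast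
qed

lemma local_D:
  assumes L: "is_local A m" and "P \<subseteq> m" shows "local_ring D" "max_ideal D = cl ` m"
proof -
  note m = local_ideal[OF L]
  have mx: "maximalideal M D \<longleftrightarrow> M = cl ` m" for M
  proof
    have A: "is_ideal A A" "P \<subseteq> A" using ideal_sub[OF idP] subringD[OF subA] by (auto simp: is_ideal_def submodule_of_def)
    assume M: "maximalideal M D"
    then interpret M: maximalideal M D .
    obtain I where I: "is_ideal A I" "P \<subseteq> I" "M = cl ` I" using M.ideal_axioms ideal_D by blast
    have "1 \<notin> I" using ideal_one_eq[OF I(1)] M.I_notcarr I(3) carrier_D by auto
    then have "I \<subseteq> m" using local_proper_ideal[OF L I(1)] by blast
    then have "M \<subseteq> cl ` m" using I(3) by blast
    moreover have "ideal (cl ` m) D" using ideal_D[of "cl ` m"] m assms(2) by blast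
    moreover have "cl ` m \<subseteq> carrier D" unfolding carrier_D using ideal_sub[OF m] by blast
    ultimately have "cl ` m = M \<or> cl ` m = carrier D" using M.I_maximal by blast
    moreover have "cl ` m \<noteq> carrier D" 
      using cl_image_subset[OF A m assms(2)] carrier_D local_max_prime[OF L] subring_one[OF subA] by (auto simp: is_prime_def)
    ultimately show "M = cl ` m" by blast
  next
    assume M: "M = cl ` m"
    show "maximalideal M D"
    proof (rule maximalidealI)
      show "ideal M D" using M m assms(2) ideal_D by blast
      have "cl 1 \<notin> cl ` m" using cl_image_mem[OF m assms(2) subring_one[OF subA]] prime_one[OF local_max_prime[OF L]] by simp
      then show "carrier D \<noteq> M" using M carrier_D subring_one[OF subA] by blast
      fix K assume K: "ideal K D" "M \<subseteq> K" "K \<subseteq> carrier D"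
      obtain I where I: "is_ideal A I" "P \<subseteq> I" "K = cl ` I" using K(1) unfolding ideal_D by blast
      have "m \<subseteq> I" using cl_image_subset[OF m assms(2) I(1,2)] K(2) M I(3) by simp
      then have "I = m \<or> I = A" using local_proper_ideal[OF L I(1)] ideal_one_eq[OF I(1)] by blast
      then show "K = M \<or> K = carrier D" using I(3) M carrier_D by blast
    qed
  qed
  show "local_ring D" unfolding local_ring_def using cring_D mx by simp
  show "max_ideal D = cl ` m" unfolding max_ideal_def mx by simp
qed

lemma krull_dim_D:
  assumes ex: "prime_chain_from A P n q" and ub: "\<And>d q. prime_chain_from A P d q \<Longrightarrow> d \<le> n"
  shows "krull_dim D = enat n"
  unfolding krull_dim_def
proof (rule antisym)
  show "(SUP n \<in> {n. \<exists>p. (\<forall>i\<le>n. primeideal (p i) D) \<and> (\<forall>i<n. p i \<subset> p (Suc i))}. enat n) \<le> enat n"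
  proof (rule SUP_least)
    fix d assume "d \<in> {n. \<exists>p. (\<forall>i\<le>n. primeideal (p i) D) \<and> (\<forall>i<n. p i \<subset> p (Suc i))}"
    then obtain K where K: "\<forall>i\<le>d. primeideal (K i) D" "\<forall>i<d. K i \<subset> K (Suc i)" by blast
    have "\<exists>p. i \<le> d \<longrightarrow> is_prime A p \<and> P \<subseteq> p \<and> K i = cl ` p" for i 
      using K(1) primeideal_D[of "K i"] by (cases "i \<le> d") auto
    then obtain p where p: "\<And>i. i \<le> d \<Longrightarrow> is_prime A (p i) \<and> P \<subseteq> p i \<and> K i = cl ` p i" by metis
    have "p i \<subset> p (Suc i)" if i: "i < d" for i
    proof -
      have 1: "is_prime A (p i) \<and> P \<subseteq> p i \<and> K i = cl ` p i" "is_prime A (p (Suc i)) \<and> P \<subseteq> p (Suc i) \<and> K (Suc i) = cl ` p (Suc i)"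
        using p[of i] p[of "Suc i"] i by auto
      note 2 = prime_ideal[OF conjunct1[OF 1(1)]] prime_ideal[OF conjunct1[OF 1(2)]]
      have "K i \<subset> K (Suc i)" using K(2) i by simp
      then have "cl ` p i \<subseteq> cl ` p (Suc i)" "p i \<noteq> p (Suc i)" using 1 by auto
      moreover have "P \<subseteq> p i" "P \<subseteq> p (Suc i)" using 1 by auto
      ultimately show ?thesis using cl_image_subset[OF 2(1) _ 2(2)] by (simp add: psubset_eq)
    qed
    then have "prime_chain_from A P d p" unfolding prime_chain_from_def using p by simp
    then show "enat d \<le> enat n" using ub by simp
  qed
  have P: "P \<subseteq> q i" if "i \<le> n" for i
    using that
  proof (induction i)
    case 0 then show ?case using ex by (simp add: prime_chain_from_def)
  next
    case (Suc i)
    then have "q i \<subset> q (Suc i)" using ex by (simp add: prime_chain_from_def)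
    then show ?case using Suc by auto
  qed
  have "(\<forall>i\<le>n. primeideal (cl ` q i) D) \<and> (\<forall>i<n. cl ` q i \<subset> cl ` q (Suc i))"
  proof (intro conjI allI impI)
    show "primeideal (cl ` q i) D" if "i \<le> n" for i using P[OF that] ex that primeideal_D unfolding prime_chain_from_def by blast
    show "cl ` q i \<subset> cl ` q (Suc i)" if i: "i < n" for i
    proof -
      have *: "is_ideal A (q i)" "is_ideal A (q (Suc i))" "q i \<subset> q (Suc i)" 
        using ex i unfolding prime_chain_from_def by (auto intro: prime_ideal)
      show ?thesis using cl_image_subset[OF *(1) P *(2) P] cl_image_subset[OF *(2) P *(1) P] *(3) i 
        unfolding psubset_eq by (metis Suc_leI less_imp_le order_refl subset_antisym)
    qed
  qed
  then show "enat n \<le> (SUP n \<in> {n. \<exists>p. (\<forall>i\<le>n. primeideal (p i) D) \<and> (\<forall>i<n. p i \<subset> p (Suc i))}. enat n)"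
    by (intro SUP_upper CollectI exI[of _ "\<lambda>i. cl ` q i"])
qed

end

subsection \<open>The quotient field of the quotient by a prime\<close>

locale subring_prime = subring_ideal A P for A P :: "'a::field set" +
  assumes prP: "is_prime A P"
begin

definition fraction :: "'a \<Rightarrow> 'a \<Rightarrow> ('a set \<times> 'a set) set" where
  "fraction a b = frac_class D (cl a, cl b)"

lemma cl_zero_iff: "cl a = cl 0 \<longleftrightarrow> a \<in> P" using cl_eq[of a 0] by simp

lemma frac_pairs_D: "frac_pairs D = {(cl a, cl b) | a b. a \<in> A \<and> b \<in> A - P}"
  unfolding frac_pairs_def carrier_D zero_D using cl_zero_iff by blast

lemma fraction_mem: 
  assumes "a \<in> A" "b \<in> A" "c \<in> A" "d \<in> A - P" shows "(cl c, cl d) \<in> fraction a b \<longleftrightarrow> a * d - c * b \<in> P"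
proof -
  have "(cl c, cl d) \<in> frac_pairs D" using assms frac_pairs_D by blast
  then show ?thesis unfolding fraction_def frac_class_def using assms mult_D cl_eq by auto
qed

lemma fraction_subset: "fraction a b \<subseteq> frac_pairs D" unfolding fraction_def frac_class_def by blast

lemma fraction_eq: 
  assumes "a \<in> A" "b \<in> A - P" "c \<in> A" "d \<in> A - P" shows "fraction a b = fraction c d \<longleftrightarrow> a * d - c * b \<in> P"
proof
  assume eq: "fraction a b = fraction c d"
  have "(cl c, cl d) \<in> fraction c d" using fraction_mem[of c d c d] assms ideal_zero[OF idP] by simp
  then show "a * d - c * b \<in> P" using fraction_mem[of a b c d] assms eq by blast
next
  have *: "fraction a b \<subseteq> fraction c d" if "a * d - c * b \<in> P" "a \<in> A" "b \<in> A - P" "c \<in> A" "d \<in> A - P" for a b c d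
  proof
    fix u assume u: "u \<in> fraction a b"
    then obtain e f where ef: "u = (cl e, cl f)" "e \<in> A" "f \<in> A - P" using fraction_subset frac_pairs_D by blast
    have 1: "a * f - e * b \<in> P" using u fraction_mem[of a b e f] ef that by blast
    have "(c * f - e * d) * b = d * (a * f - e * b) - f * (a * d - c * b)" by (simp add: algebra_simps)
    moreover have "d * (a * f - e * b) - f * (a * d - c * b) \<in> P"
      by (rule ideal_diff[OF subA idP ideal_mult[OF idP _ 1] ideal_mult[OF idP _ that(1)]]) (use that ef in auto)
    ultimately have "(c * f - e * d) * b \<in> P" by simp
    moreover have "c * f - e * d \<in> A" "b \<in> A" using that ef subring_diff[OF subA] subring_mult[OF subA] by auto
    ultimately have "c * f - e * d \<in> P" using prime_mult[OF prP] that by blast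
    then show "u \<in> fraction c d" using fraction_mem[of c d e f] ef that by blast
  qed
  assume ad: "a * d - c * b \<in> P"
  have "c * b - a * d \<in> P" using ideal_minus[OF subA idP ad] by simp
  then show "fraction a b = fraction c d" using *[OF ad assms] *[of c b a d] assms by blast
qed

lemma carrier_QF: "carrier (quotient_field D) = {fraction a b | a b. a \<in> A \<and> b \<in> A - P}"
  unfolding quotient_field_def fraction_def frac_pairs_D by auto

lemma fraction_self: "a \<in> A \<Longrightarrow> b \<in> A - P \<Longrightarrow> (cl a, cl b) \<in> fraction a b"
  using fraction_mem[of a b a b] ideal_zero[OF idP] by simp

lemma not_P_mult: "b \<in> A - P \<Longrightarrow> d \<in> A - P \<Longrightarrow> b * d \<in> A - P"
  using prime_mult[OF prP] subring_mult[OF subA] by blast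

lemma mult_QF:
  assumes "a \<in> A" "b \<in> A - P" "c \<in> A" "d \<in> A - P"
  shows "fraction a b \<otimes>\<^bsub>quotient_field D\<^esub> fraction c d = fraction (a * c) (b * d)"
proof -
  have *: "frac_class D (fst p \<otimes>\<^bsub>D\<^esub> fst q, snd p \<otimes>\<^bsub>D\<^esub> snd q) = fraction (a * c) (b * d)" 
    if pq: "p \<in> fraction a b" "q \<in> fraction c d" for p q
  proof -
    obtain e f where ef: "p = (cl e, cl f)" "e \<in> A" "f \<in> A - P" using pq(1) fraction_subset frac_pairs_D by blast
    obtain g h where gh: "q = (cl g, cl h)" "g \<in> A" "h \<in> A - P" using pq(2) fraction_subset frac_pairs_D by blast
    have 1: "a * f - e * b \<in> P" "c * h - g * d \<in> P" using pq fraction_mem[of a b e f] fraction_mem[of c d g h] ef gh assms by auto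
    have "frac_class D (fst p \<otimes>\<^bsub>D\<^esub> fst q, snd p \<otimes>\<^bsub>D\<^esub> snd q) = fraction (e * g) (f * h)"
      unfolding fraction_def using ef gh mult_D by simp
    also have "\<dots> = fraction (a * c) (b * d)"
    proof (subst eq_commute, subst fraction_eq)
      have "(a * c) * (f * h) - (e * g) * (b * d) = (c * h) * (a * f - e * b) + (e * b) * (c * h - g * d)" by (simp add: algebra_simps)
      moreover have "(c * h) * (a * f - e * b) + (e * b) * (c * h - g * d) \<in> P"
        using 1 assms ef gh subring_mult[OF subA] by (intro ideal_add[OF idP] ideal_mult[OF idP]) auto
      ultimately show "(a * c) * (f * h) - (e * g) * (b * d) \<in> P" by simp
    qed (use assms ef gh subring_mult[OF subA] not_P_mult in auto)
    finally show ?thesis .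
  qed
  show ?thesis unfolding quotient_field_def using * fraction_self[OF assms(1,2)] fraction_self[OF assms(3,4)] by auto
qed

lemma add_QF:
  assumes "a \<in> A" "b \<in> A - P" "c \<in> A" "d \<in> A - P"
  shows "fraction a b \<oplus>\<^bsub>quotient_field D\<^esub> fraction c d = fraction (a * d + c * b) (b * d)"
proof -
  have *: "frac_class D (fst p \<otimes>\<^bsub>D\<^esub> snd q \<oplus>\<^bsub>D\<^esub> fst q \<otimes>\<^bsub>D\<^esub> snd p, snd p \<otimes>\<^bsub>D\<^esub> snd q) = fraction (a * d + c * b) (b * d)" 
    if pq: "p \<in> fraction a b" "q \<in> fraction c d" for p q
  proof -
    obtain e f where ef: "p = (cl e, cl f)" "e \<in> A" "f \<in> A - P" using pq(1) fraction_subset frac_pairs_D by blast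
    obtain g h where gh: "q = (cl g, cl h)" "g \<in> A" "h \<in> A - P" using pq(2) fraction_subset frac_pairs_D by blast
    have 1: "a * f - e * b \<in> P" "c * h - g * d \<in> P" using pq fraction_mem[of a b e f] fraction_mem[of c d g h] ef gh assms by auto
    have A: "e * h \<in> A" "g * f \<in> A" "f * h \<in> A" "a * d \<in> A" "c * b \<in> A" using ef gh assms subring_mult[OF subA] by auto
    have "frac_class D (fst p \<otimes>\<^bsub>D\<^esub> snd q \<oplus>\<^bsub>D\<^esub> fst q \<otimes>\<^bsub>D\<^esub> snd p, snd p \<otimes>\<^bsub>D\<^esub> snd q) = fraction (e * h + g * f) (f * h)"
      unfolding fraction_def using ef gh mult_D add_D A by simp
    also have "\<dots> = fraction (a * d + c * b) (b * d)"
    proof (subst eq_commute, subst fraction_eq)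
      have "(a * d + c * b) * (f * h) - (e * h + g * f) * (b * d) = (d * h) * (a * f - e * b) + (b * f) * (c * h - g * d)" 
        by (simp add: algebra_simps)
      moreover have "(d * h) * (a * f - e * b) + (b * f) * (c * h - g * d) \<in> P"
        using 1 assms ef gh subring_mult[OF subA] by (intro ideal_add[OF idP] ideal_mult[OF idP]) auto
      ultimately show "(a * d + c * b) * (f * h) - (e * h + g * f) * (b * d) \<in> P" by simp
    qed (use assms ef gh A subring_add[OF subA] not_P_mult in auto)
    finally show ?thesis .
  qed
  show ?thesis unfolding quotient_field_def using * fraction_self[OF assms(1,2)] fraction_self[OF assms(3,4)] by auto
qed

lemma one_notP: "1 \<in> A - P" using subring_one[OF subA] prime_one[OF prP] by blast

lemma one_QF: "\<one>\<^bsub>quotient_field D\<^esub> = fraction 1 1"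
  unfolding quotient_field_def fraction_def by (simp add: one_D)

lemma to_QF: "to_quotient_field D (cl a) = fraction a 1"
  unfolding to_quotient_field_def fraction_def by (simp add: one_D)

end

text \<open>
  Every residue of \<open>V\<close> modulo \<open>P\<close> is a quotient of residues of \<open>A\<close>.
\<close>

definition residually_dense :: "'a::field set \<Rightarrow> 'a set \<Rightarrow> 'a set \<Rightarrow> bool" where
  "residually_dense A V P \<longleftrightarrow> (\<forall>v\<in>V. \<exists>a\<in>A. \<exists>b\<in>A - P. b * v - a \<in> P)"

text \<open>
  The canonical map of quotient fields sends a fraction of residues of \<open>A\<close> to the same fraction of
  residues of \<open>V\<close> and is always injective; it is onto exactly if every residue of \<open>V\<close> is reached.  In
  contrast to the existence of an isomorphism, the right hand side is visibly inherited by larger rings.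
\<close>

lemma quotient_field_iso_iff:
  assumes A: "is_subring A" and V: "is_subring V" and AV: "A \<subseteq> V" and P: "is_prime V P"
  shows "(\<exists>\<phi>\<in>ring_iso (quotient_field (ring_on A Quot (P \<inter> A))) (quotient_field (ring_on V Quot P)). 
     \<forall>a\<in>A. \<phi> (to_quotient_field (ring_on A Quot (P \<inter> A)) ((P \<inter> A) +>\<^bsub>ring_on A\<^esub> a)) =
       to_quotient_field (ring_on V Quot P) (P +>\<^bsub>ring_on V\<^esub> a)) \<longleftrightarrow> residually_dense A V P"
proof -
  have N: "is_prime A (P \<inter> A)" using contract_prime[OF AV A P] .
  interpret a: subring_prime A "P \<inter> A" using A N prime_ideal by unfold_locales auto
  interpret v: subring_prime V P using V P prime_ideal by unfold_locales auto
  let ?QA = "quotient_field (ring_on A Quot (P \<inter> A))" and ?QV = "quotient_field (ring_on V Quot P)"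
  show ?thesis unfolding a_r_coset_ring_on a.to_QF v.to_QF
  proof
    assume "\<exists>\<phi>\<in>ring_iso ?QA ?QV. \<forall>a\<in>A. \<phi> (a.fraction a 1) = v.fraction a 1"
    then obtain \<phi> where \<phi>: "\<phi> \<in> ring_iso ?QA ?QV" "\<And>a. a \<in> A \<Longrightarrow> \<phi> (a.fraction a 1) = v.fraction a 1" by blast
    show "residually_dense A V P" unfolding residually_dense_def
    proof
      fix x assume x: "x \<in> V"
      have "v.fraction x 1 \<in> carrier ?QV" using v.carrier_QF x v.one_notP by blast
      then have "v.fraction x 1 \<in> \<phi> ` carrier ?QA" using ring_iso_memE(5)[OF \<phi>(1)] by (simp add: bij_betw_def)
      then obtain w where w: "w \<in> carrier ?QA" "\<phi> w = v.fraction x 1" by (elim imageE) simp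
      then obtain a b where ab: "w = a.fraction a b" "a \<in> A" "b \<in> A - P" unfolding a.carrier_QF by blast
      have b: "b \<in> A - (P \<inter> A)" "b \<in> A" "b \<in> V - P" using ab AV by auto
      have "w \<otimes>\<^bsub>?QA\<^esub> a.fraction b 1 = a.fraction a 1"
        unfolding ab(1) a.mult_QF[OF ab(2) b(1,2) a.one_notP] 
        by (subst a.fraction_eq) (use ab b a.one_notP subring_mult[OF A] ideal_zero[OF a.idP] in auto)
      then have "\<phi> w \<otimes>\<^bsub>?QV\<^esub> \<phi> (a.fraction b 1) = \<phi> (a.fraction a 1)"
        using ring_iso_memE(2)[OF \<phi>(1) w(1), of "a.fraction b 1"] a.carrier_QF b a.one_notP by auto
      then have "v.fraction x 1 \<otimes>\<^bsub>?QV\<^esub> v.fraction b 1 = v.fraction a 1" using w(2) \<phi>(2) b ab by simp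
      then have "v.fraction (x * b) (1 * 1) = v.fraction a 1" using v.mult_QF[OF x v.one_notP _ v.one_notP, of b] b by simp
      then have "x * b - a \<in> P" 
        using v.fraction_eq[of "x * b" 1 a 1] x b ab AV v.one_notP subring_mult[OF V] by auto
      then show "\<exists>a\<in>A. \<exists>b\<in>A - P. b * x - a \<in> P" using ab by (auto simp: mult.commute)
    qed
  next
    assume dense: "residually_dense A V P"
    define \<phi> where "\<phi> u = (THE e. \<exists>a\<in>A. \<exists>b\<in>A - P. u = a.fraction a b \<and> e = v.fraction a b)" for u
    have tr: "a.fraction a b = a.fraction c d \<longleftrightarrow> v.fraction a b = v.fraction c d" if "a \<in> A" "b \<in> A - P" "c \<in> A" "d \<in> A - P" for a b c d
    proof -
      have "a * d - c * b \<in> A" using that subring_diff[OF A] subring_mult[OF A] by auto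
      then show ?thesis using a.fraction_eq[of a b c d] v.fraction_eq[of a b c d] that AV by auto
    qed
    have \<phi>: "\<phi> (a.fraction a b) = v.fraction a b" if "a \<in> A" "b \<in> A - P" for a b
      unfolding \<phi>_def by (rule the_equality) (use that tr in blast)+
    have cA: "carrier ?QA = {a.fraction a b | a b. a \<in> A \<and> b \<in> A - P}" using a.carrier_QF by auto
    have NP: "b \<in> A - (P \<inter> A)" "b \<in> V - P" "b \<in> A" "b \<in> V" if b: "b \<in> A - P" for b using b AV by auto
    have "\<phi> \<in> ring_iso ?QA ?QV"
    proof (rule ring_iso_memI)
      fix u assume "u \<in> carrier ?QA"
      then obtain a b where ab: "u = a.fraction a b" "a \<in> A" "b \<in> A - P" unfolding cA by blast
      then show "\<phi> u \<in> carrier ?QV" unfolding v.carrier_QF using \<phi> AV by blast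
      fix w assume "w \<in> carrier ?QA"
      then obtain c d where cd: "w = a.fraction c d" "c \<in> A" "d \<in> A - P" unfolding cA by blast
      have bd: "b * d \<in> A - P" using a.not_P_mult[of b d] NP[OF ab(3)] NP[OF cd(3)] by auto
      have AA: "a * c \<in> A" "a * d + c * b \<in> A" "a \<in> V" "c \<in> V"
        using ab cd AV subring_mult[OF A] subring_add[OF A] by auto
      show "\<phi> (u \<otimes>\<^bsub>?QA\<^esub> w) = \<phi> u \<otimes>\<^bsub>?QV\<^esub> \<phi> w"
        unfolding ab(1) cd(1) a.mult_QF[OF ab(2) NP(1)[OF ab(3)] cd(2) NP(1)[OF cd(3)]] \<phi>[OF AA(1) bd] 
          \<phi>[OF ab(2,3)] \<phi>[OF cd(2,3)] v.mult_QF[OF AA(3) NP(2)[OF ab(3)] AA(4) NP(2)[OF cd(3)]] ..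
      show "\<phi> (u \<oplus>\<^bsub>?QA\<^esub> w) = \<phi> u \<oplus>\<^bsub>?QV\<^esub> \<phi> w"
        unfolding ab(1) cd(1) a.add_QF[OF ab(2) NP(1)[OF ab(3)] cd(2) NP(1)[OF cd(3)]] \<phi>[OF AA(2) bd] 
          \<phi>[OF ab(2,3)] \<phi>[OF cd(2,3)] v.add_QF[OF AA(3) NP(2)[OF ab(3)] AA(4) NP(2)[OF cd(3)]] ..
    next
      show "\<phi> \<one>\<^bsub>?QA\<^esub> = \<one>\<^bsub>?QV\<^esub>" unfolding a.one_QF v.one_QF using \<phi> a.one_notP by auto
      show "bij_betw \<phi> (carrier ?QA) (carrier ?QV)" unfolding bij_betw_def
      proof
        show "inj_on \<phi> (carrier ?QA)"
        proof (rule inj_onI)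
          fix u w assume "u \<in> carrier ?QA" "w \<in> carrier ?QA" and eq: "\<phi> u = \<phi> w"
          then obtain a b c d where *: "u = a.fraction a b" "a \<in> A" "b \<in> A - P" "w = a.fraction c d" "c \<in> A" "d \<in> A - P" 
            unfolding cA by blast
          then show "u = w" using eq tr[OF *(2,3,5,6)] \<phi>[OF *(2,3)] \<phi>[OF *(5,6)] by simp
        qed
        have "\<phi> ` carrier ?QA = {v.fraction a b | a b. a \<in> A \<and> b \<in> A - P}" unfolding cA using \<phi> by force
        also have "\<dots> = carrier ?QV"
        proof
          show "{v.fraction a b | a b. a \<in> A \<and> b \<in> A - P} \<subseteq> carrier ?QV" unfolding v.carrier_QF using AV by blast
          show "carrier ?QV \<subseteq> {v.fraction a b | a b. a \<in> A \<and> b \<in> A - P}"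
          proof
            fix e assume "e \<in> carrier ?QV"
            then obtain x y where xy: "e = v.fraction x y" "x \<in> V" "y \<in> V - P" unfolding v.carrier_QF by blast
            obtain a b where ab: "a \<in> A" "b \<in> A - P" "b * x - a \<in> P" using dense xy(2) unfolding residually_dense_def by blast
            obtain c d where cd: "c \<in> A" "d \<in> A - P" "d * y - c \<in> P" using dense xy(3) unfolding residually_dense_def by blast
            have "c \<notin> P"
            proof
              assume "c \<in> P"
              then have "(d * y - c) + c \<in> P" using cd(3) ideal_add[OF v.idP] by blast
              then show False using prime_mult[OF P, of d y] cd(2) xy(3) AV by auto
            qed
            then have bc: "b * c \<in> A - P" using a.not_P_mult[of b c] NP[OF ab(2)] cd(1) by auto
            have "v.fraction x y = v.fraction (a * d) (b * c)"
            proof (subst v.fraction_eq)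
              have "x * (b * c) - (a * d) * y = c * (b * x - a) - a * (d * y - c)" by (simp add: algebra_simps)
              moreover have "c * (b * x - a) - a * (d * y - c) \<in> P"
                by (rule ideal_diff[OF V v.idP ideal_mult[OF v.idP _ ab(3)] ideal_mult[OF v.idP _ cd(3)]]) (use ab cd AV in auto)
              ultimately show "x * (b * c) - (a * d) * y \<in> P" by simp
            qed (use xy ab cd bc AV subring_mult[OF V] in auto)
            moreover have "a * d \<in> A" using ab cd subring_mult[OF A] by blast
            ultimately show "e \<in> {v.fraction a b | a b. a \<in> A \<and> b \<in> A - P}" using xy(1) bc by blast
          qed
        qed
        finally show "\<phi> ` carrier ?QA = carrier ?QV" .
      qed
    qed
    moreover have "\<phi> (a.fraction a 1) = v.fraction a 1" if "a \<in> A" for a using \<phi>[OF that, of 1] a.one_notP by auto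
    ultimately show "\<exists>\<phi>\<in>ring_iso ?QA ?QV. \<forall>a\<in>A. \<phi> (a.fraction a 1) = v.fraction a 1" by blast
  qed
qed

section \<open>Bases of value groups and the chain of primes\<close>

lemma add_group_on_comm_group:
  assumes "0 \<in> H" "\<And>a b. a \<in> H \<Longrightarrow> b \<in> H \<Longrightarrow> a - b \<in> (H :: 'g::ab_group_add set)"
  shows "comm_group (add_group_on H)"
proof -
  have m: "- a \<in> H" if "a \<in> H" for a using assms(2)[OF assms(1) that] by simp
  have p: "a + b \<in> H" if "a \<in> H" "b \<in> H" for a b using assms(2)[OF that(1) m[OF that(2)]] by simp
  show ?thesis
    by (rule comm_groupI) (use assms(1) p m in \<open>auto simp: add.assoc add.commute intro!: bexI[of _ "- _"]\<close>)
qed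

lemma add_group_on_inv:
  assumes "0 \<in> H" "\<And>a b. a \<in> H \<Longrightarrow> b \<in> H \<Longrightarrow> a - b \<in> (H :: 'g::ab_group_add set)" "a \<in> H"
  shows "inv\<^bsub>add_group_on H\<^esub> a = - a"
proof -
  interpret comm_group "add_group_on H" by (rule add_group_on_comm_group[OF assms(1,2)])
  have "- a \<in> H" using assms(2)[OF assms(1,3)] by simp
  then show ?thesis by (intro inv_equality) (use assms(3) in auto)
qed

context valued_field
begin

lemma value_group_zero: "0 \<in> value_group \<nu>" using value_groupI[of 1] by simp

lemma isolated_iff: "isolated_subgroup \<nu> H \<longleftrightarrow> isolated H"
proof -
  note inv = add_group_on_inv[OF value_group_zero value_group_diff]
  have "subgroup H (add_group_on (value_group \<nu>)) \<longleftrightarrow> H \<subseteq> value_group \<nu> \<and> 0 \<in> H \<and> (\<forall>a\<in>H. \<forall>b\<in>H. a - b \<in> H)"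
  proof
    assume S: "subgroup H (add_group_on (value_group \<nu>))"
    have H: "H \<subseteq> value_group \<nu>" "0 \<in> H" using subgroup.subset[OF S] subgroup.one_closed[OF S] by auto
    have "a - b \<in> H" if "a \<in> H" "b \<in> H" for a b
    proof -
      have "- b \<in> H" using subgroup.m_inv_closed[OF S that(2)] inv[of b] H(1) that(2) by auto
      then show ?thesis using subgroup.m_closed[OF S that(1)] by force
    qed
    then show "H \<subseteq> value_group \<nu> \<and> 0 \<in> H \<and> (\<forall>a\<in>H. \<forall>b\<in>H. a - b \<in> H)" using H by blast
  next
    assume H: "H \<subseteq> value_group \<nu> \<and> 0 \<in> H \<and> (\<forall>a\<in>H. \<forall>b\<in>H. a - b \<in> H)"
    then have m: "- a \<in> H" if "a \<in> H" for a using that by (metis diff_0)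
    then have p: "a + b \<in> H" if "a \<in> H" "b \<in> H" for a b using that H by (metis diff_minus_eq_add)
    show "subgroup H (add_group_on (value_group \<nu>))"
    proof (rule subgroup.intro)
      show "inv\<^bsub>add_group_on (value_group \<nu>)\<^esub> a \<in> H" if "a \<in> H" for a
        using inv[of a] H m[OF that] that by auto
    qed (use H p in auto)
  qed
  then show ?thesis unfolding isolated_subgroup_def isolated_def by blast
qed

definition vcoset :: "'g set \<Rightarrow> 'g \<Rightarrow> 'g set" where "vcoset H a = {h + a | h. h \<in> H}"

lemma vcoset_eq: "isolated H \<Longrightarrow> vcoset H a = vcoset H b \<longleftrightarrow> a - b \<in> H"
proof
  assume H: "isolated H"
  show "a - b \<in> H" if "vcoset H a = vcoset H b"
  proof -
    have "0 + a \<in> vcoset H b" using that iso_zero[OF H] unfolding vcoset_def by blast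
    then show ?thesis unfolding vcoset_def by (auto simp: diff_eq_eq)
  qed
  have *: "vcoset H a \<subseteq> vcoset H b" if "a - b \<in> H" for a b
  proof
    fix x assume "x \<in> vcoset H a"
    then obtain h where h: "h \<in> H" "x = h + a" unfolding vcoset_def by blast
    then have "x = (h + (a - b)) + b" "h + (a - b) \<in> H" using iso_add[OF H h(1) that] by (auto simp: algebra_simps)
    then show "x \<in> vcoset H b" unfolding vcoset_def by blast
  qed
  assume ab: "a - b \<in> H"
  have "b - a \<in> H" using iso_minus[OF H ab] by simp
  then show "vcoset H a = vcoset H b" using *[OF ab] *[of b a] by blast
qed

lemma r_coset_add_group: "H #>\<^bsub>add_group_on G\<^esub> a = vcoset H a"
  by (auto simp: r_coset_def vcoset_def)

end

lemma ex1_unique: "\<exists>!x. R x \<Longrightarrow> R a \<Longrightarrow> R b \<Longrightarrow> a = b"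
  by blast

locale value_quotient = valued_field \<nu> for \<nu> :: "'a::field \<Rightarrow> 'g::linordered_ab_group_add" +
  fixes H G :: "'g set"
  assumes isoH: "isolated H" and isoG: "isolated G" and HG: "H \<subseteq> G"
begin

abbreviation Q :: "'g set monoid" where "Q \<equiv> add_group_on G Mod H"

lemma comm_group_Q: "comm_group Q"
proof -
  interpret G: comm_group "add_group_on G" by (rule add_group_on_comm_group[OF iso_zero[OF isoG] iso_diff[OF isoG]])
  have "subgroup H (add_group_on G)"
  proof (rule G.subgroupI)
    show "inv\<^bsub>add_group_on G\<^esub> a \<in> H" if "a \<in> H" for a
      using add_group_on_inv[OF iso_zero[OF isoG] iso_diff[OF isoG], of a] that HG iso_minus[OF isoH] by auto
  qed (use HG iso_zero[OF isoH] iso_add[OF isoH] in auto)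
  then show ?thesis by (rule G.abelian_FactGroup)
qed

sublocale Q: comm_group Q by (rule comm_group_Q)

lemma carrier_Q: "carrier Q = vcoset H ` G"
  by (auto simp: FactGroup_def RCOSETS_def r_coset_add_group)

lemma vcoset_zero [simp]: "vcoset H 0 = H" by (simp add: vcoset_def)

lemma one_Q: "\<one>\<^bsub>Q\<^esub> = vcoset H 0" by (simp add: FactGroup_def)

lemma mult_Q: "vcoset H a \<otimes>\<^bsub>Q\<^esub> vcoset H b = vcoset H (a + b)"
proof -
  have "vcoset H a <#>\<^bsub>add_group_on G\<^esub> vcoset H b = vcoset H (a + b)"
  proof
    show "vcoset H a <#>\<^bsub>add_group_on G\<^esub> vcoset H b \<subseteq> vcoset H (a + b)"
    proof
      fix x assume "x \<in> vcoset H a <#>\<^bsub>add_group_on G\<^esub> vcoset H b"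
      then obtain h h' where hh: "x = (h + a) + (h' + b)" "h \<in> H" "h' \<in> H" by (auto simp: set_mult_def vcoset_def)
      then have "x = (h + h') + (a + b)" by (simp add: algebra_simps)
      then show "x \<in> vcoset H (a + b)" unfolding vcoset_def using hh iso_add[OF isoH] by blast
    qed
    show "vcoset H (a + b) \<subseteq> vcoset H a <#>\<^bsub>add_group_on G\<^esub> vcoset H b"
    proof
      fix x assume "x \<in> vcoset H (a + b)"
      then obtain h where "x = (h + a) + (0 + b)" "h \<in> H" by (auto simp: vcoset_def algebra_simps)
      then show "x \<in> vcoset H a <#>\<^bsub>add_group_on G\<^esub> vcoset H b" 
        unfolding set_mult_def vcoset_def using iso_zero[OF isoH] by force
    qed
  qed
  then show ?thesis by (simp add: FactGroup_def)
qed

lemma inv_Q: assumes "a \<in> G" shows "inv\<^bsub>Q\<^esub> (vcoset H a) = vcoset H (- a)"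
proof (rule Q.inv_equality)
  show "vcoset H (- a) \<otimes>\<^bsub>Q\<^esub> vcoset H a = \<one>\<^bsub>Q\<^esub>" unfolding mult_Q one_Q by simp
qed (use assms iso_minus[OF isoG] in \<open>auto simp: carrier_Q simp del: carrier_FactGroup\<close>)

lemma pow_Q: assumes "x \<noteq> 0" "\<nu> x \<in> G" shows "vcoset H (\<nu> x) [^]\<^bsub>Q\<^esub> (n :: int) = vcoset H (\<nu> (x powi n))"
proof -
  note G = val_power_mem[OF isoG assms]
  have nat: "vcoset H (\<nu> x) [^]\<^bsub>Q\<^esub> (k :: nat) = vcoset H (\<nu> (x ^ k))" for k
  proof (induction k)
    case 0 show ?case by (simp add: one_Q)
  next
    case (Suc k) then show ?case using assms val_mult[of x "x ^ k"] by (simp add: mult_Q add.commute del: mult_FactGroup)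
  qed
  show ?thesis
  proof (cases "n < 0")
    case True
    then have "x powi n = inverse (x ^ nat (- n))" by (simp add: power_int_def power_inverse)
    then show ?thesis using True nat inv_Q[OF G] val_inverse[of "x ^ nat (- n)"] assms by (simp add: int_pow_def2)
  next
    case False then show ?thesis using nat by (simp add: int_pow_def2 power_int_def)
  qed
qed

lemma finprod_Q:
  assumes "finite I" "\<And>i. i \<in> I \<Longrightarrow> f i \<noteq> 0 \<and> \<nu> (f i) \<in> G"
  shows "(\<Otimes>\<^bsub>Q\<^esub>i\<in>I. vcoset H (\<nu> (f i)) [^]\<^bsub>Q\<^esub> (n i :: int)) = vcoset H (\<nu> (\<Prod>i\<in>I. f i powi n i)) \<and> \<nu> (\<Prod>i\<in>I. f i powi n i) \<in> G"
  using assms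
proof (induction I)
  case empty show ?case by (simp add: one_Q iso_zero[OF isoG])
next
  case (insert i I)
  have p: "vcoset H (\<nu> (f j)) [^]\<^bsub>Q\<^esub> n j \<in> carrier Q" if "j \<in> insert i I" for j
    using pow_Q[of "f j" "n j"] val_powi_mem[OF isoG, of "f j" "n j"] insert.prems[OF that] by (simp add: carrier_Q)
  have nz: "(\<Prod>i\<in>I. f i powi n i) \<noteq> 0" "f i powi n i \<noteq> 0" using insert by (auto simp: power_int_eq_0_iff)
  have "(\<Otimes>\<^bsub>Q\<^esub>i\<in>insert i I. vcoset H (\<nu> (f i)) [^]\<^bsub>Q\<^esub> n i) = 
     vcoset H (\<nu> (f i)) [^]\<^bsub>Q\<^esub> n i \<otimes>\<^bsub>Q\<^esub> (\<Otimes>\<^bsub>Q\<^esub>i\<in>I. vcoset H (\<nu> (f i)) [^]\<^bsub>Q\<^esub> n i)"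
    by (rule Q.finprod_insert) (use insert p in auto)
  also have "\<dots> = vcoset H (\<nu> (f i powi n i) + \<nu> (\<Prod>i\<in>I. f i powi n i))"
    using insert pow_Q[of "f i" "n i"] by (simp add: mult_Q del: mult_FactGroup)
  finally show ?case using insert val_mult[OF nz(2,1)] val_powi_mem[OF isoG, of "f i" "n i"] iso_add[OF isoG] by simp
qed

text \<open>
  Integer combinations of cosets of values are cosets of values of Laurent monomials, so unique
  representability is independence and generation in terms of these monomials.
\<close>

lemma Z_basis_Q:
  assumes "finite I" "\<And>i. i \<in> I \<Longrightarrow> f i \<noteq> 0"
  shows "Z_basis Q I (\<lambda>i. vcoset H (\<nu> (f i))) \<longleftrightarrow> (\<forall>i\<in>I. \<nu> (f i) \<in> G) \<and>
     (\<forall>c. \<nu> (\<Prod>i\<in>I. f i powi c i) \<in> H \<longrightarrow> (\<forall>i\<in>I. c i = 0)) \<and>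
     (\<forall>g\<in>G. \<exists>c. g - \<nu> (\<Prod>i\<in>I. f i powi c i) \<in> H)"
proof -
  let ?b = "\<lambda>i. vcoset H (\<nu> (f i))"
  let ?m = "\<lambda>c. \<Prod>i\<in>I. f i powi c i"
  have mz: "?m c \<noteq> 0" for c using assms by (auto simp: power_int_eq_0_iff)
  have md: "?m (\<lambda>i. c i - d i) = ?m c / ?m d" for c d
    unfolding prod_dividef[symmetric] by (rule prod.cong) (auto simp: power_int_diff assms)
  show ?thesis
  proof
    assume Z: "Z_basis Q I ?b"
    have G: "\<nu> (f i) \<in> G" if i: "i \<in> I" for i
    proof -
      have "?b i \<in> carrier Q" using Z i unfolding Z_basis_def by auto
      then obtain g where g: "g \<in> G" "\<nu> (f i) - g \<in> H" unfolding carrier_Q using vcoset_eq[OF isoH] by auto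
      then have "(\<nu> (f i) - g) + g \<in> G" using HG iso_add[OF isoG] by blast
      then show ?thesis by simp
    qed
    have fp: "(\<Otimes>\<^bsub>Q\<^esub>i\<in>I. ?b i [^]\<^bsub>Q\<^esub> c i) = vcoset H (\<nu> (?m c))" for c :: "'b \<Rightarrow> int"
      using finprod_Q[OF assms(1), of f c] assms(2) G by blast
    have "\<forall>u\<in>carrier Q. \<exists>!n. n \<in> I \<rightarrow>\<^sub>E (UNIV :: int set) \<and> vcoset H (\<nu> (?m n)) = u"
      using Z unfolding Z_basis_def fp by (elim conjE)
    note uniq = bspec[OF this]
    have rm: "?m (restrict c I) = ?m c" for c by (rule prod.cong) auto
    have "c i = 0" if "\<nu> (?m c) \<in> H" "i \<in> I" for c i
    proof -
      have "vcoset H (\<nu> (?m (restrict c I))) = \<one>\<^bsub>Q\<^esub>" unfolding one_Q rm vcoset_eq[OF isoH] using that by simp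
      moreover have "vcoset H (\<nu> (?m (restrict (\<lambda>_. 0) I))) = \<one>\<^bsub>Q\<^esub>" unfolding one_Q rm by simp
      moreover have "restrict d I \<in> I \<rightarrow>\<^sub>E (UNIV :: int set)" for d by auto
      ultimately have "restrict c I = restrict (\<lambda>_. 0) I" by (intro ex1_unique[OF uniq[OF Q.one_closed]] conjI)
      then have "restrict c I i = restrict (\<lambda>_. 0) I i" by (rule fun_cong)
      then show ?thesis using that(2) by simp
    qed
    moreover have "\<exists>c. g - \<nu> (?m c) \<in> H" if g: "g \<in> G" for g
    proof -
      have "vcoset H g \<in> carrier Q" using g carrier_Q by blast
      from uniq[OF this] obtain n where "vcoset H (\<nu> (?m n)) = vcoset H g" by blast
      from vcoset_eq[OF isoH, THEN iffD1, OF this[symmetric]] show ?thesis by blast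
    qed
    ultimately show "(\<forall>i\<in>I. \<nu> (f i) \<in> G) \<and> (\<forall>c. \<nu> (?m c) \<in> H \<longrightarrow> (\<forall>i\<in>I. c i = 0)) \<and> (\<forall>g\<in>G. \<exists>c. g - \<nu> (?m c) \<in> H)"
      using G by blast
  next
    assume R: "(\<forall>i\<in>I. \<nu> (f i) \<in> G) \<and> (\<forall>c. \<nu> (?m c) \<in> H \<longrightarrow> (\<forall>i\<in>I. c i = 0)) \<and> (\<forall>g\<in>G. \<exists>c. g - \<nu> (?m c) \<in> H)"
    have fp: "(\<Otimes>\<^bsub>Q\<^esub>i\<in>I. ?b i [^]\<^bsub>Q\<^esub> c i) = vcoset H (\<nu> (?m c))" for c :: "'b \<Rightarrow> int"
      using finprod_Q[OF assms(1), of f c] assms(2) R by blast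
    have rm: "?m (restrict c I) = ?m c" for c by (rule prod.cong) auto
    show "Z_basis Q I ?b" unfolding Z_basis_def fp
    proof (intro conjI ballI assms(1))
      show "?b \<in> I \<rightarrow> carrier Q" using R carrier_Q by auto
      fix u assume "u \<in> carrier Q"
      then obtain g where g: "g \<in> G" "u = vcoset H g" unfolding carrier_Q by blast
      obtain c where c: "g - \<nu> (?m c) \<in> H" using R g by blast
      show "\<exists>!n. n \<in> I \<rightarrow>\<^sub>E (UNIV :: int set) \<and> vcoset H (\<nu> (?m n)) = u"
      proof (rule ex1I[of _ "restrict c I"])
        show "restrict c I \<in> I \<rightarrow>\<^sub>E UNIV \<and> vcoset H (\<nu> (?m (restrict c I))) = u"
          unfolding rm g(2) using c vcoset_eq[OF isoH, of g "\<nu> (?m c)"] by auto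
        fix n assume n: "n \<in> I \<rightarrow>\<^sub>E UNIV \<and> vcoset H (\<nu> (?m n)) = u"
        then have "\<nu> (?m n) - g \<in> H" unfolding g(2) using vcoset_eq[OF isoH] by blast
        then have "(\<nu> (?m n) - g) + (g - \<nu> (?m c)) \<in> H" using c iso_add[OF isoH] by blast
        then have "\<nu> (?m n / ?m c) \<in> H" using val_divide[OF mz mz] by simp
        then have z: "\<forall>i\<in>I. n i - c i = 0" using R md[of n c] by metis
        show "n = restrict c I"
        proof
          fix i show "n i = restrict c I i" using z n by (cases "i \<in> I") (auto simp: PiE_def extensional_def)
        qed
      qed
    qed
  qed
qed

end

lemma valuation_over_valued_field: "valuation_over k \<nu> \<Longrightarrow> valued_field \<nu>"
  unfolding valuation_over_def by unfold_locales auto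

lemma isolated_chain_valuation_chain:
  assumes "valued_field \<nu>" "isolated_chain \<nu> t \<Gamma>" shows "valuation_chain \<nu> t \<Gamma>"
proof -
  interpret valued_field \<nu> by fact
  show ?thesis using assms(2) unfolding isolated_chain_def isolated_iff by unfold_locales auto
qed

text \<open>
  Two strictly monotone enumerations of the same finite chain agree.
\<close>

lemma strict_mono_on_fills:
  fixes f :: "nat \<Rightarrow> nat"
  assumes "\<And>i j. i < j \<Longrightarrow> j \<le> t \<Longrightarrow> f i < f j" "\<And>i. i \<le> t \<Longrightarrow> 1 \<le> f i \<and> f i \<le> Suc t" "i \<le> t"
  shows "f i = Suc i"
proof -
  have "i \<le> t \<Longrightarrow> Suc i \<le> f i" for i
  proof (induction i)
    case 0 then show ?case using assms(2)[of 0] by simp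
  next
    case (Suc i) then show ?case using assms(1)[of i "Suc i"] by simp
  qed
  moreover have "d \<le> t \<Longrightarrow> f (t - d) \<le> Suc (t - d)" for d
  proof (induction d)
    case 0 then show ?case using assms(2)[of t] by simp
  next
    case (Suc d)
    have "t - d = Suc (t - Suc d)" using Suc.prems by simp
    moreover have "t - Suc d < t - d" "t - d \<le> t" using Suc.prems by auto
    then have "f (t - Suc d) < f (t - d)" by (rule assms(1))
    ultimately show ?case using Suc by simp
  qed
  from this[of "t - i"] have "f i \<le> Suc i" using assms(3) by simp
  ultimately show ?thesis using assms(3) by (simp add: le_antisym)
qed

context valuation_chain
begin

lemma PP_strict: 
  assumes "i < j" "j \<le> t" shows "val_prime (\<Gamma> j) \<subset> val_prime (\<Gamma> i)"
proof -
  have "\<Gamma> i \<subset> \<Gamma> j" using chain_strict[of i] chain_mono[of "Suc i" j] assms by auto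
  then obtain g where g: "g \<in> \<Gamma> j" "g \<notin> \<Gamma> i" by blast
  have iso: "isolated (\<Gamma> i)" "isolated (\<Gamma> j)" using chain_iso assms by auto
  define h where "h = (if 0 \<le> g then g else - g)"
  have h: "h \<in> \<Gamma> j" "h \<notin> \<Gamma> i" unfolding h_def using g iso_minus[OF iso(2)] iso_minus[OF iso(1), of "- g"] by auto
  have "h \<noteq> 0" using h(2) iso_zero[OF iso(1)] by auto
  then have "0 < h" unfolding h_def by (auto simp: not_le split: if_splits)
  obtain x where x: "x \<noteq> 0" "\<nu> x = h" using iso_vg[OF iso(2) h(1)] unfolding value_group_def by auto
  then have "x \<in> val_prime (\<Gamma> i)" "x \<notin> val_prime (\<Gamma> j)" using h \<open>0 < h\<close> by (auto simp: above_def)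
  then show ?thesis using val_prime_antimono \<open>\<Gamma> i \<subset> \<Gamma> j\<close> by blast
qed

text \<open>
  The primes attached to the isolated subgroups form a strictly decreasing sequence of \<open>t + 1\<close> primes
  among the \<open>t + 1\<close> primes of the valuation ring, so they are all of these, in order.
\<close>

lemma prime_chain_eq:
  assumes P: "prime_chain \<nu> t P" and j: "j \<in> {1..Suc t}" shows "P j = PP j"
proof -
  have Pstrict: "P i' \<subset> P i" if "1 \<le> i" "i < i'" "i' \<le> Suc t" for i i'
    using that(2,3)
  proof (induction i')
    case (Suc m)
    have "P (Suc m) \<subset> P m" using P Suc.prems that(1) unfolding prime_chain_def by auto
    then show ?case using Suc by (cases "i = m") auto
  qed simp
  have "\<exists>m. 1 \<le> m \<and> m \<le> Suc t \<and> val_prime (\<Gamma> i) = P m" if "i \<le> t" for i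
  proof -
    have "primeideal (val_prime (\<Gamma> i)) (ring_on (val_ring \<nu>))"
      using val_prime_is_prime[OF chain_iso[OF that]] primeideal_iff[OF val_ring_subring] by blast
    then have "val_prime (\<Gamma> i) \<in> P ` {1..Suc t}" using P unfolding prime_chain_def by blast
    then show ?thesis by auto
  qed
  then obtain f where f: "\<And>i. i \<le> t \<Longrightarrow> 1 \<le> f i \<and> f i \<le> Suc t \<and> val_prime (\<Gamma> i) = P (f i)" by metis
  have "f i < f j" if ij: "i < j" "j \<le> t" for i j
  proof (rule ccontr)
    assume "\<not> f i < f j"
    then have "f j < f i \<or> f j = f i" by auto
    then have "P (f i) \<subseteq> P (f j)" using Pstrict[of "f j" "f i"] f[of i] f[of j] ij by auto
    then show False using PP_strict[OF ij] f[of i] f[of j] ij by auto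
  qed
  then have "f (j - 1) = Suc (j - 1)" using f j by (intro strict_mono_on_fills[of t]) auto
  then show ?thesis using f[of "j - 1"] j by auto
qed

lemma value_bases_iff: "value_bases \<nu> t \<Gamma> r z \<longleftrightarrow> bases z"
proof -
  have "(\<forall>l\<in>{1..r j}. z (j, l) \<noteq> 0) \<and> Z_basis (add_group_on (\<Gamma> j) Mod \<Gamma> (j - 1)) {1..r j} (\<lambda>l. comp_val \<nu> \<Gamma> j (z (j, l))) \<longleftrightarrow>
    (\<forall>l\<in>{1..r j}. z (j, l) \<noteq> 0 \<and> \<nu> (z (j, l)) \<in> \<Gamma> j) \<and>
     (\<forall>c. \<nu> (level_mon z j c) \<in> \<Gamma> (j - 1) \<longrightarrow> (\<forall>l\<in>{1..r j}. c l = 0)) \<and>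
     (\<forall>g\<in>\<Gamma> j. \<exists>c. g - \<nu> (level_mon z j c) \<in> \<Gamma> (j - 1))" if j: "j \<in> {1..t}" for j
  proof -
    interpret value_quotient \<nu> "\<Gamma> (j - 1)" "\<Gamma> j"
      using chain_iso chain_mono j by unfold_locales auto
    have cv: "(\<lambda>l. comp_val \<nu> \<Gamma> j (z (j, l))) = (\<lambda>l. vcoset (\<Gamma> (j - 1)) (\<nu> (z (j, l))))"
      unfolding comp_val_def r_coset_add_group ..
    show ?thesis
    proof (cases "\<forall>l\<in>{1..r j}. z (j, l) \<noteq> 0")
      case True
      then show ?thesis unfolding cv level_mon_def using Z_basis_Q[of "{1..r j}" "\<lambda>l. z (j, l)"] by auto
    qed auto
  qed
  then show ?thesis unfolding value_bases_def bases_def by simp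
qed

section \<open>Framed rings satisfy the conditions of the theorem\<close>

lemma max_ideal_eq: "framed A z \<Longrightarrow> max_ideal (ring_on A) = val_ideal \<nu> \<inter> A"
  using local_ring_on(2)[OF framed_local] val_ideal_eq by simp

lemma J_below_top: "{p \<in> J. fst p < Suc t} = J" "{p \<in> J. 1 \<le> fst p} = J" "{p \<in> J. Suc t \<le> fst p} = {}"
  by (auto simp: param_index_def)

lemma lspan_empty: "lspan A {} = {0}"
  using lspan_least[of A "{0}" "{}"] lspan_zero[of A "{}"] by (auto simp: submodule_of_def)

lemma framed_params: 
  assumes F: "framed A z" shows "regular_parameters (ring_on A) J z"
proof -
  note A = framed_subring[OF F]
  have zA: "z ` J \<subseteq> A" using framed_pos[OF F] by blast
  have "genideal (ring_on A) (z ` J) = max_ideal (ring_on A)"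
    unfolding genideal_eq[OF A zA] max_ideal_eq[OF F] using framed_gens[OF F, of 1] PP_one J_below_top by simp
  moreover have "krull_dim (ring_on A) = enat (card J)"
  proof -
    have PT: "PP (Suc t) \<inter> A = {0}" using PP_top subring_zero[OF A] by auto
    obtain q where "prime_chain_from A (PP (Suc t) \<inter> A) (card {p \<in> J. fst p < Suc t}) q" 
      using framed_chain_exists[OF F, of "Suc t"] by auto
    then have "prime_chain_from A {0} (card J) q" unfolding PT J_below_top .
    moreover have "d \<le> card J" if "prime_chain_from A {0} d q" for d q
      using framed_chain_bound[OF F, of "Suc t" d q] that unfolding PT J_below_top by simp
    ultimately show ?thesis by (rule krull_dim_ring_on[OF A])
  qed
  ultimately show ?thesis unfolding regular_parameters_def using finite_J zA by auto
qed

lemma framed_regular: 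
  assumes F: "framed A z" shows "regular_local_ring (ring_on A)"
proof -
  have "inj_on z J" using bases_val_inj[OF framed_bases[OF F]] by (auto simp: inj_on_def)
  then have "card (z ` J) = card J" by (rule card_image)
  then show ?thesis unfolding regular_local_ring_def
    using framed_params[OF F] local_ring_on(1)[OF framed_local[OF F]] noetherian_iff[OF framed_subring[OF F]] framed_noeth[OF F]
    by (intro conjI exI[of _ "z ` J"]) (auto simp: regular_parameters_def)
qed

text \<open>
  The parameters of level below \<open>j\<close> remain distinct modulo \<open>P\<^sub>j\<close>, because the difference of two of them
  has the smaller of their values; their number is the dimension of the quotient.
\<close>

lemma framed_regular_prime:
  assumes F: "framed A z" and j: "j \<in> {1..Suc t}"
  shows "regular_prime (PP j \<inter> A) (ring_on A)"
proof -
  note A = framed_subring[OF F]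
  have jt: "j - 1 \<le> t" using j by auto
  have p: "is_prime A (PP j \<inter> A)" using contract_val_prime[OF A framed_V[OF F] chain_iso[OF jt]] .
  interpret D: subring_ideal A "PP j \<inter> A" using A prime_ideal[OF p] by unfold_locales
  let ?W = "z ` {p \<in> J. fst p < j}"
  have W: "?W \<subseteq> A" using framed_pos[OF F] by blast
  have "lspan A (?W \<union> (PP j \<inter> A)) = lspan A (z ` J)"
  proof -
    have "J = {p \<in> J. fst p < j} \<union> {p \<in> J. j \<le> fst p}" by auto
    then have "z ` J = ?W \<union> z ` {p \<in> J. j \<le> fst p}" by (metis image_Un)
    then show ?thesis unfolding framed_gens[OF F j] lspan_lspan_union[OF A] by simp
  qed
  also have "\<dots> = val_prime {0} \<inter> A" using framed_gens[OF F, of 1] PP_one val_ideal_eq J_below_top by simp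
  finally have gen: "genideal D.D (D.cl ` ?W) = D.cl ` (val_prime {0} \<inter> A)" using D.genideal_D[OF W] by simp
  have sub: "PP j \<inter> A \<subseteq> val_prime {0} \<inter> A" using PP_antimono[of 1 j] j PP_one val_ideal_eq by auto
  note loc = D.local_D[OF framed_local[OF F] sub]
  have "inj_on (D.cl \<circ> z) {p \<in> J. fst p < j}"
  proof (rule inj_onI, rule ccontr)
    fix a b assume ab: "a \<in> {p \<in> J. fst p < j}" "b \<in> {p \<in> J. fst p < j}" "(D.cl \<circ> z) a = (D.cl \<circ> z) b" "a \<noteq> b"
    have *: False if "x \<in> J" "y \<in> J" "fst x < j" "\<nu> (z x) < \<nu> (z y)" "z x - z y \<in> PP j" for x y
    proof -
      have "z x \<noteq> 0" "z y \<noteq> 0" using bases_J(1)[OF framed_bases[OF F]] that by auto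
      then have v: "z x - z y \<noteq> 0" "\<nu> (z x - z y) = \<nu> (z x)" using val_diff_neq that(4) by auto
      have "\<Gamma> (fst x) \<subseteq> \<Gamma> (j - 1)" using that(3) jt by (intro chain_mono) auto
      then have "\<nu> (z x) \<in> \<Gamma> (j - 1)" using bases_J(2)[OF framed_bases[OF F] that(1)] by blast
      then show False using that(5) v by (simp add: above_def)
    qed
    have d: "z a - z b \<in> PP j \<inter> A" using ab(3) D.cl_eq by simp
    then have "- (z a - z b) \<in> PP j \<inter> A" using ideal_minus[OF A prime_ideal[OF p]] by blast
    then have d': "z b - z a \<in> PP j" by simp
    have "\<nu> (z a) \<noteq> \<nu> (z b)" using bases_val_inj[OF framed_bases[OF F], of a b] ab by blast
    then consider "\<nu> (z a) < \<nu> (z b)" | "\<nu> (z b) < \<nu> (z a)" using linorder_neqE by blast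
    then show False using *[of a b] *[of b a] ab(1,2) d d' by cases auto
  qed
  then have "card ((D.cl \<circ> z) ` {p \<in> J. fst p < j}) = card {p \<in> J. fst p < j}" by (rule card_image)
  then have card: "card (D.cl ` ?W) = card {p \<in> J. fst p < j}" unfolding image_comp .
  obtain q where q: "prime_chain_from A (PP j \<inter> A) (card {p \<in> J. fst p < j}) q" using framed_chain_exists[OF F j] by blast
  have dim: "krull_dim D.D = enat (card {p \<in> J. fst p < j})" 
    by (rule D.krull_dim_D[OF q framed_chain_bound[OF F j]])
  have "regular_local_ring D.D" unfolding regular_local_ring_def
  proof (intro conjI exI[of _ "D.cl ` ?W"])
    show "local_ring D.D" by (rule loc(1))
    show "noetherian_ring D.D" by (rule D.noetherian_D[OF framed_noeth[OF F]])
    show "finite (D.cl ` ?W)" using finite_J by simp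
    show "D.cl ` ?W \<subseteq> carrier D.D" using W D.carrier_D by blast
    show "genideal D.D (D.cl ` ?W) = max_ideal D.D" unfolding gen loc(2) ..
    show "enat (card (D.cl ` ?W)) = krull_dim D.D" unfolding card dim ..
  qed
  then show ?thesis unfolding regular_prime_def using p primeideal_iff[OF A] by blast
qed

lemma framed_very_good: 
  assumes F: "framed A z" and "algebraic_local_ring k A" shows "very_good k \<nu> t \<Gamma> r A z"
  unfolding very_good_def dominates_def
  using assms framed_regular[OF F] framed_V[OF F] max_ideal_eq[OF F] framed_params[OF F] value_bases_iff framed_bases[OF F] by auto

lemma framed_cond_A1:
  assumes F: "framed A z" and P: "prime_chain \<nu> t P" shows "cond_A1 \<nu> t \<Gamma> P r A z"
  unfolding cond_A1_def
proof (intro conjI ballI)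
  show "value_bases \<nu> t \<Gamma> r z" using value_bases_iff framed_bases[OF F] by simp
  fix j assume "j \<in> {1..t}"
  then have j: "j \<in> {1..Suc t}" by auto
  have "z ` {p \<in> J. j \<le> fst p} \<subseteq> A" using framed_pos[OF F] by blast
  then show "P j \<inter> A = genideal (ring_on A) (z ` {p \<in> J. j \<le> fst p})"
    using framed_gens[OF F j] prime_chain_eq[OF P j] genideal_eq[OF framed_subring[OF F]] by simp
  show "regular_prime (P j \<inter> A) (ring_on A)" using framed_regular_prime[OF F j] prime_chain_eq[OF P j] by simp
qed

lemma framedI:
  assumes reg: "regular_local_ring (ring_on A)" and alg: "algebraic_local_ring k A" and dom: "dominates \<nu> A"
    and par: "regular_parameters (ring_on A) J z" and A1: "cond_A1 \<nu> t \<Gamma> P r A z" and P: "prime_chain \<nu> t P"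
  shows "framed A z"
  unfolding framed_def
proof (intro conjI ballI impI)
  have A: "is_subring A" using alg unfolding algebraic_local_ring_def subring_iff_is_subring by blast
  show N: "noeth A" using reg noetherian_iff[OF A] unfolding regular_local_ring_def by blast
  show V: "A \<subseteq> val_ring \<nu>" using dom unfolding dominates_def by blast
  show "bases z" using A1 value_bases_iff unfolding cond_A1_def by blast
  show "inverse x \<in> A" if "x \<in> A" "x \<noteq> 0" "\<nu> x = 0" for x
  proof (rule local_ring_inverse[OF N _ that(1)])
    show "local_ring (ring_on A)" using reg unfolding regular_local_ring_def by blast
    have "x \<notin> val_ideal \<nu>" using that by (simp add: val_ideal_def)
    then show "x \<notin> max_ideal (ring_on A)" using dom unfolding dominates_def by blast
  qed
  fix j assume j: "j \<in> {1..Suc t}"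
  show "PP j \<inter> A = lspan A (z ` {p \<in> J. j \<le> fst p})"
  proof (cases "j = Suc t")
    case True
    show ?thesis unfolding True J_below_top(3) using PP_top subring_zero[OF A] lspan_empty by auto
  next
    case False
    then have "P j \<inter> A = genideal (ring_on A) (z ` {p \<in> J. j \<le> fst p})" using A1 j unfolding cond_A1_def by auto
    moreover have "z ` {p \<in> J. j \<le> fst p} \<subseteq> A" using par unfolding regular_parameters_def by auto
    ultimately show ?thesis using prime_chain_eq[OF P j] genideal_eq[OF A] by simp
  qed
qed

text \<open>
  If \<open>A\<close> is a localization of \<open>k[T]\<close>, then \<open>A'\<close> is the localization of \<open>k[T, y]\<close> at its elements of value
  \<open>0\<close>: the denominators of \<open>A\<close> have value \<open>0\<close>, so they can be absorbed.
\<close>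

lemma algebraic_transform:
  assumes F: "framed A z" and alg: "algebraic_local_ring k A" and step: "prim_step (A, z) (A', z')"
  shows "algebraic_local_ring k A'"
proof -
  obtain p q where pq: "p \<in> J" "q \<in> J" "\<nu> (z q) < \<nu> (z p)" 
    "A' = localize (adjoin A {z p / z q}) (adjoin A {z p / z q} - val_ideal \<nu>)"
    using step unfolding prim_step_def by auto
  define y where "y = z p / z q"
  define B where "B = adjoin A {y}"
  have F': "framed A' z'" "A \<subseteq> A'" using prim_step_framed[OF F step] by auto
  obtain T S where T: "finite T" "S \<subseteq> adjoin k T" "submonoid S ring_of_type_algebra" "0 \<notin> S" "A = localize (adjoin k T) S"
    using alg unfolding algebraic_local_ring_def by blast
  define C where "C = adjoin k (insert y T)"
  \<comment> \<open>The elements of value \<open>0\<close> of \<open>k[T, y]\<close> are the denominators of the new presentation.\<close>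
  define S' where "S' = C - val_ideal \<nu>"
  have S: "1 \<in> S" "\<And>s t. s \<in> S \<Longrightarrow> t \<in> S \<Longrightarrow> s * t \<in> S" using submonoid.one_closed[OF T(3)] submonoid.m_closed[OF T(3)] by auto
  have mS: "mult_set (adjoin k T) S" unfolding mult_set_def using T S by blast
  have Cs: "is_subring C" and Bs: "is_subring B" unfolding C_def B_def by (rule is_subring_adjoin)+
  have kTC: "adjoin k T \<subseteq> C" using adjoin_superset[of k "insert y T"] unfolding C_def
    by (intro adjoin_least is_subring_adjoin) auto
  have yC: "y \<in> C" using adjoin_superset[of k "insert y T"] unfolding C_def by auto
  have mSC: "mult_set C S" using mS kTC unfolding mult_set_def by blast
  have kTA: "adjoin k T \<subseteq> A" unfolding T(5) by (rule localize_superset[OF mS])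
  have AB: "A \<subseteq> B" "y \<in> B" unfolding B_def using adjoin_superset[of A "{y}"] by auto
  have CB: "C \<subseteq> B" unfolding C_def using AB kTA adjoin_superset[of k T] by (intro adjoin_least Bs) auto
  have BL: "B \<subseteq> localize C S" unfolding B_def
  proof (rule adjoin_least[OF localize_subring[OF Cs mSC]])
    have "A \<subseteq> localize C S" unfolding T(5) by (rule localize_mono[OF kTC])
    moreover have "y \<in> localize C S" using localize_superset[OF mSC, of C] yC by blast
    ultimately show "A \<union> {y} \<subseteq> localize C S" by blast
  qed
  have BA': "B \<subseteq> A'"
  proof
    fix b assume "b \<in> B"
    moreover have "1 \<in> B - val_ideal \<nu>" using subring_one[OF Bs] by (simp add: val_ideal_def)
    ultimately have "b / 1 \<in> A'" unfolding pq(4) B_def y_def using localize_memI by blast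
    then show "b \<in> A'" by simp
  qed
  have Sv: "s \<noteq> 0 \<and> \<nu> s = 0 \<and> s \<in> C" if s: "s \<in> S" for s
  proof -
    have s0: "s \<noteq> 0" using s T(4) by auto
    have "1 / s \<in> A" unfolding T(5) using localize_memI[OF subring_one[OF is_subring_adjoin] s] .
    moreover have "s \<in> A" using s T(2) kTA by blast
    ultimately have "0 \<le> \<nu> (1 / s)" "0 \<le> \<nu> s" using framed_V[OF F] s0 by (auto simp: val_ring_def)
    then show ?thesis using s0 val_divide[of 1 s] s T(2) kTC by auto
  qed
  have nv: "c \<noteq> 0 \<and> \<nu> c = 0" if "c \<in> S'" for c
  proof -
    have "c \<in> val_ring \<nu>" using that CB BA' framed_V[OF F'(1)] unfolding S'_def by blast
    then show ?thesis using that unfolding S'_def val_ring_def val_ideal_def by auto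
  qed
  have S'I: "c \<in> S'" if "c \<in> C" "c \<noteq> 0" "\<nu> c = 0" for c using that unfolding S'_def val_ideal_def by auto
  have "A' = localize C S'"
  proof
    have "S' \<subseteq> B - val_ideal \<nu>" unfolding S'_def using CB by blast
    then show "localize C S' \<subseteq> A'" unfolding pq(4) localize_def using CB unfolding B_def y_def by blast
    show "A' \<subseteq> localize C S'"
    proof
      fix x assume "x \<in> A'"
      then obtain b s where bs: "b \<in> B" "s \<in> B - val_ideal \<nu>" "x = b / s" unfolding pq(4) B_def y_def by (rule localize_memE)
      obtain c d where cd: "c \<in> C" "d \<in> S" "b = c / d" using bs(1) BL localize_memE by blast
      obtain e f where ef: "e \<in> C" "f \<in> S" "s = e / f" using bs(2) BL localize_memE by blast
      have s: "s \<noteq> 0" "\<nu> s = 0"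
      proof -
        have "s \<in> val_ring \<nu>" using bs(2) BA' framed_V[OF F'(1)] by blast
        then show "s \<noteq> 0" "\<nu> s = 0" using bs(2) unfolding val_ring_def val_ideal_def by auto
      qed
      have e0: "e \<noteq> 0" using s(1) ef by auto
      have "\<nu> e = 0" using s(2) val_divide[OF e0, of f] Sv[OF ef(2)] ef(3) by simp
      then have "\<nu> (d * e) = 0" "d * e \<noteq> 0" using val_mult[of d e] Sv[OF cd(2)] e0 by auto
      then have "d * e \<in> S'" using S'I subring_mult[OF Cs _ ef(1)] Sv[OF cd(2)] by blast
      moreover have "c * f \<in> C" using subring_mult[OF Cs cd(1)] Sv[OF ef(2)] by blast
      moreover have "x = (c * f) / (d * e)" using bs(3) cd(3) ef(3) by simp
      ultimately show "x \<in> localize C S'" using localize_memI by blast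
    qed
  qed
  moreover have "submonoid S' ring_of_type_algebra"
  proof (rule submonoid.intro)
    show "\<one>\<^bsub>ring_of_type_algebra\<^esub> \<in> S'" using S'I[of 1] subring_one[OF Cs] by simp
    show "a \<otimes>\<^bsub>ring_of_type_algebra\<^esub> b \<in> S'" if "a \<in> S'" "b \<in> S'" for a b
      using S'I[of "a * b"] nv[OF that(1)] nv[OF that(2)] val_mult[of a b] that subring_mult[OF Cs] unfolding S'_def by auto
  qed simp
  moreover have "0 \<notin> S'" "S' \<subseteq> C" unfolding S'_def val_ideal_def by auto
  moreover have "\<forall>c. \<exists>a\<in>A'. \<exists>b\<in>A'. b \<noteq> 0 \<and> c = a / b"
    using alg F'(2) unfolding algebraic_local_ring_def by blast
  ultimately show ?thesis unfolding algebraic_local_ring_def subring_iff_is_subring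
    using framed_subring[OF F'(1)] local_ring_on(1)[OF framed_local[OF F'(1)]] T(1) unfolding C_def by blast
qed

lemma residually_dense_mono: "A \<subseteq> A' \<Longrightarrow> residually_dense A V P \<Longrightarrow> residually_dense A' V P"
  unfolding residually_dense_def by blast

lemma cond_A2_residually_dense:
  assumes F: "framed A z" and P: "prime_chain \<nu> t P" and A2: "cond_A2 \<nu> t P A" and i: "i \<in> {1..t}"
  shows "residually_dense A (val_ring \<nu>) (P i)"
proof -
  have i': "i \<in> {1..Suc t}" using i by auto
  have "is_prime (val_ring \<nu>) (P i)" using PP_prime[OF i'] prime_chain_eq[OF P i'] by simp
  from quotient_field_iso_iff[OF framed_subring[OF F] val_ring_subring framed_V[OF F] this]
  show ?thesis using A2 i unfolding cond_A2_def Let_def by blast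
qed

text \<open>
  The second isomorphism of the condition does not mention the ring, and the first is residual
  density, which passes to larger rings.
\<close>

lemma cond_A2_transfer:
  assumes F: "framed A z" and F': "framed A' z'" and P: "prime_chain \<nu> t P" and A2: "cond_A2 \<nu> t P A" and AA: "A \<subseteq> A'"
  shows "cond_A2 \<nu> t P A'"
  unfolding cond_A2_def Let_def
proof (intro ballI conjI)
  fix i assume i: "i \<in> {1..t}"
  have i': "i \<in> {1..Suc t}" using i by auto
  have p: "is_prime (val_ring \<nu>) (P i)" using PP_prime[OF i'] prime_chain_eq[OF P i'] by simp
  have "residually_dense A' (val_ring \<nu>) (P i)"
    using residually_dense_mono[OF AA cond_A2_residually_dense[OF F P A2 i]] .
  with quotient_field_iso_iff[OF framed_subring[OF F'] val_ring_subring framed_V[OF F'] p]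
  show "\<exists>\<phi>\<in>ring_iso (quotient_field (ring_on A' Quot P i \<inter> A')) (quotient_field (ring_on (val_ring \<nu>) Quot P i)).
      \<forall>a\<in>A'. \<phi> (to_quotient_field (ring_on A' Quot P i \<inter> A') (P i \<inter> A' +>\<^bsub>ring_on A'\<^esub> a)) =
        to_quotient_field (ring_on (val_ring \<nu>) Quot P i) (P i +>\<^bsub>ring_on (val_ring \<nu>)\<^esub> a)" by blast
  show "\<exists>\<psi>\<in>ring_iso (quotient_field (ring_on (val_ring \<nu>) Quot P i)) (ring_on (comp_ring \<nu> P i) Quot comp_ideal \<nu> P i).
      \<forall>a\<in>val_ring \<nu>. \<psi> (to_quotient_field (ring_on (val_ring \<nu>) Quot P i) (P i +>\<^bsub>ring_on (val_ring \<nu>)\<^esub> a)) =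
        comp_ideal \<nu> P i +>\<^bsub>ring_on (comp_ring \<nu> P i)\<^esub> a"
    using A2 i unfolding cond_A2_def Let_def by blast
qed

lemma prim_steps_transform_sequence:
  assumes "prim_steps (A, z) (A', z')" and F: "framed A z" and alg: "algebraic_local_ring k A" 
  shows "transform_sequence k \<nu> t \<Gamma> r (A, z) (A', z') \<and> algebraic_local_ring k A'"
  using assms(1)
proof (induction "(A', z')" arbitrary: A' z' rule: rtranclp_induct)
  case base then show ?case using alg by simp
next
  case (step y)
  obtain A1 z1 where y: "y = (A1, z1)" by (cases y)
  have F1: "framed A1 z1" using prim_steps_framed[OF _ F] step(1) y by blast
  have s: "prim_step (A1, z1) (A', z')" using step(2) y by simp
  have IH: "transform_sequence k \<nu> t \<Gamma> r (A, z) (A1, z1)" "algebraic_local_ring k A1" using step(3)[OF y] by auto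
  obtain p q where pq: "p \<in> J" "q \<in> J" "\<nu> (z1 q) < \<nu> (z1 p)" "z' = z1(p := z1 p / z1 q)"
    "A' = localize (adjoin A1 {z1 p / z1 q}) (adjoin A1 {z1 p / z1 q} - val_ideal \<nu>)"
    using s unfolding prim_step_def by auto
  have "primitive_transform k \<nu> t \<Gamma> r (A1, z1) (A', z')"
    unfolding primitive_transform_def Let_def case_prod_conv
    by (intro conjI framed_very_good[OF F1 IH(2)], rule bexI[OF _ pq(1)], rule bexI[OF _ pq(2)]) (use pq in auto)
  then show ?case using IH(1) algebraic_transform[OF F1 IH(2) s] rtranclp.rtrancl_into_rtrancl by metis
qed

end

section \<open>Monomialization along the valuation\<close>

theorem theorem1p2:
  fixes k R :: "'a::field set"
    and \<nu> :: "'a \<Rightarrow> 'g::linordered_ab_group_add"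
    and t :: nat
    and \<Gamma> :: "nat \<Rightarrow> 'g set"
    and P :: "nat \<Rightarrow> 'a set"
    and r :: "nat \<Rightarrow> nat"
    and x :: "nat \<times> nat \<Rightarrow> 'a"
  assumes "algebraic_function_field k"
    and "valuation_over k \<nu>"
    and "abhyankar k \<nu>"
    and "isolated_chain \<nu> t \<Gamma>"
    and "prime_chain \<nu> t P"
    and "algebraic_local_ring k R"
    and "regular_local_ring (ring_on R)"
    and "dominates \<nu> R"
    and "regular_parameters (ring_on R) (param_index t r) x"
    and "cond_A1 \<nu> t \<Gamma> P r R x"
    and "cond_A2 \<nu> t P R"
  shows
    "(\<forall>f\<in>R. f \<noteq> 0 \<longrightarrow>
        (\<exists>R1 x1. transform_sequence k \<nu> t \<Gamma> r (R, x) (R1, x1) \<and>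
           very_good k \<nu> t \<Gamma> r R1 x1 \<and> cond_A1 \<nu> t \<Gamma> P r R1 x1 \<and> cond_A2 \<nu> t P R1 \<and>
           (\<exists>(a :: nat \<times> nat \<Rightarrow> nat) u. u \<in> Units (ring_on R1) \<and>
              f = (\<Prod>p\<in>param_index t r. x1 p ^ a p) * u))) \<and>
     (\<forall>I. ideal I (ring_on R) \<and> I \<noteq> {0} \<longrightarrow>
        (\<exists>R1 x1. transform_sequence k \<nu> t \<Gamma> r (R, x) (R1, x1) \<and>
           very_good k \<nu> t \<Gamma> r R1 x1 \<and>
           (\<exists>a :: nat \<times> nat \<Rightarrow> nat.
              genideal (ring_on R1) I =
                genideal (ring_on R1) {\<Prod>p\<in>param_index t r. x1 p ^ a p}))) \<and>
     (\<forall>f\<in>val_ring \<nu>. f \<noteq> 0 \<longrightarrow>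
        (\<exists>R1 x1. transform_sequence k \<nu> t \<Gamma> r (R, x) (R1, x1) \<and>
           very_good k \<nu> t \<Gamma> r R1 x1 \<and>
           (\<exists>(a :: nat \<times> nat \<Rightarrow> nat) u. u \<in> Units (ring_on R1) \<and>
              f = (\<Prod>p\<in>param_index t r. x1 p ^ a p) * u)))"
proof -
  interpret valued_field \<nu> by (rule valuation_over_valued_field[OF assms(2)])
  interpret valuation_chain \<nu> t \<Gamma> r
    by (rule isolated_chain_valuation_chain[OF valued_field_axioms assms(4)])
  note alg = assms(6) and P = assms(5)
  have F: "framed R x" by (rule framedI[OF assms(7) alg assms(8,9,10) P])
  note A = framed_subring[OF F]
  have good: "framed R1 x1 \<and> R \<subseteq> R1 \<and> transform_sequence k \<nu> t \<Gamma> r (R, x) (R1, x1) \<and> very_good k \<nu> t \<Gamma> r R1 x1 \<and>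
      cond_A1 \<nu> t \<Gamma> P r R1 x1 \<and> cond_A2 \<nu> t P R1" if "prim_steps (R, x) (R1, x1)" for R1 x1
  proof -
    have F1: "framed R1 x1" "R \<subseteq> R1" using prim_steps_framed[OF that F] by auto
    have "transform_sequence k \<nu> t \<Gamma> r (R, x) (R1, x1)" "algebraic_local_ring k R1"
      using prim_steps_transform_sequence[OF that F alg] by auto
    then show ?thesis using F1 framed_very_good framed_cond_A1[OF F1(1) P] cond_A2_transfer[OF F F1(1) P assms(11) F1(2)] by blast
  qed
  have unit: "u \<in> Units (ring_on R1)" if "framed R1 x1" "u \<in> R1" "u \<noteq> 0" "\<nu> u = 0" for R1 x1 u
    using Units_ring_on[OF framed_subring[OF that(1)]] framed_inverse[OF that] that by blast
  show ?thesis
  proof (intro conjI ballI allI impI)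
    fix f assume f: "f \<in> R" "f \<noteq> 0"
    obtain R1 x1 \<mu> u where 1: "prim_steps (R, x) (R1, x1)" "\<mu> \<in> monomials x1" "u \<in> R1" "u \<noteq> 0" "\<nu> u = 0" "f = \<mu> * u"
      using monomialize[OF F f] by blast
    obtain a where a: "\<mu> = (\<Prod>p\<in>J. x1 p ^ a p)" using monomial_exponents[OF 1(2)] .
    have "u \<in> Units (ring_on R1)" using unit[OF _ 1(3-5)] good[OF 1(1)] by blast
    then show "\<exists>R1 x1. transform_sequence k \<nu> t \<Gamma> r (R, x) (R1, x1) \<and> very_good k \<nu> t \<Gamma> r R1 x1 \<and> 
        cond_A1 \<nu> t \<Gamma> P r R1 x1 \<and> cond_A2 \<nu> t P R1 \<and>
        (\<exists>(a :: nat \<times> nat \<Rightarrow> nat) u. u \<in> Units (ring_on R1) \<and> f = (\<Prod>p\<in>J. x1 p ^ a p) * u)"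
      using good[OF 1(1)] 1(6) a by blast
  next
    fix I assume I: "ideal I (ring_on R) \<and> I \<noteq> {0}"
    then have I': "is_ideal R I" "I \<noteq> {0}" using ideal_iff[OF A] by auto
    obtain R1 x1 \<mu> where 1: "prim_steps (R, x) (R1, x1)" "\<mu> \<in> monomials x1" "lspan R1 I = lspan R1 {\<mu>}"
      using principalize_ideal[OF F I'] by blast
    obtain a where a: "\<mu> = (\<Prod>p\<in>J. x1 p ^ a p)" using monomial_exponents[OF 1(2)] .
    have F1: "framed R1 x1" "R \<subseteq> R1" using good[OF 1(1)] by auto
    have "I \<subseteq> R1" "{\<mu>} \<subseteq> R1" using I'(1) F1 monomials_framed(1)[OF F1(1) 1(2)] unfolding is_ideal_def by auto
    then have "genideal (ring_on R1) I = genideal (ring_on R1) {\<Prod>p\<in>J. x1 p ^ a p}"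
      using 1(3) a genideal_eq[OF framed_subring[OF F1(1)]] by simp
    then show "\<exists>R1 x1. transform_sequence k \<nu> t \<Gamma> r (R, x) (R1, x1) \<and> very_good k \<nu> t \<Gamma> r R1 x1 \<and>
        (\<exists>a :: nat \<times> nat \<Rightarrow> nat. genideal (ring_on R1) I = genideal (ring_on R1) {\<Prod>p\<in>J. x1 p ^ a p})"
      using good[OF 1(1)] by blast
  next
    fix f assume f: "f \<in> val_ring \<nu>" "f \<noteq> 0"
    then have f0: "0 \<le> \<nu> f" by (simp add: val_ring_def)
    obtain g h where gh: "g \<in> R" "h \<in> R" "h \<noteq> 0" "f = g / h" using alg unfolding algebraic_local_ring_def by blast
    obtain R1 x1 \<mu> u where 1: "prim_steps (R, x) (R1, x1)" "\<mu> \<in> monomials x1" "u \<in> R1" "u \<noteq> 0" "\<nu> u = 0" "f = \<mu> * u"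
      using monomialize_fraction[OF F gh f(2) f0] by blast
    obtain a where a: "\<mu> = (\<Prod>p\<in>J. x1 p ^ a p)" using monomial_exponents[OF 1(2)] .
    have "u \<in> Units (ring_on R1)" using unit[OF _ 1(3-5)] good[OF 1(1)] by blast
    then show "\<exists>R1 x1. transform_sequence k \<nu> t \<Gamma> r (R, x) (R1, x1) \<and> very_good k \<nu> t \<Gamma> r R1 x1 \<and>
        (\<exists>(a :: nat \<times> nat \<Rightarrow> nat) u. u \<in> Units (ring_on R1) \<and> f = (\<Prod>p\<in>J. x1 p ^ a p) * u)"
      using good[OF 1(1)] 1(6) a by blast
  qed
qed

end
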